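(* Let $k$ be a perfect field of characteristic $p>0$ and let $g\in R=k[x_1,\dots,x_n]$ be a non-constant polynomial. Then the set of roots of the $b$-function $b_g$ of $g$, a priori a subset of $\mathbb{Z}_p$, is a finite set of strictly negative rational numbers, and each root is $\geq -1$.
   Context: Let $k$ be a field of characteristic $p>0$, $R$ a smooth commutative $k$-algebra, $f\in R$. $D_R$ is the ring of Grothendieck ($k$-linear) differential operators of $R$, and similarly $D_{R[t]}$ for the polynomial ring $R[t]$. For $e\ge 0$, $\frac{d}{dt}^{[p^e]}\in D_{R[t]}$ is the $R$-linear divided power operator with $\frac{d}{dt}^{[p^e]}(t^n)=\binom{n}{p^e}t^{n-p^e}$ (with $\binom{n}{m}=0$ for $n<m$), and $\nu_e:=\frac{d}{dt}^{[p^e]}\,t^{p^e}$ is the $e$-th higher Euler operator. $D_R[\nu_e;e\in\mathbb{N}]\subset D_{R[t]}$ is the subring generated by $D_R$ and all $\nu_e$. $B_f:=R[t][\frac{1}{f-t}]/R[t]$ (a left $D_{R[t]}$-module), $\delta_f\in B_f$ is the class of $\frac{1}{f-t}$, $M_f:=D_R[\nu_e;e\in\mathbb{N}]\,\delta_f\subset B_f$. The subset $tM_f$ is a $D_R[\nu_e;e\in\mathbb{N}]$-submodule of $M_f$, and $N_f:=M_f/tM_f$. Let $A_k$ be the $k$-algebra of functions $\mathbb{N}\to k$ generated by the binomial coefficient functions $\binom{s}{n}: l\mapsto\binom{l}{n} \bmod p$; it is generated by the $\binom{s}{p^e}$, $e\ge0$. $N_f^\gamma$ is $N_f$ viewed as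 an $A_k$-module with $\binom{s}{p^e}$ acting as $-\nu_e$ (this is well defined). The $b$-function $b_f$ is the annihilator of $N_f^\gamma$ in $A_k$, an ideal of $A_k$. Roots: the maximal ideals of $A_k$ are in bijection with $\mathbb{Z}_p$, the $p$-adic integer $z=\sum_{e\ge0}z_ep^e$ ($0\le z_e\le p-1$) corresponding to the ideal $\mathfrak{m}_z$ generated by $\{\binom{s}{p^e}-z_e;\ e\ge0\}$. The roots of an ideal $I\subset A_k$ are the $z\in\mathbb{Z}_p$ with $I\subset\mathfrak{m}_z$. Rational numbers in $\mathbb{Z}_{(p)}$ are regarded as elements of $\mathbb{Z}_p$. *)

theory Defs
  imports
    "HOL-Library.Poly_Mapping"
    "HOL-Library.Set_Algebras"
    "HOL-Library.FuncSet"
    "HOL-Computational_Algebra.Polynomial_Factorial"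
    "HOL-Algebra.Module"
    "HOL-Algebra.Ideal"
begin

section \<open>Polynomial rings\<close>

text \<open>
  The type \<open>('n, 'k) mpol\<close> is the polynomial ring over \<open>'k\<close> with one variable for each element of
  the finite type \<open>'n\<close>. The order on \<open>'n\<close> is used only because the library's integral domain
  instance for \<^type>\<open>poly_mapping\<close> asks for it. Writing \<open>R\<close> for this ring, \<open>R[t]\<close> is
  \<open>('n, 'k) mpol poly\<close>.
\<close>

type_synonym ('n, 'k) mpol = "('n \<Rightarrow>\<^sub>0 nat) \<Rightarrow>\<^sub>0 'k"

definition mconst :: "'k::zero \<Rightarrow> ('n, 'k) mpol" where
  "mconst c = Poly_Mapping.single 0 c"

text \<open>Perfectness of a field of characteristic \<open>p > 0\<close>: the Frobenius map is onto.\<close>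

definition perfect_pos_char :: "'k::field itself \<Rightarrow> bool" where
  "perfect_pos_char _ \<longleftrightarrow> CHAR('k) > 0 \<and> surj (\<lambda>x::'k. x ^ CHAR('k))"


section \<open>Grothendieck differential operators\<close>

text \<open>
  \<open>S\<close> is a subring of the ambient ring and a \<open>k\<close>-algebra through \<open>\<iota> : k \<rightarrow> S\<close>.
  Maps on \<open>S\<close> are extensional, so that two of them are equal iff they agree on \<open>S\<close>.
\<close>

definition lin_endos :: "('k \<Rightarrow> 'a::comm_ring_1) \<Rightarrow> 'a set \<Rightarrow> ('a \<Rightarrow> 'a) set" where
  "lin_endos \<iota> S = {P \<in> S \<rightarrow>\<^sub>E S.
     (\<forall>x\<in>S. \<forall>y\<in>S. P (x + y) = P x + P y) \<and> (\<forall>c. \<forall>x\<in>S. P (\<iota> c * x) = \<iota> c * P x)}"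

primrec diff_ops_le :: "('k \<Rightarrow> 'a::comm_ring_1) \<Rightarrow> 'a set \<Rightarrow> nat \<Rightarrow> ('a \<Rightarrow> 'a) set" where
  "diff_ops_le \<iota> S 0 = {P \<in> lin_endos \<iota> S. \<forall>a\<in>S. \<forall>x\<in>S. P (a * x) = a * P x}"
| "diff_ops_le \<iota> S (Suc n) =
     {P \<in> lin_endos \<iota> S. \<forall>a\<in>S. (\<lambda>x\<in>S. P (a * x) - a * P x) \<in> diff_ops_le \<iota> S n}"

definition diff_ops :: "('k \<Rightarrow> 'a::comm_ring_1) \<Rightarrow> 'a set \<Rightarrow> ('a \<Rightarrow> 'a) set" where
  "diff_ops \<iota> S = (\<Union>n. diff_ops_le \<iota> S n)"

text \<open>The \<open>m\<close>-th divided power of \<open>d/dt\<close>, i.e. \<open>t\<^sup>i \<mapsto> (i choose m) t\<^bsup>i - m\<^esup>\<close>.\<close>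

definition divided_deriv :: "nat \<Rightarrow> 'r::comm_ring_1 poly \<Rightarrow> 'r poly" where
  "divided_deriv m q = (\<Sum>i\<le>degree q. monom (of_nat (i choose m) * coeff q i) (i - m))"

definition euler_op :: "nat \<Rightarrow> nat \<Rightarrow> 'r::comm_ring_1 poly \<Rightarrow> 'r poly" where
  "euler_op p e = (\<lambda>q. divided_deriv (p ^ e) (monom 1 (p ^ e) * q))"

text \<open>
  The ring \<open>D\<^sub>R[\<nu>\<^sub>e; e \<in> \<nat>]\<close>. An operator \<open>P\<close> on \<open>R\<close> is regarded as an operator on \<open>R[t]\<close> by
  applying it to the coefficients.
\<close>

inductive_set DR_euler ::
  "(('n::{finite,linorder}, 'k::field) mpol poly \<Rightarrow> ('n, 'k) mpol poly) set" where
  "P \<in> diff_ops mconst UNIV \<Longrightarrow> map_poly P \<in> DR_euler"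
| "euler_op CHAR('k) e \<in> DR_euler"
| "P \<in> DR_euler \<Longrightarrow> Q \<in> DR_euler \<Longrightarrow> (\<lambda>q. P q + Q q) \<in> DR_euler"
| "P \<in> DR_euler \<Longrightarrow> (\<lambda>q. - P q) \<in> DR_euler"
| "P \<in> DR_euler \<Longrightarrow> Q \<in> DR_euler \<Longrightarrow> P \<circ> Q \<in> DR_euler"


section \<open>The modules \<open>B\<^sub>f\<close>, \<open>M\<^sub>f\<close> and \<open>N\<^sub>f\<close>\<close>

text \<open>
  \<open>R[t][1/(f-t)]\<close> is realised inside the fraction field of \<open>R[t]\<close>; the polynomial \<open>f - t\<close>
  in \<open>t\<close> has the coefficient list \<open>[:f, -1:]\<close>.
\<close>

definition loc_ring :: "('n::{finite,linorder}, 'k::field) mpol \<Rightarrow> ('n, 'k) mpol poly fract set" where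
  "loc_ring f = {Fract a ([:f, -1:] ^ m) | a m. True}"

abbreviation Rt :: "('n::{finite,linorder}, 'k::field) mpol poly fract set" where
  "Rt \<equiv> range to_fract"

text \<open>
  A differential operator of \<open>R[t]\<close> extends uniquely to a differential operator of the
  localization, and this is how it acts there.
\<close>

definition loc_ext :: "('n::{finite,linorder}, 'k::field) mpol \<Rightarrow>
    (('n, 'k) mpol poly \<Rightarrow> ('n, 'k) mpol poly) \<Rightarrow>
    ('n, 'k) mpol poly fract \<Rightarrow> ('n, 'k) mpol poly fract" where
  "loc_ext f P = (THE Q. Q \<in> diff_ops (\<lambda>c. to_fract [:mconst c:]) (loc_ring f) \<and>
     (\<forall>q. Q (to_fract q) = to_fract (P q)))"

text \<open>
  Elements of \<open>B\<^sub>f\<close> are cosets \<open>u +o Rt\<close> with \<open>u\<close> in \<open>loc_ring f\<close>, and elements of \<open>N\<^sub>f\<close>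
  are cosets \<open>X +o tM_mod f\<close> with \<open>X\<close> in \<open>M_mod f\<close>. At both levels the sum of cosets is the
  elementwise sum of sets from \<^theory>\<open>HOL-Library.Set_Algebras\<close>. In \<open>B_act\<close> and \<open>N_act\<close>
  all sets in the union are the same coset.
\<close>

definition B_act :: "('n::{finite,linorder}, 'k::field) mpol \<Rightarrow>
    (('n, 'k) mpol poly \<Rightarrow> ('n, 'k) mpol poly) \<Rightarrow>
    ('n, 'k) mpol poly fract set \<Rightarrow> ('n, 'k) mpol poly fract set" where
  "B_act f P X = (\<Union>u\<in>X. loc_ext f P u +o Rt)"

definition delta :: "('n::{finite,linorder}, 'k::field) mpol \<Rightarrow> ('n, 'k) mpol poly fract set" where
  "delta f = Fract 1 [:f, -1:] +o Rt"

definition M_mod :: "('n::{finite,linorder}, 'k::field) mpol \<Rightarrow> ('n, 'k) mpol poly fract set set" where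
  "M_mod f = (\<lambda>P. B_act f P (delta f)) ` DR_euler"

definition tM_mod :: "('n::{finite,linorder}, 'k::field) mpol \<Rightarrow> ('n, 'k) mpol poly fract set set" where
  "tM_mod f = B_act f (\<lambda>q. [:0, 1:] * q) ` M_mod f"

definition N_mod :: "('n::{finite,linorder}, 'k::field) mpol \<Rightarrow> ('n, 'k) mpol poly fract set set set" where
  "N_mod f = (\<lambda>X. X +o tM_mod f) ` M_mod f"

definition N_act :: "('n::{finite,linorder}, 'k::field) mpol \<Rightarrow>
    (('n, 'k) mpol poly \<Rightarrow> ('n, 'k) mpol poly) \<Rightarrow>
    ('n, 'k) mpol poly fract set set \<Rightarrow> ('n, 'k) mpol poly fract set set" where
  "N_act f P Y = (\<Union>X\<in>Y. B_act f P X +o tM_mod f)"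


section \<open>The algebra \<open>A\<^sub>k\<close> and the \<open>b\<close>-function\<close>

definition binom_fun :: "nat \<Rightarrow> nat \<Rightarrow> 'k::field" where
  "binom_fun n = (\<lambda>l. of_nat (l choose n))"

inductive_set binom_functions :: "(nat \<Rightarrow> 'k::field) set" where
  "(\<lambda>_. c) \<in> binom_functions"
| "binom_fun n \<in> binom_functions"
| "a \<in> binom_functions \<Longrightarrow> b \<in> binom_functions \<Longrightarrow> (\<lambda>l. a l + b l) \<in> binom_functions"
| "a \<in> binom_functions \<Longrightarrow> b \<in> binom_functions \<Longrightarrow> (\<lambda>l. a l * b l) \<in> binom_functions"

definition binom_alg :: "(nat \<Rightarrow> 'k::field) ring" where
  "binom_alg = \<lparr>carrier = binom_functions,
     monoid.mult = (\<lambda>a b l. a l * b l), one = (\<lambda>_. 1),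
     ring.zero = (\<lambda>_. 0), add = (\<lambda>a b l. a l + b l)\<rparr>"

text \<open>
  \<open>N\<^sub>f\<close> with scalar multiplication \<open>sm\<close>. The fields for a ring multiplication and its unit are
  part of the record type but play no role for modules.
\<close>

definition N_record :: "('n::{finite,linorder}, 'k::field) mpol \<Rightarrow>
    ((nat \<Rightarrow> 'k) \<Rightarrow> ('n, 'k) mpol poly fract set set \<Rightarrow> ('n, 'k) mpol poly fract set set) \<Rightarrow>
    (nat \<Rightarrow> 'k, ('n, 'k) mpol poly fract set set) module" where
  "N_record f sm = \<lparr>carrier = N_mod f, monoid.mult = undefined, one = undefined,
     ring.zero = tM_mod f, add = (+), smult = sm\<rparr>"

text \<open>
  The scalar multiplication of \<open>N\<^sub>f\<^sup>\<gamma>\<close>: the unique \<open>A\<^sub>k\<close>-module structure on \<open>N\<^sub>f\<close> that extends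
  its \<open>k\<close>-vector space structure and in which \<open>binom_fun (p ^ e)\<close> acts as \<open>- \<nu>\<^sub>e\<close>.
\<close>

definition gamma_smult :: "('n::{finite,linorder}, 'k::field) mpol \<Rightarrow>
    (nat \<Rightarrow> 'k) \<Rightarrow> ('n, 'k) mpol poly fract set set \<Rightarrow> ('n, 'k) mpol poly fract set set" where
  "gamma_smult f = (THE sm.
     sm \<in> carrier binom_alg \<rightarrow>\<^sub>E (N_mod f \<rightarrow>\<^sub>E N_mod f) \<and>
     module binom_alg (N_record f sm) \<and>
     (\<forall>c. \<forall>Y\<in>N_mod f. sm (\<lambda>_. c) Y = N_act f (\<lambda>q. [:mconst c:] * q) Y) \<and>
     (\<forall>e. \<forall>Y\<in>N_mod f. sm (binom_fun (CHAR('k) ^ e)) Y = N_act f (\<lambda>q. - euler_op CHAR('k) e q) Y))"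

definition N_gamma :: "('n::{finite,linorder}, 'k::field) mpol \<Rightarrow>
    (nat \<Rightarrow> 'k, ('n, 'k) mpol poly fract set set) module" where
  "N_gamma f = N_record f (gamma_smult f)"

definition annihilator :: "('a, 'c) ring_scheme \<Rightarrow> ('a, 'b, 'd) module_scheme \<Rightarrow> 'a set" where
  "annihilator A N = {a \<in> carrier A. \<forall>x\<in>carrier N. a \<odot>\<^bsub>N\<^esub> x = \<zero>\<^bsub>N\<^esub>}"

definition b_function :: "('n::{finite,linorder}, 'k::field) mpol \<Rightarrow> (nat \<Rightarrow> 'k) set" where
  "b_function f = annihilator binom_alg (N_gamma f)"


section \<open>Roots\<close>

text \<open>
  A \<open>p\<close>-adic integer \<open>z = \<Sum>\<^sub>e z\<^sub>e p\<^sup>e\<close> is represented by its sequence of digits \<open>0 \<le> z\<^sub>e < p\<close>.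
\<close>

definition padic_ints :: "nat \<Rightarrow> (nat \<Rightarrow> nat) set" where
  "padic_ints p = {z. \<forall>e. z e < p}"

definition root_ideal :: "(nat \<Rightarrow> nat) \<Rightarrow> (nat \<Rightarrow> 'k::field) set" where
  "root_ideal z =
     Idl\<^bsub>binom_alg\<^esub> {(\<lambda>l. binom_fun (CHAR('k) ^ e) l - of_nat (z e)) | e. True}"

definition roots :: "(nat \<Rightarrow> 'k::field) set \<Rightarrow> (nat \<Rightarrow> nat) set" where
  "roots I = {z \<in> padic_ints CHAR('k). I \<subseteq> root_ideal z}"

text \<open>The local ring \<open>\<int>\<^sub>(\<^sub>p\<^sub>)\<close> of rationals whose reduced denominator is prime to the prime \<open>p\<close>.\<close>

definition Z_loc :: "nat \<Rightarrow> rat set" where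
  "Z_loc p = {r. \<not> int p dvd snd (quotient_of r)}"

text \<open>
  \<open>r\<close>, regarded as a \<open>p\<close>-adic integer, equals \<open>z\<close>: the partial sums of \<open>\<Sum>\<^sub>e z\<^sub>e p\<^sup>e\<close>
  approximate \<open>r\<close> modulo every power of \<open>p\<close>.
\<close>

definition padic_eq_rat :: "nat \<Rightarrow> (nat \<Rightarrow> nat) \<Rightarrow> rat \<Rightarrow> bool" where
  "padic_eq_rat p z r \<longleftrightarrow> z \<in> padic_ints p \<and> r \<in> Z_loc p \<and>
     (\<forall>m. \<exists>u\<in>Z_loc p. r - (\<Sum>e<m. of_nat (z e) * of_nat p ^ e) = of_nat p ^ m * u)"

end

theory Submission
  imports Defs
begin

text \<open>
  Write \<open>R = k[x\<^sub>1, \<dots>, x\<^sub>n]\<close>, and for \<open>q = p\<^sup>e\<close> let \<open>D\<^sup>e\<close> be the ring of additive maps on \<open>R\<close> that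
  commute with multiplication by \<open>q\<close>-th powers. The whole argument is about the sets \<open>J\<^sub>e\<close>
  (\<open>jumps\<close> below) of those \<open>j < q\<close> for which \<open>g\<^sup>j\<close> is not of the form \<open>P (g\<^sup>j\<^sup>+\<^sup>1)\<close> with \<open>P \<in> D\<^sup>e\<close>.
  They play the role of the \<open>F\<close>-jumping exponents of \<open>g\<close>.

  \<^emph>\<open>The roots are limits of jumps.\<close> Since \<open>g\<^sup>q - t\<^sup>q = (g - t)\<^sup>q\<close>, the class of \<open>1/(g - t)\<close> equals
  \<open>\<Sum>\<^sub>j g\<^sup>j t\<^bsup>q - 1 - j\<^esup> / (g - t)\<^sup>q\<close>, and the Euler operators \<open>\<nu>\<^sub>0, \<dots>, \<nu>\<^bsub>e - 1\<^esub>\<close> are diagonal on the powers of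
  \<open>t\<close>. The idempotent of \<open>A\<^sub>k\<close> that is the indicator of the residue class of \<open>j\<close> modulo \<open>q\<close> therefore
  maps the generator to the single summand with index \<open>j\<close>. If \<open>g\<^sup>j = P (g\<^sup>j\<^sup>+\<^sup>1)\<close>, this summand is
  \<open>t\<close> times \<open>P\<close> applied to the summand with index \<open>j + 1\<close> (for \<open>j = q - 1\<close>: to the one with index \<open>0\<close>, up
  to an element of \<open>R[t]\<close>), so it vanishes in \<open>N\<^sub>g\<close>. Hence the idempotent lies in the \<open>b\<close>-function
  (\<open>not_jump_annihilates\<close>), and a root \<open>z\<close> must satisfy \<open>z mod p\<^sup>e \<in> J\<^sub>e\<close> for all \<open>e\<close> (\<open>roots_subset\<close>).

  \<^emph>\<open>There are few jumps, and they form a self-similar system.\<close> The number of elements of \<open>J\<^sub>e\<close> is bounded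
  independently of \<open>e\<close>: the \<open>q\<close>-th roots of the coordinates of \<open>g\<^sup>j\<close> over \<open>R\<^sup>q\<close> have exponents bounded by those
  of \<open>g\<close>, and each jump is a strict step in a descending chain of subspaces of one finite-dimensional
  space (\<open>card_jumps_le\<close>). Reading \<open>j\<close> as a word of \<open>e\<close> digits, \<open>J\<^sub>e\<close> is stable under deleting the leading
  digit (an operator in \<open>D\<^sup>e\<close> is also in \<open>D\<^bsup>e + 1\<^esup>\<close>), under deleting the last digit, and every word in it can be
  continued by a new last digit. The last two properties come from conjugating operators with the
  Frobenius map and a splitting of it (\<open>jumps_div\<close>, \<open>jumps_lift\<close>).

  \<^emph>\<open>Limits are rational.\<close> By the bound, the set \<open>Z\<close> of \<open>p\<close>-adic integers all of whose truncations are jumps is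
  finite. The shift of digit sequences maps \<open>Z\<close> to itself, and onto it by the continuation
  property; so it permutes the finite set \<open>Z\<close> and every \<open>z \<in> Z\<close> is purely periodic, that is
  \<open>z = - N / (p\<^sup>b - 1)\<close> with \<open>0 \<le> N \<le> p\<^sup>b - 1\<close>. Finally \<open>z = 0\<close> is impossible, because \<open>1\<close> is an image of
  \<open>g \<noteq> 0\<close> under \<open>D\<^sup>e\<close> once \<open>p\<^sup>e\<close> exceeds all exponents of \<open>g\<close> (\<open>zero_not_jump\<close>).

  Making this precise for the given objects needs two descriptions. In characteristic \<open>p\<close>, the
  Grothendieck differential operators of a finitely generated algebra are the linear maps that commute with
  \<open>p\<^sup>e\<close>-th powers for some \<open>e\<close>; this yields both \<open>D\<^sub>R\<close> and the extension of operators to the localization.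
  And \<open>A\<^sub>k\<close> is the algebra of functions that are periodic modulo a power of \<open>p\<close>, which makes its action on
  \<open>N\<^sub>g\<close> explicit and unique.
\<close>

section \<open>Differential operators in positive characteristic\<close>

inductive_set alg_gen :: "('k \<Rightarrow> 'a::comm_ring_1) \<Rightarrow> 'a set \<Rightarrow> 'a set" for \<iota> G where
  gen_const: "\<iota> c \<in> alg_gen \<iota> G"
| gen_base: "g \<in> G \<Longrightarrow> g \<in> alg_gen \<iota> G"
| gen_add: "a \<in> alg_gen \<iota> G \<Longrightarrow> b \<in> alg_gen \<iota> G \<Longrightarrow> a + b \<in> alg_gen \<iota> G"
| gen_mult: "a \<in> alg_gen \<iota> G \<Longrightarrow> b \<in> alg_gen \<iota> G \<Longrightarrow> a * b \<in> alg_gen \<iota> G"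

locale const_subalgebra =
  fixes \<iota> :: "'k \<Rightarrow> 'a::comm_ring_1" and S :: "'a set"
  assumes const_mem: "\<iota> c \<in> S"
    and one_mem: "1 \<in> S"
    and add_mem: "x \<in> S \<Longrightarrow> y \<in> S \<Longrightarrow> x + y \<in> S"
    and minus_mem: "x \<in> S \<Longrightarrow> - x \<in> S"
    and mult_mem: "x \<in> S \<Longrightarrow> y \<in> S \<Longrightarrow> x * y \<in> S"
begin

lemma zero_mem: "0 \<in> S"
  using add_mem[OF one_mem minus_mem[OF one_mem]] by simp

lemma diff_mem: "x \<in> S \<Longrightarrow> y \<in> S \<Longrightarrow> x - y \<in> S"
  using add_mem[OF _ minus_mem] by (metis diff_conv_add_uminus)

text \<open>
  Differential operators are restricted to the subring, so that equality of functions is equality of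
  operators; the commutator and the operations below carry the same restriction.
\<close>

definition ad :: "'a \<Rightarrow> ('a \<Rightarrow> 'a) \<Rightarrow> 'a \<Rightarrow> 'a" where
  "ad a P = (\<lambda>x\<in>S. P (a * x) - a * P x)"

lemma lin_endosD:
  assumes "P \<in> lin_endos \<iota> S"
  shows "x \<in> S \<Longrightarrow> P x \<in> S" "x \<notin> S \<Longrightarrow> P x = undefined"
    "x \<in> S \<Longrightarrow> y \<in> S \<Longrightarrow> P (x + y) = P x + P y"
    "x \<in> S \<Longrightarrow> P (\<iota> c * x) = \<iota> c * P x"
  using assms by (auto simp: lin_endos_def PiE_def Pi_def extensional_def)

lemma lin_endosI:
  assumes "\<And>x. x \<in> S \<Longrightarrow> P x \<in> S" "\<And>x. x \<notin> S \<Longrightarrow> P x = undefined"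
    "\<And>x y. x \<in> S \<Longrightarrow> y \<in> S \<Longrightarrow> P (x + y) = P x + P y"
    "\<And>c x. x \<in> S \<Longrightarrow> P (\<iota> c * x) = \<iota> c * P x"
  shows "P \<in> lin_endos \<iota> S"
  using assms by (auto simp: lin_endos_def PiE_def Pi_def extensional_def)

lemma ad_apply: "x \<in> S \<Longrightarrow> ad a P x = P (a * x) - a * P x"
  by (simp add: ad_def)

lemma ad_lin:
  assumes P: "P \<in> lin_endos \<iota> S" and a: "a \<in> S"
  shows "ad a P \<in> lin_endos \<iota> S"
proof (rule lin_endosI)
  fix c x assume x: "x \<in> S"
  have "ad a P (\<iota> c * x) = P (\<iota> c * (a * x)) - a * P (\<iota> c * x)"
    using x const_mem[of c] by (simp add: ad_def mult_mem mult.left_commute[of a])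
  also have "\<dots> = \<iota> c * P (a * x) - a * (\<iota> c * P x)"
    using x a by (simp only: lin_endosD(4)[OF P] mult_mem)
  also have "\<dots> = \<iota> c * ad a P x" using x by (simp add: ad_def algebra_simps)
  finally show "ad a P (\<iota> c * x) = \<iota> c * ad a P x" .
qed (use a in \<open>auto simp: ad_def mult_mem add_mem diff_mem lin_endosD[OF P] algebra_simps\<close>)

definition op_add where "op_add P Q = (\<lambda>x\<in>S. P x + Q x :: 'a)"
definition op_lmult where "op_lmult b P = (\<lambda>x\<in>S. b * P x :: 'a)"
definition op_rmult where "op_rmult b P = (\<lambda>x\<in>S. P (b * x) :: 'a)"
definition op_zero :: "'a \<Rightarrow> 'a" where "op_zero = (\<lambda>x\<in>S. 0)"

lemma op_lin:
  assumes "P \<in> lin_endos \<iota> S" "Q \<in> lin_endos \<iota> S" "b \<in> S"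
  shows "op_add P Q \<in> lin_endos \<iota> S" "op_lmult b P \<in> lin_endos \<iota> S"
    "op_rmult b P \<in> lin_endos \<iota> S"
proof -
  note [simp] = lin_endosD[OF assms(1)] lin_endosD[OF assms(2)] assms(3)
  show "op_add P Q \<in> lin_endos \<iota> S" "op_lmult b P \<in> lin_endos \<iota> S"
    by (rule lin_endosI;
      simp add: op_add_def op_lmult_def add_mem mult_mem const_mem distrib_left mult.left_commute add_ac)+
  show "op_rmult b P \<in> lin_endos \<iota> S"
  proof (rule lin_endosI)
    fix c x assume x: "x \<in> S"
    show "op_rmult b P (\<iota> c * x) = \<iota> c * op_rmult b P x"
      using x by (simp add: op_rmult_def const_mem mult_mem mult.left_commute[of b])
  qed (simp_all add: op_rmult_def mult_mem add_mem distrib_left)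
qed

lemma op_zero_lin: "op_zero \<in> lin_endos \<iota> S"
  by (rule lin_endosI) (auto simp: op_zero_def add_mem mult_mem const_mem zero_mem)

lemma diff_ops_le_lin: "P \<in> diff_ops_le \<iota> S n \<Longrightarrow> P \<in> lin_endos \<iota> S"
  by (cases n) auto

lemma diff_ops_le_0_iff:
  "P \<in> diff_ops_le \<iota> S 0 \<longleftrightarrow> P \<in> lin_endos \<iota> S \<and> (\<forall>a\<in>S. ad a P = op_zero)"
  by (auto simp: ad_def op_zero_def fun_eq_iff)

lemma diff_ops_le_Suc_iff:
  "P \<in> diff_ops_le \<iota> S (Suc n) \<longleftrightarrow> P \<in> lin_endos \<iota> S \<and> (\<forall>a\<in>S. ad a P \<in> diff_ops_le \<iota> S n)"
  by (auto simp: ad_def)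

lemma ad_op:
  assumes "a \<in> S" "b \<in> S"
  shows "ad a op_zero = op_zero"
    "ad a (op_add P Q) = op_add (ad a P) (ad a Q)"
    "ad a (op_lmult b P) = op_lmult b (ad a P)"
    "ad a (op_rmult b P) = op_rmult b (ad a P)"
  using assms
  by (auto simp: ad_def op_zero_def op_add_def op_lmult_def op_rmult_def mult_mem
      algebra_simps fun_eq_iff)

lemma ad_sum:
  assumes "a \<in> S" "b \<in> S" "P \<in> lin_endos \<iota> S"
  shows "ad (a + b) P = op_add (ad a P) (ad b P)"
  using assms(1,2) lin_endosD(3)[OF assms(3)]
  by (auto simp: ad_def op_add_def mult_mem algebra_simps fun_eq_iff)

text \<open>
  The Leibniz rule. It reduces statements about all commutators of an operator to commutators with
  generators.
\<close>

lemma ad_mult: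
  assumes "a \<in> S" "b \<in> S"
  shows "ad (a * b) P = op_add (op_rmult b (ad a P)) (op_lmult a (ad b P))"
  using assms
  by (auto simp: ad_def op_zero_def op_add_def op_lmult_def op_rmult_def mult_mem add_mem
      algebra_simps fun_eq_iff)

lemma ad_commute:
  assumes "a \<in> S" "b \<in> S"
  shows "ad a (ad b P) = ad b (ad a P)"
  using assms by (auto simp: ad_def mult_mem algebra_simps fun_eq_iff)

lemma ad_const:
  assumes "P \<in> lin_endos \<iota> S" shows "ad (\<iota> c) P = op_zero"
  using lin_endosD[OF assms] by (auto simp: ad_def op_zero_def)

lemma op_zero_ops:
  "op_add op_zero op_zero = op_zero"
  "b \<in> S \<Longrightarrow> op_lmult b op_zero = op_zero" "b \<in> S \<Longrightarrow> op_rmult b op_zero = op_zero"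
  by (auto simp: op_zero_def op_add_def op_lmult_def op_rmult_def mult_mem fun_eq_iff)

lemma diff_ops_le_zero: "op_zero \<in> diff_ops_le \<iota> S n"
proof (induction n)
  case 0 show ?case by (simp only: diff_ops_le_0_iff) (simp add: ad_op(1) op_zero_lin)
next
  case (Suc n) then show ?case
    by (simp only: diff_ops_le_Suc_iff) (simp add: ad_op(1) op_zero_lin)
qed

lemma diff_ops_le_add:
  "P \<in> diff_ops_le \<iota> S n \<Longrightarrow> Q \<in> diff_ops_le \<iota> S n \<Longrightarrow> op_add P Q \<in> diff_ops_le \<iota> S n"
proof (induction n arbitrary: P Q)
  case 0 then show ?case
    unfolding diff_ops_le_0_iff by (simp add: ad_op(2)[OF _ one_mem] op_lin(1)[OF _ _ one_mem] op_zero_ops(1))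
next
  case (Suc n) then show ?case
    unfolding diff_ops_le_Suc_iff by (simp add: ad_op(2)[OF _ one_mem] op_lin(1)[OF _ _ one_mem])
qed

lemma diff_ops_le_mult:
  "P \<in> diff_ops_le \<iota> S n \<Longrightarrow> b \<in> S \<Longrightarrow>
    op_lmult b P \<in> diff_ops_le \<iota> S n \<and> op_rmult b P \<in> diff_ops_le \<iota> S n"
proof (induction n arbitrary: P)
  case 0 then show ?case
    unfolding diff_ops_le_0_iff by (simp add: ad_op(3,4) op_lin(2,3)[OF _ op_zero_lin] op_zero_ops(2,3))
next
  case (Suc n) then show ?case
    unfolding diff_ops_le_Suc_iff by (simp add: ad_op(3,4) op_lin(2,3)[OF _ op_zero_lin])
qed

lemma alg_gen_subset: "G \<subseteq> S \<Longrightarrow> alg_gen \<iota> G \<subseteq> S"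
proof
  fix x assume "x \<in> alg_gen \<iota> G" "G \<subseteq> S"
  then show "x \<in> S" by induction (auto intro: const_mem add_mem mult_mem)
qed

lemma diff_ops_leI_generators:
  assumes G: "G \<subseteq> S" "S \<subseteq> alg_gen \<iota> G" and P: "P \<in> lin_endos \<iota> S"
    and gen: "\<And>g. g \<in> G \<Longrightarrow> ad g P \<in> diff_ops_le \<iota> S n"
  shows "P \<in> diff_ops_le \<iota> S (Suc n)"
proof -
  have "ad a P \<in> diff_ops_le \<iota> S n" if "a \<in> alg_gen \<iota> G" for a
    using that
  proof induction
    case (gen_const c) then show ?case using ad_const[OF P] diff_ops_le_zero by simp
  next
    case (gen_base g) then show ?case using gen by blast
  next
    case (gen_add a b)
    then have "a \<in> S" "b \<in> S" using alg_gen_subset[OF G(1)] by auto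
    then show ?case using gen_add ad_sum[OF _ _ P] diff_ops_le_add by simp
  next
    case (gen_mult a b)
    then have "a \<in> S" "b \<in> S" using alg_gen_subset[OF G(1)] by auto
    then show ?case using gen_mult ad_mult diff_ops_le_add diff_ops_le_mult by simp
  qed
  then show ?thesis using G(2) P diff_ops_le_Suc_iff by blast
qed

lemma ad_funpow_lin:
  assumes "P \<in> lin_endos \<iota> S" "a \<in> S" shows "(ad a ^^ n) P \<in> lin_endos \<iota> S"
  by (induction n) (use assms in \<open>auto intro: ad_lin\<close>)

lemma ad_funpow_commute:
  assumes "a \<in> S" "b \<in> S" shows "(ad a ^^ n) (ad b P) = ad b ((ad a ^^ n) P)"
  by (induction n) (use assms ad_commute in auto)

lemma ad_funpow_zero: "a \<in> S \<Longrightarrow> (ad a ^^ n) op_zero = op_zero"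
  by (induction n) (auto simp: ad_op(1))

text \<open>
  Commutators with different elements commute. Hence taking the commutator with a generator \<open>g\<close> lowers the
  exponent of nilpotency at \<open>g\<close> by one and does not raise the others, and induction on the sum of all these
  exponents bounds the order.
\<close>

lemma diff_ops_le_nilpotent:
  assumes G: "G \<subseteq> S" "S \<subseteq> alg_gen \<iota> G" "finite G" "G \<noteq> {}"
    and P: "P \<in> lin_endos \<iota> S"
    and nil: "\<And>g. g \<in> G \<Longrightarrow> (ad g ^^ m g) P = op_zero"
  shows "P \<in> diff_ops_le \<iota> S (sum m G)"
  using P nil
proof (induction "sum m G" arbitrary: m P)
  case 0
  obtain g where g: "g \<in> G" using G(4) by blast
  then have "m g = 0" using 0(1) G(3) by (simp add: sum_eq_0_iff)
  then show ?case using 0(3)[OF g] diff_ops_le_zero by simp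
next
  case (Suc s)
  show ?case
  proof (cases "\<exists>g\<in>G. m g = 0")
    case True
    then show ?thesis using Suc(4) diff_ops_le_zero by force
  next
    case pos: False
    have "P \<in> diff_ops_le \<iota> S (Suc s)"
    proof (rule diff_ops_leI_generators[OF G(1,2) Suc(3)])
      fix g assume g: "g \<in> G"
      then have gS: "g \<in> S" using G(1) by blast
      define m' where "m' = m(g := m g - 1)"
      have "sum m G = m g + sum m (G - {g})" "sum m' G = m' g + sum m' (G - {g})"
        using G(3) g by (auto intro: sum.remove)
      moreover have "sum m' (G - {g}) = sum m (G - {g})"
        by (rule sum.cong) (auto simp: m'_def)
      ultimately have s: "s = sum m' G" using Suc(2) pos g by (auto simp: m'_def)
      have "ad g P \<in> diff_ops_le \<iota> S (sum m' G)"
      proof (rule Suc(1)[OF s])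
        show "ad g P \<in> lin_endos \<iota> S" using ad_lin[OF Suc(3) gS] .
        fix g' assume g': "g' \<in> G"
        then have gS': "g' \<in> S" using G(1) by blast
        show "(ad g' ^^ m' g') (ad g P) = op_zero"
        proof (cases "g' = g")
          case True
          have "m g = Suc (m g - 1)" using pos g by force
          then show ?thesis using Suc(4)[OF g] True
            by (metis fun_upd_same funpow_Suc_right m'_def o_apply)
        next
          case False
          then show ?thesis
            using ad_funpow_commute[OF gS' gS] Suc(4)[OF g'] ad_op(1)[OF gS gS] by (simp add: m'_def)
        qed
      qed
      then show "ad g P \<in> diff_ops_le \<iota> S s" using s by simp
    qed
    then show ?thesis using Suc(2) by simp
  qed
qed

text \<open>
  The \<open>m\<close>-fold commutator with \<open>g\<close> is \<open>(X - g)\<^sup>m\<close>, where \<open>X\<close> stands for multiplication by \<open>g\<close> before the operator is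
  applied and scalars for multiplication afterwards. Phrased with polynomials, binomial identities become
  identities in \<open>'a poly\<close>.
\<close>

lemma ad_funpow_apply:
  assumes g: "g \<in> S" and x: "x \<in> S"
  shows "(ad g ^^ m) P x = (\<Sum>i\<le>m. coeff ([:-g, 1:] ^ m) i * P (g ^ i * x))"
  using x
proof (induction m arbitrary: x)
  case (Suc m)
  define A where "A = [:-g, 1:] ^ m"
  have deg: "degree A \<le> m" unfolding A_def by (rule order_trans[OF degree_power_le]) simp
  have gx: "g * x \<in> S" using g Suc.prems mult_mem by blast
  have 0: "coeff A (Suc m) = 0" using deg by (simp add: coeff_eq_0)
  have "(ad g ^^ Suc m) P x = (ad g ^^ m) P (g * x) - g * (ad g ^^ m) P x"
    using Suc.prems by (simp add: ad_apply)
  also have "\<dots> = (\<Sum>i\<le>m. coeff A i * P (g ^ Suc i * x)) - g * (\<Sum>i\<le>m. coeff A i * P (g ^ i * x))"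
    by (simp add: Suc.IH[OF Suc.prems] Suc.IH[OF gx] A_def mult_ac)
  also have "(\<Sum>i\<le>m. coeff A i * P (g ^ Suc i * x)) =
      (\<Sum>i\<le>Suc m. coeff (pCons 0 A) i * P (g ^ i * x))"
    by (subst sum.atMost_Suc_shift) simp
  also have "g * (\<Sum>i\<le>m. coeff A i * P (g ^ i * x)) = (\<Sum>i\<le>Suc m. coeff (Polynomial.smult g A) i * P (g ^ i * x))"
    using 0 by (simp add: sum_distrib_left mult_ac)
  also have "(\<Sum>i\<le>Suc m. coeff (pCons 0 A) i * P (g ^ i * x)) -
      (\<Sum>i\<le>Suc m. coeff (Polynomial.smult g A) i * P (g ^ i * x)) =
      (\<Sum>i\<le>Suc m. coeff (pCons 0 A - Polynomial.smult g A) i * P (g ^ i * x))"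
    by (simp only: sum_subtractf[symmetric] coeff_diff left_diff_distrib)
  also have "pCons 0 A - Polynomial.smult g A = [:-g, 1:] ^ Suc m"
    by (simp add: A_def)
  finally show ?case .
qed simp

text \<open>
  In characteristic \<open>p\<close> one has \<open>(X - g)\<^sup>q = X\<^sup>q - g\<^sup>q\<close>: the \<open>q\<close>-fold commutator with \<open>g\<close> is the commutator with
  \<open>g\<^sup>q\<close>.
\<close>

lemma ad_funpow_char:
  assumes char: "prime CHAR('a)" and g: "g \<in> S" and x: "x \<in> S"
  shows "(ad g ^^ (CHAR('a) ^ e)) P x = P (g ^ CHAR('a) ^ e * x) - g ^ CHAR('a) ^ e * P x"
proof -
  define q where "q = CHAR('a) ^ e"
  have q0: "q > 0" using char by (simp add: q_def prime_gt_0_nat)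
  have "([:-g, 1:] + [:g:]) ^ q = [:-g, 1:] ^ q + [:g:] ^ q"
    using freshmans_dream'[of q e "[:-g, 1:]" "[:g:]"] char by (simp add: q_def)
  moreover have "[:-g, 1:] + [:g:] = monom 1 1" by (simp add: monom_altdef)
  ultimately have "[:-g, 1:] ^ q = monom 1 1 ^ q - [:g:] ^ q" by (simp add: eq_diff_eq)
  then have "[:-g, 1:] ^ q = monom 1 q - [:g ^ q:]"
    by (simp add: monom_power poly_const_pow)
  then have c: "coeff ([:-g, 1:] ^ q) i = (if i = q then 1 else if i = 0 then - (g ^ q) else 0)" for i
    using q0 by (auto simp: coeff_pCons split: nat.split)
  have "(ad g ^^ q) P x = (\<Sum>i\<le>q. coeff ([:-g, 1:] ^ q) i * P (g ^ i * x))"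
    by (rule ad_funpow_apply[OF g x])
  also have "\<dots> = (\<Sum>i\<in>{0,q}. coeff ([:-g, 1:] ^ q) i * P (g ^ i * x))"
    by (rule sum.mono_neutral_right) (auto simp: c)
  also have "\<dots> = P (g ^ q * x) - g ^ q * P x" using q0 by (simp add: c)
  finally show ?thesis unfolding q_def .
qed

text \<open>
  The \<open>p\<^sup>e\<close>-fold commutator with a generator is the commutator with its \<open>p\<^sup>e\<close>-th power, so commutators with
  generators are nilpotent on such an operator.
\<close>

lemma diff_opsI_char:
  assumes G: "G \<subseteq> S" "S \<subseteq> alg_gen \<iota> G" "finite G" "G \<noteq> {}"
    and char: "prime CHAR('a)" and P: "P \<in> lin_endos \<iota> S"
    and lin: "\<And>g x. g \<in> G \<Longrightarrow> x \<in> S \<Longrightarrow> P (g ^ CHAR('a) ^ e * x) = g ^ CHAR('a) ^ e * P x"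
  shows "P \<in> diff_ops \<iota> S"
proof -
  have "P \<in> diff_ops_le \<iota> S (\<Sum>g\<in>G. CHAR('a) ^ e)"
  proof (rule diff_ops_le_nilpotent[OF G P])
    fix g assume g: "g \<in> G"
    then have gS: "g \<in> S" using G by blast
    show "(ad g ^^ (CHAR('a) ^ e)) P = op_zero"
    proof
      fix x show "(ad g ^^ (CHAR('a) ^ e)) P x = op_zero x"
        using ad_funpow_char[OF char gS, of x e P] lin[OF g, of x]
          lin_endosD(2)[OF ad_funpow_lin[OF P gS], of x]
        by (cases "x \<in> S") (auto simp: op_zero_def)
    qed
  qed
  then show ?thesis unfolding diff_ops_def by blast
qed

lemma ad_funpow_diff_ops_le:
  assumes "P \<in> diff_ops_le \<iota> S n" "a \<in> S" shows "(ad a ^^ Suc n) P = op_zero"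
  using assms
proof (induction n arbitrary: P)
  case 0 then show ?case using diff_ops_le_0_iff by simp
next
  case (Suc n)
  then have "ad a P \<in> diff_ops_le \<iota> S n" using diff_ops_le_Suc_iff by blast
  from Suc.IH[OF this Suc.prems(2)] show ?case by (metis funpow_Suc_right o_apply)
qed

text \<open>
  For an operator of order \<open>n\<close>, the commutator with any element is nilpotent with exponent \<open>n + 1 \<le> p\<^sup>n\<close>.
\<close>

lemma diff_ops_char_linear:
  assumes P: "P \<in> diff_ops \<iota> S" and char: "prime CHAR('a)"
  obtains e where "\<And>a x. a \<in> S \<Longrightarrow> x \<in> S \<Longrightarrow> P (a ^ CHAR('a) ^ e * x) = a ^ CHAR('a) ^ e * P x"
proof -
  obtain n where n: "P \<in> diff_ops_le \<iota> S n" using P unfolding diff_ops_def by blast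
  have "n < CHAR('a) ^ n" using prime_gt_1_nat[OF char] by (simp add: power_gt_expt)
  then have r: "CHAR('a) ^ n = (CHAR('a) ^ n - Suc n) + Suc n" by simp
  have "P (a ^ CHAR('a) ^ n * x) = a ^ CHAR('a) ^ n * P x" if "a \<in> S" "x \<in> S" for a x
  proof -
    have "(ad a ^^ (CHAR('a) ^ n)) P = op_zero"
      by (subst r, subst funpow_add) (use ad_funpow_diff_ops_le[OF n that(1)] ad_funpow_zero[OF that(1)] in simp)
    then show ?thesis using ad_funpow_char[OF char that, of n P] that(2) by (simp add: op_zero_def)
  qed
  then show ?thesis using that by blast
qed

lemma diff_ops_le_Suc_mono: "P \<in> diff_ops_le \<iota> S n \<Longrightarrow> P \<in> diff_ops_le \<iota> S (Suc n)"
proof (induction n arbitrary: P)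
  case 0
  then show ?case unfolding diff_ops_le_Suc_iff diff_ops_le_0_iff
    by (simp add: ad_op(1) op_zero_lin)
next
  case (Suc n)
  then show ?case using diff_ops_le_Suc_iff by blast
qed

lemma diff_ops_le_mono: "m \<le> n \<Longrightarrow> P \<in> diff_ops_le \<iota> S m \<Longrightarrow> P \<in> diff_ops_le \<iota> S n"
  by (induction rule: dec_induct) (auto simp del: diff_ops_le.simps intro: diff_ops_le_Suc_mono)

text \<open>
  By induction on the order the commutators of such an operator with elements of \<open>T\<close> vanish, so it is \<open>T\<close>-linear;
  clearing denominators then gives the claim. This is the uniqueness of the extension of an operator to
  a localization.
\<close>

lemma diff_op_zero_on_localization:
  assumes "P \<in> diff_ops_le \<iota> S n"
    and T: "T \<subseteq> S" "\<And>a b. a \<in> T \<Longrightarrow> b \<in> T \<Longrightarrow> a * b \<in> T"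
    and loc: "\<And>u. u \<in> S \<Longrightarrow> \<exists>h\<in>T. h * u \<in> T \<and> (\<forall>v. h * v = 0 \<longrightarrow> v = 0)"
    and zero: "\<And>a. a \<in> T \<Longrightarrow> P a = 0"
  shows "u \<in> S \<Longrightarrow> P u = 0"
  using assms(1) zero
proof (induction n arbitrary: P u)
  case 0
  obtain h where h: "h \<in> T" "h * u \<in> T" "\<And>v. h * v = 0 \<Longrightarrow> v = 0" using loc 0(1) by blast
  have "P (h * u) = h * P u" using 0(1,2) h(1) T(1) by auto
  then show ?case using h 0(3) by metis
next
  case (Suc n)
  obtain h where h: "h \<in> T" "h * u \<in> T" "\<And>v. h * v = 0 \<Longrightarrow> v = 0" using loc Suc(2) by blast
  have "ad h P u = 0"
  proof (rule Suc.IH[where P = "ad h P" and u = u])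
    show "u \<in> S" by (rule Suc(2))
    show "ad h P \<in> diff_ops_le \<iota> S n"
      using Suc(3) h(1) T(1) unfolding diff_ops_le_Suc_iff by blast
    show "ad h P a = 0" if "a \<in> T" for a
      using that h T Suc(4) ad_apply[of a h P] by auto
  qed
  then have "P (h * u) = h * P u" using ad_apply[OF Suc(2)] by simp
  then show ?case using h Suc(4) by metis
qed

lemma diff_ops_eqI_localization:
  assumes P: "P \<in> diff_ops \<iota> S" and Q: "Q \<in> diff_ops \<iota> S"
    and T: "T \<subseteq> S" "\<And>a b. a \<in> T \<Longrightarrow> b \<in> T \<Longrightarrow> a * b \<in> T"
    and loc: "\<And>u. u \<in> S \<Longrightarrow> \<exists>h\<in>T. h * u \<in> T \<and> (\<forall>v. h * v = 0 \<longrightarrow> v = 0)"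
    and eq: "\<And>a. a \<in> T \<Longrightarrow> P a = Q a"
  shows "P = Q"
proof
  fix u
  obtain m n where mn: "P \<in> diff_ops_le \<iota> S m" "Q \<in> diff_ops_le \<iota> S n"
    using P Q unfolding diff_ops_def by blast
  define N where "N = max m n"
  have PQ: "P \<in> diff_ops_le \<iota> S N" "Q \<in> diff_ops_le \<iota> S N"
    using diff_ops_le_mono[OF _ mn(1), of N] diff_ops_le_mono[OF _ mn(2), of N] by (auto simp: N_def)
  define D where "D = op_add P (op_lmult (- 1) Q)"
  have D: "D \<in> diff_ops_le \<iota> S N"
    unfolding D_def using diff_ops_le_add[OF PQ(1)] diff_ops_le_mult[OF PQ(2) minus_mem[OF one_mem]] by blast
  have D_eq: "D x = P x - Q x" if "x \<in> S" for x
    using that by (simp add: D_def op_add_def op_lmult_def)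
  have D0: "D a = 0" if "a \<in> T" for a using D_eq[of a] eq[OF that] T(1) that by auto
  show "P u = Q u"
  proof (cases "u \<in> S")
    case True
    have "D u = 0" by (rule diff_op_zero_on_localization[OF D T loc D0 True])
    then show ?thesis using D_eq[OF True] by simp
  next
    case False
    then show ?thesis using diff_ops_le_lin[OF PQ(1)] diff_ops_le_lin[OF PQ(2)] lin_endosD(2) by metis
  qed
qed

end

section \<open>Digit words and periodic expansions\<close>

definition digit_trunc :: "nat \<Rightarrow> (nat \<Rightarrow> nat) \<Rightarrow> nat \<Rightarrow> nat" where
  "digit_trunc p z e = (\<Sum>i<e. z i * p ^ i)"

lemma digit_trunc_0 [simp]: "digit_trunc p z 0 = 0"
  by (simp add: digit_trunc_def)

lemma digit_trunc_Suc: "digit_trunc p z (Suc e) = digit_trunc p z e + z e * p ^ e"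
  by (simp add: digit_trunc_def)

lemma digit_trunc_Suc_shift: "digit_trunc p z (Suc e) = z 0 + p * digit_trunc p (\<lambda>i. z (Suc i)) e"
  unfolding digit_trunc_def by (subst sum.lessThan_Suc_shift) (simp add: sum_distrib_left mult_ac)

lemma digit_trunc_less:
  assumes "z \<in> padic_ints p" shows "digit_trunc p z e < p ^ e"
proof (induction e)
  case (Suc e)
  have "z e + 1 \<le> p" using assms by (auto simp: padic_ints_def Suc_le_eq)
  then have "(z e + 1) * p ^ e \<le> p * p ^ e" by (rule mult_right_mono) simp
  then show ?case using Suc by (simp add: digit_trunc_Suc algebra_simps)
qed simp

lemma digit_trunc_digit:
  "z \<in> padic_ints p \<Longrightarrow> i < e \<Longrightarrow> (digit_trunc p z e div p ^ i) mod p = z i"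
proof (induction i arbitrary: z e)
  case 0
  then obtain e' where "e = Suc e'" by (cases e) auto
  then show ?case using 0 by (simp add: digit_trunc_Suc_shift padic_ints_def)
next
  case (Suc i)
  then obtain e' where e: "e = Suc e'" by (cases e) auto
  have z0: "z 0 < p" and sh: "(\<lambda>i. z (Suc i)) \<in> padic_ints p"
    using Suc.prems(1) by (auto simp: padic_ints_def)
  have "digit_trunc p z e div p = digit_trunc p (\<lambda>i. z (Suc i)) e'"
    using z0 by (simp add: e digit_trunc_Suc_shift)
  then have "digit_trunc p z e div p ^ Suc i = digit_trunc p (\<lambda>i. z (Suc i)) e' div p ^ i"
    by (simp add: div_mult2_eq)
  then show ?case using Suc.IH[OF sh, of e'] Suc.prems(2) e by simp
qed

lemma digit_trunc_eqD:
  assumes "z \<in> padic_ints p" "w \<in> padic_ints p" "digit_trunc p z e = digit_trunc p w e" "i < e"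
  shows "z i = w i"
  using digit_trunc_digit[OF assms(1,4)] digit_trunc_digit[OF assms(2,4)] assms(3) by simp

text \<open>
  The combinatorial properties of the sets of jumps. A number \<open>j < p\<^sup>e\<close> is read as a word of \<open>e\<close> digits in base
  \<open>p\<close>. Reduction modulo \<open>p\<^sup>e\<close> deletes the leading digit, division by \<open>p\<close> deletes the last one, and \<open>p j + r\<close> has the
  new last digit \<open>r\<close>.
\<close>

locale digit_words =
  fixes p :: nat and J :: "nat \<Rightarrow> nat set" and C :: nat
  assumes p: "p \<ge> 2"
    and J_less: "j \<in> J e \<Longrightarrow> j < p ^ e"
    and J_card: "card (J e) \<le> C"
    and J_mod: "j \<in> J (Suc e) \<Longrightarrow> j mod p ^ e \<in> J e"
    and J_div: "j \<in> J (Suc e) \<Longrightarrow> j div p \<in> J e"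
    and J_lift: "j \<in> J e \<Longrightarrow> \<exists>r<p. p * j + r \<in> J (Suc e)"
begin

definition limit_words :: "(nat \<Rightarrow> nat) set" where
  "limit_words = {z \<in> padic_ints p. \<forall>e. digit_trunc p z e \<in> J e}"

lemma finite_J: "finite (J e)"
  using J_less by (rule_tac finite_subset[of _ "{..<p ^ e}"]) auto

text \<open>
  Finitely many different \<open>p\<close>-adic integers are already told apart by their truncations at one common
  length, where there are at most \<open>C\<close> words.
\<close>

lemma finite_limit_words: "finite limit_words"
proof -
  have "card W \<le> C" if W: "W \<subseteq> limit_words" "finite W" for W
  proof -
    (* the first place where two words differ; e exceeds all these places *)
    define d where "d z w = (LEAST i. z i \<noteq> w i)" for z w :: "nat \<Rightarrow> nat"
    have "finite ((\<lambda>(z,w). d z w) ` (W \<times> W))" using W(2) by blast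
    then obtain e where e: "\<forall>i \<in> (\<lambda>(z,w). d z w) ` (W \<times> W). i < e"
      using finite_nat_set_iff_bounded by blast
    have "inj_on (\<lambda>z. digit_trunc p z e) W"
    proof (rule inj_onI, rule ccontr)
      fix z w assume zw: "z \<in> W" "w \<in> W" "digit_trunc p z e = digit_trunc p w e" "z \<noteq> w"
      then obtain i where "z i \<noteq> w i" by blast
      then have "z (d z w) \<noteq> w (d z w)" unfolding d_def by (rule LeastI)
      moreover have "d z w < e" using e zw(1,2) by auto
      ultimately show False
        using digit_trunc_eqD[of z p w e "d z w"] zw W(1) by (auto simp: limit_words_def)
    qed
    moreover have "(\<lambda>z. digit_trunc p z e) ` W \<subseteq> J e" using W(1) by (auto simp: limit_words_def)
    ultimately have "card W \<le> card (J e)" using finite_J by (rule card_inj_on_le)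
    then show ?thesis using J_card[of e] by simp
  qed
  then show ?thesis using finite_if_finite_subsets_card_bdd[of limit_words C] by blast
qed

lemma limit_words_shift: "z \<in> limit_words \<Longrightarrow> (\<lambda>i. z (Suc i)) \<in> limit_words"
proof -
  assume z: "z \<in> limit_words"
  have z0: "z 0 < p" using z by (auto simp: limit_words_def padic_ints_def)
  have "digit_trunc p (\<lambda>i. z (Suc i)) e \<in> J e" for e
  proof -
    have "digit_trunc p z (Suc e) div p \<in> J e" using z J_div by (auto simp: limit_words_def)
    then show ?thesis using z0 by (simp add: digit_trunc_Suc_shift)
  qed
  then show ?thesis using z by (auto simp: limit_words_def padic_ints_def)
qed

text \<open>
  Each truncation can be continued by some last digit. A digit that works for long truncations also works for
  short ones, and there are only \<open>p\<close> digits, so one digit works for all truncations.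
\<close>

lemma limit_words_extend:
  assumes z: "z \<in> limit_words"
  shows "\<exists>w\<in>limit_words. (\<lambda>i. w (Suc i)) = z"
proof -
  have zp: "z \<in> padic_ints p" and zJ: "\<And>e. digit_trunc p z e \<in> J e"
    using z by (auto simp: limit_words_def)
  have mono: "p * digit_trunc p z e + r \<in> J (Suc e)"
    if "p * digit_trunc p z e' + r \<in> J (Suc e')" "e \<le> e'" "r < p" for e e' r
    using that(2,1)
  proof (induction rule: dec_induct)
    case (step n)
    have "p * digit_trunc p z n + r < p ^ Suc n"
    proof -
      have "p * (digit_trunc p z n + 1) \<le> p * p ^ n"
        using digit_trunc_less[OF zp, of n] by (intro mult_left_mono) auto
      then show ?thesis using that(3) by simp
    qed
    then have "(p * digit_trunc p z (Suc n) + r) mod p ^ Suc n = p * digit_trunc p z n + r"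
      by (simp add: digit_trunc_Suc distrib_left mult.left_commute[of p] add.assoc add.commute[of _ r]
          flip: add.assoc)
    then show ?case using step J_mod[of "p * digit_trunc p z (Suc n) + r" "Suc n"] by simp
  qed
  have "\<exists>r<p. \<forall>e. p * digit_trunc p z e + r \<in> J (Suc e)"
  proof (rule ccontr)
    assume "\<not> ?thesis"
    then have "\<forall>r\<in>{..<p}. \<exists>e. p * digit_trunc p z e + r \<notin> J (Suc e)" by auto
    then obtain E where E: "\<And>r. r < p \<Longrightarrow> p * digit_trunc p z (E r) + r \<notin> J (Suc (E r))"
      by (metis lessThan_iff)
    define e where "e = Max (E ` {..<p})"
    obtain r where r: "r < p" "p * digit_trunc p z e + r \<in> J (Suc e)" using J_lift[OF zJ[of e]] by blast
    have "E r \<le> e" unfolding e_def using r(1) by (intro Max_ge) auto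
    then show False using mono[OF r(2) _ r(1)] E[OF r(1)] by blast
  qed
  then obtain r where r: "r < p" "\<And>e. p * digit_trunc p z e + r \<in> J (Suc e)" by blast
  define w where "w = case_nat r z"
  have sh: "(\<lambda>i. w (Suc i)) = z" by (simp add: w_def)
  have "w \<in> padic_ints p" using r(1) zp by (auto simp: w_def padic_ints_def split: nat.split)
  moreover have "digit_trunc p w e \<in> J e" for e
  proof (cases e)
    case 0
    then show ?thesis using zJ[of 0] by simp
  next
    case (Suc e')
    then show ?thesis using r(2)[of e'] by (simp add: digit_trunc_Suc_shift sh) (simp add: w_def add.commute)
  qed
  ultimately show ?thesis using sh by (auto simp: limit_words_def)
qed

text \<open>
  The shift is surjective on a finite set, hence injective, hence every orbit is a cycle.
\<close>

lemma limit_words_periodic: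
  assumes z: "z \<in> limit_words"
  shows "\<exists>b>0. \<forall>i. z (i + b) = z i"
proof -
  define sh where "sh = (\<lambda>(z::nat \<Rightarrow> nat) i. z (Suc i))"
  have shn: "(sh ^^ n) y = (\<lambda>i. y (i + n))" for n y
    by (induction n arbitrary: y) (auto simp: sh_def)
  have sub: "sh ` limit_words \<subseteq> limit_words" using limit_words_shift by (auto simp: sh_def)
  have surj: "sh ` limit_words = limit_words"
    using sub limit_words_extend by (fastforce simp: sh_def image_iff)
  then have inj: "inj_on sh limit_words" using finite_limit_words by (simp add: eq_card_imp_inj_on)
  have mem: "(sh ^^ n) z \<in> limit_words" for n
    by (induction n) (use z sub in auto)
  have "\<not> inj (\<lambda>n. (sh ^^ n) z)"
  proof
    assume "inj (\<lambda>n. (sh ^^ n) z)"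
    then have "infinite (range (\<lambda>n. (sh ^^ n) z))" by (simp add: finite_image_iff)
    then show False using mem finite_limit_words by (meson finite_subset image_subsetI)
  qed
  then obtain m n where mn: "m < n" "(sh ^^ m) z = (sh ^^ n) z"
  proof -
    obtain m n where "m \<noteq> n" "(sh ^^ m) z = (sh ^^ n) z"
      using \<open>\<not> inj (\<lambda>n. (sh ^^ n) z)\<close> unfolding inj_def by blast
    then show ?thesis using that[of m n] that[of n m] by (cases "m < n") auto
  qed
  define b where "b = n - m"
  have b: "b > 0" "(sh ^^ m) z = (sh ^^ (m + b)) z" using mn by (simp_all add: b_def)
  have "(sh ^^ k) z = (sh ^^ (k + b)) z \<Longrightarrow> z = (sh ^^ b) z" for k
  proof (induction k)
    case (Suc k)
    then have "sh ((sh ^^ k) z) = sh ((sh ^^ (k + b)) z)" by simp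
    then show ?case using inj mem Suc.IH by (auto dest: inj_onD)
  qed simp
  then have "z = (sh ^^ b) z" using b(2) by blast
  then show ?thesis using b(1) unfolding shn by metis
qed

end

lemma Z_loc_quotient:
  assumes b: "\<not> int p dvd b"
  shows "of_int a / of_int b \<in> Z_loc p"
proof -
  have b0: "b \<noteq> 0" using b by auto
  obtain c d where cd: "quotient_of (of_int a / of_int b) = (c, d)" by fastforce
  have d0: "d > 0" and fr: "of_int a / of_int b = (of_int c / of_int d :: rat)" and co: "coprime c d"
    using quotient_of_denom_pos[OF cd] quotient_of_div[OF cd] quotient_of_coprime[OF cd] by auto
  have "(of_int (a * d) :: rat) = of_int (c * b)" using fr b0 d0 by (simp add: field_simps)
  then have "a * d = c * b" by (simp only: of_int_eq_iff)
  then have "d dvd c * b" by (metis dvd_triv_right)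
  then have "d dvd b" using co by (simp add: coprime_commute coprime_dvd_mult_right_iff)
  then show ?thesis using b cd by (auto simp: Z_loc_def intro: dvd_trans)
qed

text \<open>
  A purely periodic expansion is a geometric series in \<open>p\<^sup>b\<close>. The proof avoids series: the rationals
  attached to the shifts of \<open>z\<close> satisfy \<open>r\<^sub>m = z\<^sub>m + p r\<^sub>m\<^sub>+\<^sub>1\<close>.
\<close>

lemma padic_periodic_rat:
  assumes p: "p \<ge> 2" and z: "z \<in> padic_ints p" and b: "b > 0" "\<And>i. z (i + b) = z i"
  shows "padic_eq_rat p z (- of_nat (digit_trunc p z b) / of_nat (p ^ b - 1))"
proof -
  define N where "N m = digit_trunc p (\<lambda>i. z (i + m)) b" for m
  define r :: "nat \<Rightarrow> rat" where "r m = - of_nat (N m) / of_nat (p ^ b - 1)" for m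
  have pb: "p ^ b > 1" using p b(1) by (intro one_less_power) auto
  have pdvd: "p dvd p ^ b" using b(1) by (simp add: dvd_power)
  have nd: "\<not> int p dvd int (p ^ b - 1)"
  proof
    assume "int p dvd int (p ^ b - 1)"
    then have "p dvd p ^ b - 1" by (simp only: int_dvd_int_iff)
    then have "p dvd p ^ b - (p ^ b - 1)" using pdvd by (rule_tac dvd_diff_nat)
    then show False using pb p by simp
  qed
  have loc: "r m \<in> Z_loc p" for m
  proof -
    have "r m = of_int (- int (N m)) / of_int (int (p ^ b - 1))"
      by (simp add: r_def)
    then show ?thesis using Z_loc_quotient[OF nd] by metis
  qed
  have step: "r m = of_nat (z m) + of_nat p * r (Suc m)" for m
  proof -
    have "digit_trunc p (\<lambda>i. z (i + m)) (Suc b) = N m + z m * p ^ b"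
      unfolding N_def digit_trunc_Suc using b(2)[of m] by (simp add: add.commute)
    moreover have "digit_trunc p (\<lambda>i. z (i + m)) (Suc b) = z m + p * N (Suc m)"
      unfolding N_def digit_trunc_Suc_shift by simp
    ultimately have "of_nat (N m) + of_nat (z m) * of_nat (p ^ b) =
        (of_nat (z m) + of_nat p * of_nat (N (Suc m)) :: rat)"
      by (metis of_nat_add of_nat_mult)
    moreover obtain M where M: "p ^ b = Suc M" "M > 0" using pb by (cases "p ^ b") auto
    ultimately have "of_nat p * of_nat (N (Suc m)) = (of_nat (N m) + of_nat (z m) * of_nat M :: rat)"
      by (simp add: algebra_simps)
    then show ?thesis unfolding r_def using M by (simp add: field_simps)
  qed
  have "r 0 - (\<Sum>e<m. of_nat (z e) * of_nat p ^ e) = of_nat p ^ m * r m" for m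
  proof (induction m)
    case (Suc m)
    then show ?case using step[of m] by (simp add: algebra_simps)
  qed simp
  then have "padic_eq_rat p z (r 0)" unfolding padic_eq_rat_def using z loc by blast
  then show ?thesis by (simp add: r_def N_def)
qed

lemma padic_periodic_rat_bounds:
  assumes p: "p \<ge> 2" and z: "z \<in> padic_ints p" "z n \<noteq> 0" and b: "b > 0" "\<And>i. z (i + b) = z i"
  shows "\<exists>r. padic_eq_rat p z r \<and> - 1 \<le> r \<and> r < 0"
proof -
  define N where "N = digit_trunc p z b"
  have per: "z (i + k * b) = z i" for i k
  proof (induction k)
    case (Suc k)
    have "i + Suc k * b = (i + k * b) + b" by simp
    then show ?case by (simp only: b(2) Suc)
  qed simp
  have "z (n mod b) \<noteq> 0" using per[of "n mod b" "n div b"] z(2) by simp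
  moreover have "n mod b < b" using b(1) by simp
  ultimately have "N \<noteq> 0" unfolding N_def digit_trunc_def using p by (auto simp: sum_eq_0_iff)
  moreover have "N < p ^ b" unfolding N_def using digit_trunc_less[OF z(1)] .
  ultimately have N: "0 < N" "N \<le> p ^ b - 1" by auto
  have "- 1 \<le> - of_nat N / (of_nat M :: rat) \<and> - of_nat N / (of_nat M :: rat) < 0"
    if "N \<le> M" for M
    using N(1) that by (auto simp: divide_simps)
  note this[OF N(2)]
  then show ?thesis using padic_periodic_rat[OF p z(1) b] unfolding N_def by blast
qed

section \<open>Operators linear over powers, and jumps\<close>

text \<open>
  For \<open>q\<close> a power of the characteristic, these operators form one step of the Frobenius filtration
  of the differential operators of a polynomial ring over a perfect field.
\<close>

definition frob_lin :: "nat \<Rightarrow> ('a::comm_ring_1 \<Rightarrow> 'a) \<Rightarrow> bool" where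
  "frob_lin q P \<longleftrightarrow> (\<forall>x y. P (x + y) = P x + P y) \<and> (\<forall>a x. P (a ^ q * x) = a ^ q * P x)"

lemma frob_linD:
  assumes "frob_lin q P"
  shows "P (x + y) = P x + P y" "P (a ^ q * x) = a ^ q * P x"
  using assms by (auto simp: frob_lin_def)

lemma frob_lin_zero: "frob_lin q P \<Longrightarrow> P 0 = 0"
  using frob_linD(1)[of q P 0 0] by simp

lemma frob_lin_dvd:
  assumes "frob_lin q P" "q dvd r" shows "frob_lin r P"
proof -
  obtain s where s: "r = s * q" using assms(2) by (metis dvd_def mult.commute)
  then have "P (a ^ r * x) = a ^ r * P x" for a x
    using frob_linD(2)[OF assms(1), of "a ^ s" x] by (simp add: power_mult)
  then show ?thesis using assms(1) by (auto simp: frob_lin_def)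
qed

lemma frob_lin_comp: "frob_lin q P \<Longrightarrow> frob_lin q Q \<Longrightarrow> frob_lin q (P \<circ> Q)"
  by (auto simp: frob_lin_def)

lemma frob_lin_lmult: "frob_lin q P \<Longrightarrow> frob_lin q (\<lambda>x. b * P x)"
  by (auto simp: frob_lin_def algebra_simps)

lemma frob_lin_rmult: "frob_lin q P \<Longrightarrow> frob_lin q (\<lambda>x. P (b * x))"
  unfolding frob_lin_def by (simp add: distrib_left mult.left_commute[of b])

lemma frob_lin_id: "frob_lin q (\<lambda>x. x)"
  by (auto simp: frob_lin_def)

text \<open>
  The \<open>q\<^sup>-\<^sup>1\<close>-linear maps; those with value \<open>1\<close> at \<open>1\<close> split the \<open>q\<close>-power map.
\<close>

definition cartier_lin :: "nat \<Rightarrow> ('a::comm_ring_1 \<Rightarrow> 'a) \<Rightarrow> bool" where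
  "cartier_lin q \<phi> \<longleftrightarrow> (\<forall>x y. \<phi> (x + y) = \<phi> x + \<phi> y) \<and> (\<forall>a x. \<phi> (a ^ q * x) = a * \<phi> x)"

lemma cartier_linD:
  assumes "cartier_lin q P"
  shows "P (x + y) = P x + P y" "P (a ^ q * x) = a * P x"
  using assms by (auto simp: cartier_lin_def)

lemma cartier_lin_add: "cartier_lin q P \<Longrightarrow> cartier_lin q Q \<Longrightarrow> cartier_lin q (\<lambda>x. P x + Q x)"
  by (auto simp: cartier_lin_def algebra_simps)

lemma cartier_lin_lmult: "cartier_lin q P \<Longrightarrow> cartier_lin q (\<lambda>x. b * P x)"
  by (auto simp: cartier_lin_def algebra_simps)

lemma cartier_lin_rmult: "cartier_lin q P \<Longrightarrow> cartier_lin q (\<lambda>x. P (b * x))"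
  unfolding cartier_lin_def by (simp add: distrib_left mult.left_commute[of b])

lemma frob_lin_cartier_sum:
  fixes \<phi> :: "'i \<Rightarrow> 'a::comm_ring_1 \<Rightarrow> 'a"
  assumes char: "prime CHAR('a)" "q = CHAR('a) ^ e" and \<phi>: "\<And>b. b \<in> B \<Longrightarrow> cartier_lin q (\<phi> b)"
  shows "frob_lin q (\<lambda>x. \<Sum>b\<in>B. \<phi> b x ^ q * c b)"
proof -
  have "(\<Sum>b\<in>B. \<phi> b (x + y) ^ q * c b) = (\<Sum>b\<in>B. \<phi> b x ^ q * c b) + (\<Sum>b\<in>B. \<phi> b y ^ q * c b)" for x y
    unfolding sum.distrib[symmetric]
    by (rule sum.cong) (auto simp: cartier_linD(1)[OF \<phi>] freshmans_dream'[OF char] distrib_right)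
  moreover have "(\<Sum>b\<in>B. \<phi> b (a ^ q * x) ^ q * c b) = a ^ q * (\<Sum>b\<in>B. \<phi> b x ^ q * c b)" for a x
    unfolding sum_distrib_left
    by (rule sum.cong) (auto simp: cartier_linD(2)[OF \<phi>] power_mult_distrib mult.assoc)
  ultimately show ?thesis by (simp add: frob_lin_def)
qed

text \<open>
  For a nonzero polynomial \<open>f\<close> over a perfect field, the values at \<open>f\<^sup>j\<close> of these operators form the \<open>q\<close>-th Frobenius power of
  the test ideal of \<open>f\<close> with exponent \<open>j / q\<close>, and \<open>j\<close> is a jump iff the interval from \<open>j / q\<close> (excluded) to
  \<open>(j + 1) / q\<close> (included) contains an \<open>F\<close>-jumping exponent of \<open>f\<close>.
\<close>

definition jumps :: "'a::comm_ring_1 \<Rightarrow> nat \<Rightarrow> nat set" where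
  "jumps f q = {j. j < q \<and> \<not> (\<exists>P. frob_lin q P \<and> P (f ^ Suc j) = f ^ j)}"

text \<open>
  An operator that is linear over \<open>q\<close>-th powers commutes with multiplication by \<open>f\<^sup>q\<close>, and it is linear over
  powers with larger exponents.
\<close>

lemma jumps_mod:
  assumes "j \<in> jumps f (q * q')" "q > 0"
  shows "j mod q \<in> jumps f q"
proof (rule ccontr)
  assume "\<not> ?thesis"
  then obtain P where P: "frob_lin q P" "P (f ^ Suc (j mod q)) = f ^ (j mod q)"
    using assms(2) by (auto simp: jumps_def)
  have "Suc j = j div q * q + Suc (j mod q)" by simp
  then have "f ^ Suc j = (f ^ (j div q)) ^ q * f ^ Suc (j mod q)"
    by (metis power_add power_mult)
  then have "P (f ^ Suc j) = P ((f ^ (j div q)) ^ q * f ^ Suc (j mod q))" by (rule arg_cong)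
  also have "\<dots> = f ^ j"
    by (simp add: frob_linD[OF P(1)] P(2) del: power_Suc) (simp add: power_mult[symmetric] power_add[symmetric])
  finally show False using assms(1) frob_lin_dvd[OF P(1), of "q * q'"] by (auto simp: jumps_def)
qed

context
  fixes \<kappa> :: "'a::comm_ring_1 \<Rightarrow> 'a" and q :: nat and p
  assumes char: "prime CHAR('a)" and p: "p = CHAR('a)" and \<kappa>: "cartier_lin p \<kappa>" "\<kappa> 1 = 1"
begin

lemma splitting_pow: "\<kappa> (x ^ p) = x"
  using cartier_linD(2)[OF \<kappa>(1), of x 1] \<kappa>(2) by simp

text \<open>
  An operator \<open>P\<close> for the exponent \<open>j div p\<close> at level \<open>q\<close> gives the operator \<open>x \<mapsto> (P (\<kappa> x))\<^sup>p\<close> for its \<open>p\<close>-th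
  multiple at level \<open>p q\<close>. Multiplication with powers of \<open>f\<close> before and after it adjusts the last digit.
\<close>

lemma jumps_div:
  fixes f :: 'a
  assumes "j \<in> jumps f (p * q)"
  shows "j div p \<in> jumps f q"
proof (rule ccontr)
  assume "\<not> ?thesis"
  moreover have "j div p < q" using assms by (auto simp: jumps_def less_mult_imp_div_less mult.commute)
  ultimately obtain P where P: "frob_lin q P" "P (f ^ Suc (j div p)) = f ^ (j div p)"
    by (auto simp: jumps_def)
  define P' where "P' x = P (\<kappa> x) ^ p" for x
  have "P' (x + y) = P' x + P' y" for x y
    unfolding P'_def cartier_linD(1)[OF \<kappa>(1)] frob_linD(1)[OF P(1)] using char p
    by (simp add: freshmans_dream)
  moreover have "P' (a ^ (p * q) * x) = a ^ (p * q) * P' x" for a x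
  proof -
    have "\<kappa> (a ^ (p * q) * x) = a ^ q * \<kappa> x"
      using cartier_linD(2)[OF \<kappa>(1), of "a ^ q" x] by (simp add: power_mult[symmetric] mult.commute)
    then show ?thesis
      unfolding P'_def
      by (simp only: frob_linD(2)[OF P(1)] power_mult_distrib) (simp add: power_mult[symmetric] mult.commute[of q p])
  qed
  ultimately have P': "frob_lin (p * q) P'" by (simp add: frob_lin_def)
  define r where "r = j mod p"
  have p0: "p > 0" using char p by (simp add: prime_gt_0_nat)
  have r: "r < p" using p0 by (simp add: r_def)
  (* the last digit r of j contributes f^r; the factor before P' completes j + 1 to a multiple of p *)
  define P'' where "P'' x = f ^ r * P' (f ^ (p - 1 - r) * x)" for x
  have P'': "frob_lin (p * q) P''"
    unfolding P''_def by (intro frob_lin_lmult frob_lin_rmult P')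
  have "(p - 1 - r) + Suc j = p * Suc (j div p)"
  proof -
    have "j = p * (j div p) + r" unfolding r_def by simp
    then show ?thesis using r by simp
  qed
  then have "f ^ (p - 1 - r) * f ^ Suc j = (f ^ Suc (j div p)) ^ p"
    by (metis power_add power_mult mult.commute)
  then have "P'' (f ^ Suc j) = f ^ r * (f ^ (j div p)) ^ p"
    unfolding P''_def P'_def by (simp only: splitting_pow P(2))
  also have "\<dots> = f ^ j" unfolding r_def by (simp add: power_mult[symmetric] power_add[symmetric] mult.commute)
  finally show False using assms P'' by (auto simp: jumps_def)
qed

text \<open>
  If none of the \<open>p\<close> continuations were a jump, composing their operators would lead from \<open>f\<^bsup>p j + p\<^esup>\<close> to \<open>f\<^bsup>p j\<^esup>\<close>,
  and \<open>x \<mapsto> \<kappa> (P (x\<^sup>p))\<close> would lead from \<open>f\<^bsup>j + 1\<^esup>\<close> to \<open>f\<^sup>j\<close>.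
\<close>

lemma jumps_lift:
  fixes f :: 'a
  assumes "j \<in> jumps f q"
  shows "\<exists>r<p. p * j + r \<in> jumps f (p * q)"
proof (rule ccontr)
  assume contra: "\<not> ?thesis"
  have p0: "p > 0" using char p by (simp add: prime_gt_0_nat)
  have j: "j < q" using assms by (auto simp: jumps_def)
  have less: "p * j + r < p * q" if "r < p" for r
  proof -
    have "p * Suc j \<le> p * q" using j by (intro mult_left_mono) auto
    then show ?thesis using that by simp
  qed
  have "\<exists>P. frob_lin (p * q) P \<and> P (f ^ (p * j + r)) = f ^ (p * j)" if "r \<le> p" for r
    using that
  proof (induction r)
    case 0 show ?case using frob_lin_id by auto
  next
    case (Suc r)
    then obtain P where P: "frob_lin (p * q) P" "P (f ^ (p * j + r)) = f ^ (p * j)" by auto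
    obtain P' where P': "frob_lin (p * q) P'" "P' (f ^ Suc (p * j + r)) = f ^ (p * j + r)"
      using contra Suc.prems less[of r] by (auto simp: jumps_def)
    have "(P \<circ> P') (f ^ (p * j + Suc r)) = f ^ (p * j)" using P(2) P'(2) by simp
    then show ?case using frob_lin_comp[OF P(1) P'(1)] by blast
  qed
  then obtain P where P: "frob_lin (p * q) P" "P (f ^ (p * j + p)) = f ^ (p * j)" by blast
  define P' where "P' x = \<kappa> (P (x ^ p))" for x
  have "P' (x + y) = P' x + P' y" for x y
    unfolding P'_def using char p
    by (simp add: freshmans_dream frob_linD(1)[OF P(1)] cartier_linD(1)[OF \<kappa>(1)])
  moreover have "P' (a ^ q * x) = a ^ q * P' x" for a x
  proof -
    have "(a ^ q * x) ^ p = a ^ (p * q) * x ^ p"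
      by (simp add: power_mult_distrib power_mult[symmetric] mult.commute)
    moreover have "a ^ (p * q) = (a ^ q) ^ p" by (simp add: power_mult[symmetric] mult.commute)
    ultimately show ?thesis
      unfolding P'_def by (metis frob_linD(2)[OF P(1)] cartier_linD(2)[OF \<kappa>(1)])
  qed
  ultimately have "frob_lin q P'" by (simp add: frob_lin_def)
  moreover have "P' (f ^ Suc j) = f ^ j"
  proof -
    have "(f ^ Suc j) ^ p = f ^ (p * j + p)" by (simp only: power_mult[symmetric]) (simp add: algebra_simps)
    then show ?thesis
      unfolding P'_def by (simp only: P(2)) (simp only: mult.commute[of p] power_mult splitting_pow)
  qed
  ultimately show False using assms by (auto simp: jumps_def)
qed

end

section \<open>Coordinates of polynomials over their powers\<close>

lemma CHAR_poly_mapping: "CHAR('a::comm_monoid_add \<Rightarrow>\<^sub>0 'b::comm_semiring_1) = CHAR('b)"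
proof (rule CHAR_eqI)
  have "of_nat n = (0 :: 'a \<Rightarrow>\<^sub>0 'b) \<longleftrightarrow> of_nat n = (0 :: 'b)" for n
    by (simp add: poly_mapping_eq_iff fun_eq_iff lookup_of_nat when_def)
  then show "of_nat CHAR('b) = (0 :: 'a \<Rightarrow>\<^sub>0 'b)"
    "\<And>x. of_nat x = (0 :: 'a \<Rightarrow>\<^sub>0 'b) \<Longrightarrow> CHAR('b) dvd x"
    by (simp_all add: of_nat_eq_0_iff_char_dvd)
qed

lemma poly_mapping_induct_sum [case_names zero monomial sum]:
  fixes x :: "'a \<Rightarrow>\<^sub>0 'b::comm_monoid_add"
  assumes "P 0" "\<And>m c. P (Poly_Mapping.single m c)" "\<And>x y. P x \<Longrightarrow> P y \<Longrightarrow> P (x + y)"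
  shows "P x"
proof (induction x rule: Poly_Mapping.update_induct)
  case const show ?case by (rule assms(1))
next
  case (update f a b)
  have "Poly_Mapping.update a b f = Poly_Mapping.single a b + f"
    using update(1) by (intro poly_mapping_eqI)
      (auto simp: lookup_update lookup_add lookup_single when_def in_keys_iff)
  then show ?case using assms update by simp
qed

lemma mpol_single_power:
  "Poly_Mapping.single m c ^ n = Poly_Mapping.single (\<Sum>i<n. m) (c ^ n)"
  by (induction n) (auto simp: mult_single add.commute)

definition exp_box :: "nat \<Rightarrow> ('n \<Rightarrow>\<^sub>0 nat) set" where
  "exp_box q = {m. \<forall>i. Poly_Mapping.lookup m i < q}"

definition mdiv :: "nat \<Rightarrow> ('n::finite \<Rightarrow>\<^sub>0 nat) \<Rightarrow> 'n \<Rightarrow>\<^sub>0 nat" where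
  "mdiv q m = Abs_poly_mapping (\<lambda>i. Poly_Mapping.lookup m i div q)"

definition mmod :: "nat \<Rightarrow> ('n::finite \<Rightarrow>\<^sub>0 nat) \<Rightarrow> 'n \<Rightarrow>\<^sub>0 nat" where
  "mmod q m = Abs_poly_mapping (\<lambda>i. Poly_Mapping.lookup m i mod q)"

lemma lookup_mdiv_mmod [simp]:
  "Poly_Mapping.lookup (mdiv q m) i = Poly_Mapping.lookup m i div q"
  "Poly_Mapping.lookup (mmod q m) i = Poly_Mapping.lookup m i mod q"
  by (simp_all add: mdiv_def mmod_def)

lemma lookup_sum_const: "Poly_Mapping.lookup (\<Sum>i<n. m) x = n * Poly_Mapping.lookup m x"
  for m :: "'a \<Rightarrow>\<^sub>0 nat"
  by (simp add: lookup_sum)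

lemma finite_exp_box: "finite (exp_box q :: ('n::finite \<Rightarrow>\<^sub>0 nat) set)"
proof -
  have "finite (UNIV \<rightarrow>\<^sub>E {..<q} :: ('n \<Rightarrow> nat) set)" by (intro finite_PiE) auto
  moreover have "Poly_Mapping.lookup ` exp_box q \<subseteq> (UNIV \<rightarrow>\<^sub>E {..<q} :: ('n \<Rightarrow> nat) set)"
    by (auto simp: exp_box_def)
  ultimately have "finite (Poly_Mapping.lookup ` (exp_box q :: ('n \<Rightarrow>\<^sub>0 nat) set))"
    by (rule finite_subset[rotated])
  then show ?thesis by (rule finite_imageD) (auto intro: inj_onI poly_mapping_eqI)
qed

definition qth_root :: "nat \<Rightarrow> 'k::field \<Rightarrow> 'k" where
  "qth_root q = inv_into UNIV (\<lambda>x. x ^ q)"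

text \<open>
  \<open>R\<close> is free over \<open>R\<^sup>q\<close> with the monomials in \<open>exp_box q\<close> as a basis; this is the \<open>q\<close>-th root of the coefficient of
  the basis element \<open>x\<^sup>b\<close>.
\<close>

definition frob_coord :: "nat \<Rightarrow> ('n::finite \<Rightarrow>\<^sub>0 nat) \<Rightarrow> ('n, 'k::field) mpol \<Rightarrow> ('n, 'k) mpol" where
  "frob_coord q b h = (\<Sum>m\<in>Poly_Mapping.keys h. if mmod q m = b
     then Poly_Mapping.single (mdiv q m) (qth_root q (Poly_Mapping.lookup h m)) else 0)"

lemma perfect_prime: "perfect_pos_char TYPE('k::field) \<Longrightarrow> prime CHAR('k)"
  by (simp add: perfect_pos_char_def prime_CHAR_semidom)

context
  fixes q e :: nat
  assumes perf: "perfect_pos_char TYPE('k::field)" and q: "q = CHAR('k) ^ e"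
begin

lemma q_pos: "q > 0"
  using perfect_prime[OF perf] q by (simp add: prime_gt_0_nat)

lemma surj_frob: "surj (\<lambda>x::'k. x ^ q)"
  unfolding q
proof (induction e)
  case (Suc e)
  have "surj ((\<lambda>x::'k. x ^ CHAR('k)) \<circ> (\<lambda>x::'k. x ^ (CHAR('k) ^ e)))"
    using perf Suc by (intro comp_surj) (auto simp: perfect_pos_char_def)
  then show ?case by (simp add: o_def power_mult[symmetric] mult.commute)
qed simp

lemma frob_diff: "((x::'k) - y) ^ q = x ^ q - y ^ q"
  using freshmans_dream'[OF perfect_prime[OF perf] q, of "x - y" y] by simp

lemma inj_frob: "inj (\<lambda>x::'k. x ^ q)"
proof (rule injI)
  fix x y :: 'k assume "x ^ q = y ^ q"
  then have "(x - y) ^ q = 0" by (simp add: frob_diff)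
  then show "x = y" by simp
qed

lemma qth_root_power [simp]: "qth_root q (c :: 'k) ^ q = c"
  unfolding qth_root_def using surj_f_inv_f[OF surj_frob] .

lemma qth_root_eqI: "d ^ q = (c :: 'k) \<Longrightarrow> qth_root q c = d"
  using inj_frob qth_root_power by (metis injD)

lemma qth_root_simps: "qth_root q (0 :: 'k) = 0" "qth_root q (c + d) = qth_root q c + qth_root q (d :: 'k)"
  "qth_root q (c ^ q * d) = c * qth_root q (d :: 'k)" "qth_root q 1 = (1 :: 'k)"
  by (rule qth_root_eqI; use q_pos in \<open>simp add: power_mult_distrib freshmans_dream'[OF perfect_prime[OF perf] q]\<close>)+

lemma frob_coord_add: "frob_coord q b (x + y) = frob_coord q b x + frob_coord q b (y :: ('n::finite, 'k) mpol)"
  unfolding frob_coord_def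
  by (rule setsum_keys_plus_distrib) (auto simp: qth_root_simps single_add)

lemma frob_coord_single:
  "frob_coord q b (Poly_Mapping.single m (c::'k)) = (if mmod q m = b then Poly_Mapping.single (mdiv q m) (qth_root q c) else 0)"
  by (cases "c = 0") (auto simp: frob_coord_def qth_root_simps)

lemma frob_coord_zero: "frob_coord q b (0 :: ('n::finite, 'k) mpol) = 0"
  by (simp add: frob_coord_def)

lemma mpol_char: "prime CHAR(('n, 'k) mpol)" "q = CHAR(('n, 'k) mpol) ^ e"
  using perfect_prime[OF perf] q by (simp_all add: CHAR_poly_mapping)

text \<open>
  Both sides are additive in both arguments, so it suffices to compare them on monomials.
\<close>

lemma frob_coord_cartier: "cartier_lin q (frob_coord q b :: ('n::finite, 'k) mpol \<Rightarrow> _)"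
  unfolding cartier_lin_def
proof (intro conjI allI)
  fix a x :: "('n, 'k) mpol"
  show "frob_coord q b (a ^ q * x) = a * frob_coord q b x"
  proof (induction a rule: poly_mapping_induct_sum)
    case zero then show ?case using q_pos by (simp add: frob_coord_zero zero_power)
  next
    case (sum a a')
    then show ?case
      by (simp add: freshmans_dream'[OF mpol_char] distrib_right frob_coord_add)
  next
    case (monomial m c)
    show ?case
    proof (induction x rule: poly_mapping_induct_sum)
      case zero then show ?case by (simp add: frob_coord_zero)
    next
      case (sum x x') then show ?case by (simp add: distrib_left frob_coord_add)
    next
      case (monomial n d)
      have "mmod q ((\<Sum>i<q. m) + n) = mmod q n" "mdiv q ((\<Sum>i<q. m) + n) = m + mdiv q n"
        using q_pos by (auto intro!: poly_mapping_eqI simp: lookup_add lookup_sum_const simp del: sum_constant)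
      then show ?case
        unfolding mpol_single_power mult_single frob_coord_single by (simp add: mult_single qth_root_simps del: sum_constant)
    qed
  qed
qed (rule frob_coord_add)

lemma frob_coord_expansion:
  "(\<Sum>b\<in>exp_box q. frob_coord q b x ^ q * Poly_Mapping.single b 1) = (x :: ('n::finite, 'k) mpol)"
proof (induction x rule: poly_mapping_induct_sum)
  case zero then show ?case using q_pos by (simp add: frob_coord_zero zero_power)
next
  case (sum x y)
  then show ?case
    by (simp add: frob_coord_add freshmans_dream'[OF mpol_char] distrib_right sum.distrib)
next
  case (monomial m c)
  have box: "mmod q m \<in> exp_box q" using q_pos by (simp add: exp_box_def)
  have "(\<Sum>b\<in>exp_box q. frob_coord q b (Poly_Mapping.single m c) ^ q * Poly_Mapping.single b 1) =
     (\<Sum>b\<in>exp_box q. if b = mmod q m then (Poly_Mapping.single (mdiv q m) (qth_root q c)) ^ q * Poly_Mapping.single b 1 else 0)"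
    using q_pos by (intro sum.cong) (auto simp: frob_coord_single zero_power)
  also have "\<dots> = (Poly_Mapping.single (mdiv q m) (qth_root q c)) ^ q * Poly_Mapping.single (mmod q m) 1"
    by (subst sum.delta[OF finite_exp_box]) (simp only: box if_True)
  also have "\<dots> = Poly_Mapping.single ((\<Sum>i<q. mdiv q m) + mmod q m) c"
    unfolding mpol_single_power mult_single by simp
  also have "(\<Sum>i<q. mdiv q m) + mmod q m = m"
    by (auto intro!: poly_mapping_eqI simp: lookup_add lookup_sum_const simp del: sum_constant)
  finally show ?case .
qed

end

definition exps_le :: "nat \<Rightarrow> ('n, 'k::zero) mpol \<Rightarrow> bool" where
  "exps_le d h \<longleftrightarrow> (\<forall>m\<in>Poly_Mapping.keys h. \<forall>i. Poly_Mapping.lookup m i \<le> d)"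

lemma exps_le_mult:
  assumes "exps_le c x" "exps_le d y"
  shows "exps_le (c + d) (x * y :: ('n, 'k::field) mpol)"
proof -
  have "Poly_Mapping.lookup m i \<le> c + d" if m: "m \<in> Poly_Mapping.keys (x * y)" for m i
  proof -
    obtain a b where "m = a + b" "a \<in> Poly_Mapping.keys x" "b \<in> Poly_Mapping.keys y"
      using m keys_mult[of x y] by blast
    then show ?thesis using assms by (auto simp: exps_le_def lookup_add intro: add_mono)
  qed
  then show ?thesis by (auto simp: exps_le_def)
qed

lemma exps_le_power: "exps_le d x \<Longrightarrow> exps_le (j * d) (x ^ j :: ('n, 'k::field) mpol)"
proof (induction j)
  case 0 then show ?case by (simp add: exps_le_def keys_one)
next
  case (Suc j) then show ?case using exps_le_mult[of d x "j * d" "x ^ j"] by simp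
qed

text \<open>
  Taking coordinates divides exponents by \<open>q\<close>. This is what keeps the coordinates of \<open>f\<^sup>j\<close>, \<open>j < q\<close>, in a space that
  depends on \<open>f\<close> only.
\<close>

lemma exps_le_frob_coord:
  assumes "exps_le c h" "c < q * Suc d"
  shows "exps_le d (frob_coord q b h :: ('n::finite, 'k::field) mpol)"
proof -
  have "Poly_Mapping.lookup n i \<le> d" if n: "n \<in> Poly_Mapping.keys (frob_coord q b h)" for n i
  proof -
    obtain m where m: "m \<in> Poly_Mapping.keys h"
      "n \<in> Poly_Mapping.keys (if mmod q m = b
       then Poly_Mapping.single (mdiv q m) (qth_root q (Poly_Mapping.lookup h m)) else 0)"
      using subsetD[OF keys_sum n[unfolded frob_coord_def]] by blast
    then have "n = mdiv q m" by (auto split: if_splits)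
    moreover have "Poly_Mapping.lookup m i \<le> c" using m(1) assms(1) by (simp add: exps_le_def)
    ultimately show ?thesis using assms(2) by (simp add: less_mult_imp_div_less mult.commute flip: less_Suc_eq_le)
  qed
  then show ?thesis by (simp add: exps_le_def)
qed

lemma exps_le_exists: "\<exists>d. exps_le d (x :: ('n::finite, 'k::field) mpol)"
proof -
  have "finite ((\<lambda>(m,i). Poly_Mapping.lookup m i) ` (Poly_Mapping.keys x \<times> UNIV))" by simp
  then obtain d where "\<forall>k\<in>(\<lambda>(m,i). Poly_Mapping.lookup m i) ` (Poly_Mapping.keys x \<times> UNIV). k \<le> d"
    using finite_nat_set_iff_bounded_le by blast
  then show ?thesis unfolding exps_le_def by (intro exI[of _ d]) auto
qed

section \<open>The number of jumps\<close>

lemma mconst_simps: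
  "mconst (c + d) = mconst c + mconst d" "mconst (c * d) = mconst c * mconst d"
  "mconst 0 = 0" "mconst 1 = 1" "mconst (- a) = - mconst (a :: 'k::field)"
  by (simp_all add: mconst_def single_add mult_single single_uminus)

lemma mconst_power: "mconst (c ^ n) = (mconst (c::'k::field) ^ n :: ('n, 'k) mpol)"
  by (induction n) (auto simp: mconst_simps)

lemma vector_space_mpol: "vector_space (\<lambda>(c::'k::field) (x :: ('n, 'k) mpol). mconst c * x)"
  by standard (auto simp: mconst_simps algebra_simps)

text \<open>
  Vectors that witness strict steps of a descending chain of subspaces are linearly independent.
\<close>

lemma (in vector_space) card_chain_le:
  fixes V :: "nat \<Rightarrow> 'b set"
  assumes sub: "\<And>j. subspace (V j)" and mono: "\<And>j. V (Suc j) \<subseteq> V j"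
    and J: "finite J" "\<And>j. j \<in> J \<Longrightarrow> v j \<in> V j" "\<And>j. j \<in> J \<Longrightarrow> v j \<notin> V (Suc j)"
    and B: "finite B" "\<And>j. j \<in> J \<Longrightarrow> v j \<in> span B"
  shows "card J \<le> card B"
proof -
  have anti: "i \<le> j \<Longrightarrow> V j \<subseteq> V i" for i j
    using lift_Suc_antimono_le[of V] mono by blast
  have "A \<subseteq> J \<Longrightarrow> independent (v ` A) \<and> card (v ` A) = card A" if "finite A" for A
    using that
  proof (induction A rule: finite_linorder_min_induct)
    case empty then show ?case by (simp add: independent_empty)
  next
    case (insert b A)
    have "v ` A \<subseteq> V (Suc b)"
    proof
      fix x assume "x \<in> v ` A"
      then obtain a where a: "x = v a" "a \<in> A" by blast
      then have "v a \<in> V a" "Suc b \<le> a" using insert.prems insert.hyps(2) J(2) by auto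
      then show "x \<in> V (Suc b)" using a(1) anti by blast
    qed
    then have "span (v ` A) \<subseteq> V (Suc b)" using span_minimal sub by blast
    then have nin: "v b \<notin> span (v ` A)" using J(3) insert.prems by blast
    then have nin': "v b \<notin> v ` A" using span_base by blast
    have bA: "b \<notin> A" using insert.hyps(2) by blast
    have IH: "independent (v ` A)" "card (v ` A) = card A" using insert by auto
    have "independent (v ` insert b A)" using IH(1) nin nin' by (simp add: independent_insert)
    then show ?case using IH nin' bA insert.hyps(1) by simp
  qed
  from this[OF J(1)] have "independent (v ` J)" "card (v ` J) = card J" by auto
  moreover have "v ` J \<subseteq> span B" using B(2) by blast
  ultimately show ?thesis using independent_span_bound[OF B(1)] by metis
qed

context
  assumes perf: "perfect_pos_char TYPE('k::field)"
begin

text \<open>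
  Let \<open>V j\<close> consist of the values at \<open>f\<^sup>j\<close> of the \<open>q\<^sup>-\<^sup>1\<close>-linear maps. If all coordinates of \<open>f\<^sup>j\<close> were in \<open>V (j + 1)\<close>, they
  could be reassembled to an operator that maps \<open>f\<^sup>j\<^sup>+\<^sup>1\<close> to \<open>f\<^sup>j\<close>. So at a jump some coordinate leaves \<open>V (j + 1)\<close>;
  these coordinates lie in the span of the monomials with exponents at most \<open>d\<close>.
\<close>

lemma card_jumps_le:
  fixes f :: "('n::finite, 'k) mpol"
  assumes f: "exps_le d f"
  shows "card (jumps f (CHAR('k) ^ e)) \<le> card (exp_box (Suc d) :: ('n \<Rightarrow>\<^sub>0 nat) set)"
proof -
  define q where "q = CHAR('k) ^ e"
  note q0 = q_pos[OF perf q_def]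
  interpret vs: vector_space "\<lambda>(c::'k) (x :: ('n, 'k) mpol). mconst c * x"
    by (rule vector_space_mpol)
  define V where "V j = {\<phi> (f ^ j) | \<phi>. cartier_lin q \<phi>}" for j
  have V_add: "x + y \<in> V j" if xy: "x \<in> V j" "y \<in> V j" for x y j
  proof -
    obtain \<phi> \<psi> where "x = \<phi> (f ^ j)" "y = \<psi> (f ^ j)" "cartier_lin q \<phi>" "cartier_lin q \<psi>"
      using xy unfolding V_def by blast
    then show ?thesis unfolding V_def using cartier_lin_add[of q \<phi> \<psi>] by (intro CollectI exI[of _ "\<lambda>x. \<phi> x + \<psi> x"]) simp
  qed
  have V_mult: "c * x \<in> V j" if x: "x \<in> V j" for c x j
  proof -
    obtain \<phi> where "x = \<phi> (f ^ j)" "cartier_lin q \<phi>" using x by (auto simp: V_def)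
    then show ?thesis unfolding V_def using cartier_lin_lmult[of q \<phi> c]
      by (intro CollectI exI[of _ "\<lambda>x. c * \<phi> x"]) simp
  qed
  have V_zero: "0 \<in> V j" for j
    unfolding V_def by (intro CollectI exI[of _ "\<lambda>x. 0"]) (simp add: cartier_lin_def)
  have "\<exists>b\<in>exp_box q. frob_coord q b (f ^ j) \<notin> V (Suc j)" if j: "j \<in> jumps f q" for j
  proof (rule ccontr)
    assume "\<not> ?thesis"
    then have "\<forall>b\<in>exp_box q. \<exists>\<phi>. cartier_lin q \<phi> \<and> frob_coord q b (f ^ j) = \<phi> (f ^ Suc j)"
      unfolding V_def by blast
    then obtain \<phi> where \<phi>: "\<And>b. b \<in> exp_box q \<Longrightarrow> cartier_lin q (\<phi> b)"
      "\<And>b. b \<in> exp_box q \<Longrightarrow> frob_coord q b (f ^ j) = \<phi> b (f ^ Suc j)" by metis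
    have "frob_lin q (\<lambda>x. \<Sum>b\<in>exp_box q. \<phi> b x ^ q * Poly_Mapping.single b 1)"
      by (rule frob_lin_cartier_sum[OF mpol_char[OF perf q_def] \<phi>(1)])
    moreover have "(\<Sum>b\<in>exp_box q. \<phi> b (f ^ Suc j) ^ q * Poly_Mapping.single b 1) = f ^ j"
      by (rule trans[OF _ frob_coord_expansion[OF perf q_def, of "f ^ j"]], rule sum.cong) (auto simp: \<phi>(2))
    ultimately show False using j unfolding jumps_def by blast
  qed
  then obtain b where b: "\<And>j. j \<in> jumps f q \<Longrightarrow> b j \<in> exp_box q"
    "\<And>j. j \<in> jumps f q \<Longrightarrow> frob_coord q (b j) (f ^ j) \<notin> V (Suc j)" by metis
  define B :: "('n, 'k) mpol set" where "B = (\<lambda>m. Poly_Mapping.single m 1) ` exp_box (Suc d)"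
  have single: "Poly_Mapping.single m c \<in> vs.span B" if "m \<in> exp_box (Suc d)" for m c
  proof -
    have "mconst c * Poly_Mapping.single m 1 \<in> vs.span B"
      using that by (intro vs.span_scale vs.span_base) (auto simp: B_def)
    then show ?thesis by (simp add: mconst_def mult_single)
  qed
  have "card (jumps f q) \<le> card B"
  proof (rule vs.card_chain_le[where V = V and v = "\<lambda>j. frob_coord q (b j) (f ^ j)"])
    show "vs.subspace (V j)" for j
      by (rule vs.subspaceI) (auto intro: V_add V_mult V_zero)
    show "V (Suc j) \<subseteq> V j" for j
    proof
      fix x assume "x \<in> V (Suc j)"
      then obtain \<phi> where "x = \<phi> (f * f ^ j)" "cartier_lin q \<phi>" by (auto simp: V_def)
      then show "x \<in> V j" unfolding V_def using cartier_lin_rmult[of q \<phi> f]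
        by (intro CollectI exI[of _ "\<lambda>x. \<phi> (f * x)"]) simp
    qed
    show "finite (jumps f q)" by (rule finite_subset[of _ "{..<q}"]) (auto simp: jumps_def)
    show "finite B" unfolding B_def by (intro finite_imageI finite_exp_box)
    fix j assume j: "j \<in> jumps f q"
    show "frob_coord q (b j) (f ^ j) \<in> V j"
      unfolding V_def using frob_coord_cartier[OF perf q_def] by blast
    show "frob_coord q (b j) (f ^ j) \<notin> V (Suc j)" using b(2)[OF j] .
    have "j * d \<le> q * d" using j by (intro mult_right_mono) (auto simp: jumps_def)
    then have "j * d < q * Suc d" using q0 unfolding mult_Suc_right by linarith
    then have "exps_le d (frob_coord q (b j) (f ^ j))"
      using exps_le_frob_coord exps_le_power[OF f] by blast
    then have "Poly_Mapping.keys (frob_coord q (b j) (f ^ j)) \<subseteq> exp_box (Suc d)"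
      by (auto simp: exps_le_def exp_box_def less_Suc_eq_le)
    moreover have "x \<in> vs.span B" if "Poly_Mapping.keys x \<subseteq> exp_box (Suc d)" for x
    proof -
      have "x = (\<Sum>m\<in>Poly_Mapping.keys x. Poly_Mapping.single m (Poly_Mapping.lookup x m))"
        by (rule poly_mapping_eqI) (simp add: lookup_sum lookup_single when_def sum.delta in_keys_iff)
      moreover have "\<dots> \<in> vs.span B" using that single by (intro vs.span_sum) blast
      ultimately show ?thesis by simp
    qed
    ultimately show "frob_coord q (b j) (f ^ j) \<in> vs.span B" by blast
  qed
  also have "\<dots> \<le> card (exp_box (Suc d) :: ('n \<Rightarrow>\<^sub>0 nat) set)"
    unfolding B_def by (intro card_image_le finite_exp_box)
  finally show ?thesis unfolding q_def .
qed

text \<open>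
  When \<open>q\<close> exceeds all exponents of \<open>f\<close>, the coordinates of \<open>f\<close> are constants, one of which is not \<open>0\<close>.
\<close>

lemma zero_not_jump:
  fixes f :: "('n::finite, 'k) mpol"
  assumes "f \<noteq> 0"
  shows "\<exists>e. 0 \<notin> jumps f (CHAR('k) ^ e)"
proof -
  obtain d where d: "exps_le d f" using exps_le_exists by blast
  (* the level d itself suffices, as p^d > d *)
  define q where "q = CHAR('k) ^ d"
  have dq: "d < q" unfolding q_def using prime_gt_1_nat[OF perfect_prime[OF perf]] by (simp add: power_gt_expt)
  obtain b where b: "b \<in> Poly_Mapping.keys f" using assms by fastforce
  have eq: "mmod q m = m" "mdiv q m = 0" if "m \<in> Poly_Mapping.keys f" for m
  proof -
    have "Poly_Mapping.lookup m i < q" for i using d that dq by (auto simp: exps_le_def intro: le_less_trans)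
    then show "mmod q m = m" "mdiv q m = 0" by (auto intro!: poly_mapping_eqI)
  qed
  define c where "c = Poly_Mapping.lookup f b"
  have c0: "c \<noteq> 0" using b by (simp add: c_def in_keys_iff)
  have "frob_coord q b f = (\<Sum>m\<in>Poly_Mapping.keys f. if m = b then mconst (qth_root q (Poly_Mapping.lookup f m)) else 0)"
    unfolding frob_coord_def by (rule sum.cong) (auto simp: eq mconst_def)
  also have "\<dots> = mconst (qth_root q c)" using b by (simp add: sum.delta c_def)
  finally have cf: "frob_coord q b f = mconst (qth_root q c)" .
  define P :: "('n, 'k) mpol \<Rightarrow> ('n, 'k) mpol" where "P x = (\<Sum>b'\<in>{b}. frob_coord q b' x ^ q * mconst (inverse c))" for x
  have "mconst (qth_root q c) ^ q * mconst (inverse c) = (1 :: ('n, 'k) mpol)"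
    using c0 by (simp only: mconst_power[symmetric] qth_root_power[OF perf q_def] mconst_simps(2)[symmetric])
      (simp add: mconst_simps)
  then have Pf: "P (f ^ Suc 0) = f ^ 0" by (simp add: P_def cf)
  have "frob_lin q P"
    unfolding P_def by (rule frob_lin_cartier_sum[OF mpol_char[OF perf q_def] frob_coord_cartier[OF perf q_def]])
  then have "0 \<notin> jumps f q" using Pf unfolding jumps_def by blast
  then show ?thesis unfolding q_def by blast
qed

lemma digit_words_jumps:
  fixes f :: "('n::finite, 'k) mpol"
  shows "\<exists>C. digit_words CHAR('k) (\<lambda>e. jumps f (CHAR('k) ^ e)) C"
proof -
  obtain d where d: "exps_le d f" using exps_le_exists by blast
  define p where "p = CHAR('k)"
  have p: "p = CHAR('k) ^ 1" by (simp add: p_def)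
  have prime: "prime p" using perfect_prime[OF perf] by (simp add: p_def)
  have box0: "mmod p 0 = (0::'n \<Rightarrow>\<^sub>0 nat)" "mdiv p 0 = (0::'n \<Rightarrow>\<^sub>0 nat)"
    by (auto intro!: poly_mapping_eqI)
  have char: "prime CHAR(('n, 'k) mpol)" "p = CHAR(('n, 'k) mpol)"
    using mpol_char[OF perf p] by simp_all
  have split: "cartier_lin p (frob_coord p 0 :: ('n, 'k) mpol \<Rightarrow> _)" "frob_coord p 0 (1 :: ('n, 'k) mpol) = 1"
    using frob_coord_cartier[OF perf p] frob_coord_single[OF perf p, of "0 :: 'n \<Rightarrow>\<^sub>0 nat" 0 1] qth_root_simps(4)[OF perf p]
    by (simp_all add: box0)
  have "digit_words p (\<lambda>e. jumps f (p ^ e)) (card (exp_box (Suc d) :: ('n \<Rightarrow>\<^sub>0 nat) set))"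
  proof
    show "2 \<le> p" using prime_ge_2_nat[OF prime] .
    show "j < p ^ e" if "j \<in> jumps f (p ^ e)" for j e using that by (simp add: jumps_def)
    show "card (jumps f (p ^ e)) \<le> card (exp_box (Suc d) :: ('n \<Rightarrow>\<^sub>0 nat) set)" for e
      unfolding p_def by (rule card_jumps_le[OF d])
    show "j mod p ^ e \<in> jumps f (p ^ e)" if "j \<in> jumps f (p ^ Suc e)" for j e
      using jumps_mod[of j f "p ^ e" p] that prime_gt_0_nat[OF prime] by (simp add: mult.commute)
    show "j div p \<in> jumps f (p ^ e)" if "j \<in> jumps f (p ^ Suc e)" for j e
      using jumps_div[OF char split] that by simp
    show "\<exists>r<p. p * j + r \<in> jumps f (p ^ Suc e)" if "j \<in> jumps f (p ^ e)" for j e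
      using jumps_lift[OF char split] that by simp
  qed
  then show ?thesis unfolding p_def by blast
qed

lemma jump_limits_rational:
  fixes f :: "('n::finite, 'k) mpol"
  assumes "f \<noteq> 0"
  defines "Z \<equiv> {z \<in> padic_ints CHAR('k). \<forall>e. digit_trunc CHAR('k) z e \<in> jumps f (CHAR('k) ^ e)}"
  shows "finite Z" "z \<in> Z \<Longrightarrow> \<exists>r. padic_eq_rat CHAR('k) z r \<and> - 1 \<le> r \<and> r < 0"
proof -
  obtain C where "digit_words CHAR('k) (\<lambda>e. jumps f (CHAR('k) ^ e)) C" using digit_words_jumps by blast
  then interpret digit_words "CHAR('k)" "\<lambda>e. jumps f (CHAR('k) ^ e)" C .
  have Z: "Z = limit_words" by (simp add: Z_def limit_words_def)
  show "finite Z" unfolding Z by (rule finite_limit_words)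
  show "\<exists>r. padic_eq_rat CHAR('k) z r \<and> - 1 \<le> r \<and> r < 0" if z: "z \<in> Z"
  proof -
    obtain b where b: "b > 0" "\<And>i. z (i + b) = z i" using limit_words_periodic z Z by blast
    obtain e where "0 \<notin> jumps f (CHAR('k) ^ e)" using zero_not_jump[OF assms(1)] by blast
    then have "digit_trunc CHAR('k) z e \<noteq> 0" using z unfolding Z_def by (metis (mono_tags, lifting) mem_Collect_eq)
    then obtain n where "z n \<noteq> 0" unfolding digit_trunc_def by (metis (no_types, lifting) mult_zero_left sum.neutral)
    moreover have "z \<in> padic_ints CHAR('k)" using z by (simp add: Z_def)
    ultimately show ?thesis by (intro padic_periodic_rat_bounds[where b = b and n = n] p b)
  qed
qed

end

section \<open>Operators on polynomials and on the localization\<close>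

lemma const_subalgebra_mpol: "const_subalgebra mconst (UNIV :: ('n, 'k::field) mpol set)"
  by standard auto

definition mvar :: "'n \<Rightarrow> ('n, 'k::field) mpol" where
  "mvar i = Poly_Mapping.single (Poly_Mapping.single i 1) 1"

lemma single_alg_gen: "Poly_Mapping.single m (1::'k::field) \<in> alg_gen mconst (range mvar)"
proof (induction m rule: poly_mapping_induct_sum)
  case zero
  show ?case using gen_const[of mconst 1] by (simp add: mconst_simps)
next
  case (monomial i n)
  show ?case
  proof (induction n)
    case 0 then show ?case using gen_const[of mconst 1] by (simp add: mconst_simps)
  next
    case (Suc n)
    have "Poly_Mapping.single (Poly_Mapping.single i (Suc n)) (1::'k) =
        mvar i * Poly_Mapping.single (Poly_Mapping.single i n) 1"
      by (simp add: mvar_def mult_single single_add[symmetric])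
    then show ?case using Suc gen_mult gen_base by (metis rangeI)
  qed
next
  case (sum x y)
  have "Poly_Mapping.single (x + y) (1::'k) = Poly_Mapping.single x 1 * Poly_Mapping.single y 1"
    by (simp add: mult_single)
  then show ?case using sum gen_mult by metis
qed

lemma mpol_alg_gen: "(x :: ('n, 'k::field) mpol) \<in> alg_gen mconst (range mvar)"
proof (induction x rule: poly_mapping_induct_sum)
  case zero show ?case using gen_const[of mconst 0] by (simp add: mconst_simps)
next
  case (monomial m c)
  have "Poly_Mapping.single m c = mconst c * Poly_Mapping.single m 1"
    by (simp add: mconst_def mult_single)
  then show ?case using single_alg_gen gen_const gen_mult by metis
next
  case (sum x y) then show ?case using gen_add by blast
qed

context
  fixes p
  assumes perf: "perfect_pos_char TYPE('k::field)" and p: "p = CHAR('k)"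
begin

lemma p_prime: "prime p"
  using perfect_prime[OF perf] p by simp

lemma mconst_root: "\<exists>a. mconst c = (a :: ('n, 'k) mpol) ^ p ^ e"
  using qth_root_power[OF perf, of "p ^ e" e c] p mconst_power by metis

lemma frob_lin_mconst:
  assumes "frob_lin (p ^ e) P" shows "P (mconst c * x) = mconst c * P (x :: ('n, 'k) mpol)"
proof -
  obtain a :: "('n, 'k) mpol" where "mconst c = a ^ p ^ e" using mconst_root by blast
  then show ?thesis using frob_linD(2)[OF assms] by simp
qed

lemma frob_lin_poly_mconst:
  assumes "frob_lin (p ^ e) P" shows "P ([:mconst c:] * x) = [:mconst c:] * P (x :: ('n, 'k) mpol poly)"
proof -
  obtain a :: "('n, 'k) mpol" where "mconst c = a ^ p ^ e" using mconst_root by blast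
  then have "[:mconst c:] = [:a:] ^ p ^ e" by (simp add: poly_const_pow)
  then show ?thesis using frob_linD(2)[OF assms] by metis
qed

text \<open>
  Linearity over constants is automatic on the right, since a constant is a \<open>p\<^sup>e\<close>-th power when \<open>k\<close> is
  perfect.
\<close>

lemma diff_ops_mpol_iff:
  fixes P :: "('n::finite, 'k) mpol \<Rightarrow> ('n, 'k) mpol"
  shows "P \<in> diff_ops mconst UNIV \<longleftrightarrow> (\<exists>e. frob_lin (p ^ e) P)"
proof
  interpret const_subalgebra mconst "UNIV :: ('n, 'k) mpol set" by (rule const_subalgebra_mpol)
  have pm: "CHAR(('n, 'k) mpol) = p" by (simp add: CHAR_poly_mapping p)
  {
    assume P: "P \<in> diff_ops mconst UNIV"
    obtain e where "\<And>a x. P (a ^ p ^ e * x) = a ^ p ^ e * P x"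
      using diff_ops_char_linear[OF P] p_prime pm by auto
    moreover have "P (x + y) = P x + P y" for x y
      using P diff_ops_le_lin lin_endosD(3) unfolding diff_ops_def by blast
    ultimately show "\<exists>e. frob_lin (p ^ e) P" by (auto simp: frob_lin_def)
  next
    assume "\<exists>e. frob_lin (p ^ e) P"
    then obtain e where P: "frob_lin (p ^ e) P" by blast
    show "P \<in> diff_ops mconst UNIV"
    proof (rule diff_opsI_char[where G = "range mvar" and e = e])
      show "P \<in> lin_endos mconst UNIV"
        by (rule lin_endosI) (auto simp: frob_linD(1)[OF P] frob_lin_mconst[OF P])
    qed (auto simp: pm p_prime frob_linD(2)[OF P] mpol_alg_gen)
  }
qed

end

abbreviation f_sub_t :: "('n::{finite,linorder}, 'k::field) mpol \<Rightarrow> ('n, 'k) mpol poly fract" where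
  "f_sub_t f \<equiv> to_fract [:f, -1:]"

lemma to_fract_power: "to_fract (x ^ n) = to_fract x ^ n"
  by (induction n) auto

lemma f_sub_t_nonzero: "f_sub_t f \<noteq> 0"
  by simp

lemma loc_ring_eq: "loc_ring f = {to_fract a / f_sub_t f ^ m | a m. True}"
  by (simp add: loc_ring_def Fract_conv_to_fract to_fract_power)

text \<open>
  The exponent of the denominator may be enlarged to a multiple of any \<open>q\<close>, so that denominators are scalars for
  operators at level \<open>q\<close>.
\<close>

lemma loc_ringE:
  assumes "u \<in> loc_ring f" "q > 0"
  obtains a m where "u = to_fract a / f_sub_t f ^ (q * m)"
proof -
  obtain a m where u: "u = to_fract a / f_sub_t f ^ m" using assms(1) by (auto simp: loc_ring_eq)
  have "m \<le> q * m" using assms(2) by simp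
  then have "f_sub_t f ^ (q * m) = f_sub_t f ^ (q * m - m) * f_sub_t f ^ m" by (simp add: power_add[symmetric])
  then have "u = to_fract (a * [:f, -1:] ^ (q * m - m)) / f_sub_t f ^ (q * m)"
    using u f_sub_t_nonzero[of f] by (simp add: to_fract_power)
  then show ?thesis using that by blast
qed

lemma loc_ringI: "to_fract a / f_sub_t f ^ m \<in> loc_ring f"
  by (auto simp: loc_ring_eq)

lemma to_fract_loc_ring: "to_fract a \<in> loc_ring f"
  using loc_ringI[of a f 0] by simp

lemma frac_eq_iff:
  "to_fract a / f_sub_t f ^ m = to_fract b / f_sub_t f ^ n \<longleftrightarrow> a * [:f, -1:] ^ n = b * [:f, -1:] ^ m"
proof -
  have "to_fract a / f_sub_t f ^ m = to_fract b / f_sub_t f ^ n \<longleftrightarrow> to_fract a * f_sub_t f ^ n = to_fract b * f_sub_t f ^ m"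
    using f_sub_t_nonzero[of f] by (simp add: frac_eq_eq)
  also have "\<dots> \<longleftrightarrow> to_fract (a * [:f, -1:] ^ n) = to_fract (b * [:f, -1:] ^ m)"
    by (simp only: to_fract_mult to_fract_power)
  finally show ?thesis by (simp only: to_fract_eq_iff)
qed

text \<open>
  The numerator is written with explicit \<open>q\<close>-th powers as coefficients, in the form to which linearity over
  \<open>q\<close>-th powers applies.
\<close>

lemma frac_add:
  "to_fract a / f_sub_t f ^ (q * m) + to_fract b / f_sub_t f ^ (q * n) =
   to_fract (([:f, -1:] ^ n) ^ q * a + ([:f, -1:] ^ m) ^ q * b) / f_sub_t f ^ (q * (m + n))"
  using f_sub_t_nonzero[of f]
  by (simp add: to_fract_power power_add distrib_left add_frac_eq mult_ac flip: power_mult del: to_fract_eq_0_iff)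

abbreviation loc_const :: "'k::field \<Rightarrow> ('n::{finite,linorder}, 'k) mpol poly fract" where
  "loc_const c \<equiv> to_fract [:mconst c:]"

lemma const_subalgebra_loc:
  "const_subalgebra loc_const (loc_ring (f :: ('n::{finite,linorder}, 'k::field) mpol))"
proof
  show "loc_const c \<in> loc_ring f" for c by (rule to_fract_loc_ring)
  show "1 \<in> loc_ring f" using to_fract_loc_ring[of 1 f] by simp
  fix x assume "x \<in> loc_ring f"
  then obtain a m where x: "x = to_fract a / f_sub_t f ^ (1 * m)" using loc_ringE[of x f 1] by auto
  show "- x \<in> loc_ring f" using loc_ringI[of "- a" f m] by (simp add: x)
  fix y assume "y \<in> loc_ring f"
  then obtain b n where y: "y = to_fract b / f_sub_t f ^ (1 * n)" using loc_ringE[of y f 1] by auto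
  show "x + y \<in> loc_ring f" unfolding x y frac_add by (rule loc_ringI)
  show "x * y \<in> loc_ring f" using loc_ringI[of "a * b" f "m + n"] by (simp add: x y power_add)
qed

definition loc_gens :: "('n::{finite,linorder}, 'k::field) mpol \<Rightarrow> ('n, 'k) mpol poly fract set" where
  "loc_gens f = insert (1 / f_sub_t f) (insert (to_fract [:0, 1:]) (range (\<lambda>i. to_fract [:mvar i:])))"

lemma loc_gens_subset: "loc_gens f \<subseteq> loc_ring f"
  using loc_ringI[of 1 f 1] by (auto simp: loc_gens_def to_fract_loc_ring)

lemma loc_ring_alg_gen: "loc_ring f \<subseteq> alg_gen loc_const (loc_gens f)"
proof
  fix u assume "u \<in> loc_ring f"
  then obtain a m where "u = to_fract a / f_sub_t f ^ m" by (auto simp: loc_ring_eq)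
  then have u: "u = to_fract a * (1 / f_sub_t f) ^ m" by (simp add: power_one_over)
  have c: "to_fract [:c:] \<in> alg_gen loc_const (loc_gens f)" for c
    using mpol_alg_gen[of c]
  proof induction
    case (gen_const c) then show ?case by (rule alg_gen.gen_const)
  next
    case (gen_base g) then show ?case by (intro alg_gen.gen_base) (auto simp: loc_gens_def)
  next
    case (gen_add a b)
    have "to_fract [:a + b:] = to_fract [:a:] + to_fract [:b:]" by (simp flip: to_fract_add)
    then show ?case using alg_gen.gen_add[OF gen_add.IH] by simp
  next
    case (gen_mult a b)
    have "to_fract [:a * b:] = to_fract [:a:] * to_fract [:b:]" by (simp flip: to_fract_mult)
    then show ?case using alg_gen.gen_mult[OF gen_mult.IH] by simp
  qed
  have "to_fract a \<in> alg_gen loc_const (loc_gens f)"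
  proof (induction a rule: pCons_induct)
    case 0 then show ?case using c[of 0] by simp
  next
    case (pCons x a)
    have "to_fract (pCons x a) = to_fract [:x:] + to_fract [:0, 1:] * to_fract a"
      by (simp flip: to_fract_mult to_fract_add)
    moreover have "to_fract [:0, 1:] \<in> alg_gen loc_const (loc_gens f)"
      by (intro alg_gen.gen_base) (auto simp: loc_gens_def)
    ultimately show ?case using c pCons(2) by (metis alg_gen.gen_add alg_gen.gen_mult)
  qed
  moreover have "(1 / f_sub_t f) ^ m \<in> alg_gen loc_const (loc_gens f)"
  proof (induction m)
    case 0 then show ?case using c[of 1] by (simp flip: one_pCons)
  next
    case (Suc m)
    have "1 / f_sub_t f \<in> alg_gen loc_const (loc_gens f)"
      by (intro alg_gen.gen_base) (auto simp: loc_gens_def)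
    then show ?case using Suc by (simp only: power_Suc alg_gen.gen_mult)
  qed
  ultimately show "u \<in> alg_gen loc_const (loc_gens f)" unfolding u by (rule alg_gen.gen_mult)
qed

context
  fixes p e q :: nat and f :: "('n::{finite,linorder}, 'k::field) mpol"
  assumes perf: "perfect_pos_char TYPE('k)" and p: "p = CHAR('k)" and q: "q = p ^ e"
begin

lemma CHAR_mpol_poly: "CHAR(('n, 'k) mpol poly) = p"
  by (simp add: p CHAR_poly_mapping)

lemma CHAR_loc: "CHAR(('n, 'k) mpol poly fract) = p"
proof (rule CHAR_eqI)
  have "of_nat n = (0 :: ('n, 'k) mpol poly fract) \<longleftrightarrow> of_nat n = (0 :: ('n, 'k) mpol poly)" for n
    by (metis Fract_of_nat_eq to_fract_def to_fract_eq_0_iff)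
  then show "of_nat p = (0 :: ('n, 'k) mpol poly fract)"
    "\<And>x. of_nat x = (0 :: ('n, 'k) mpol poly fract) \<Longrightarrow> p dvd x"
    using CHAR_mpol_poly by (simp_all add: of_nat_eq_0_iff_char_dvd)
qed

text \<open>
  On fractions whose denominator is a \<open>q\<close>-th power, the extension has to act on the numerator; this is well defined
  and linear over \<open>q\<close>-th powers, hence a differential operator, and it is the only extension by
  \<open>diff_ops_eqI_localization\<close>.
\<close>

lemma loc_ext_props:
  assumes P: "frob_lin q P"
  shows "loc_ext f P \<in> diff_ops loc_const (loc_ring f)" (is ?A)
    and "loc_ext f P (to_fract a / f_sub_t f ^ (q * m)) = to_fract (P a) / f_sub_t f ^ (q * m)" (is ?B)
proof -
  interpret const_subalgebra loc_const "loc_ring f" by (rule const_subalgebra_loc)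
  have q0: "q > 0" using p_prime[OF perf p] q by (simp add: prime_gt_0_nat)
  let ?h = "[:f, -1:]"
  define Q where "Q = (\<lambda>u\<in>loc_ring f. case (SOME (a, m). u = to_fract a / f_sub_t f ^ (q * m)) of
    (a, m) \<Rightarrow> to_fract (P a) / f_sub_t f ^ (q * m))"
  have Q: "Q (to_fract a / f_sub_t f ^ (q * m)) = to_fract (P a) / f_sub_t f ^ (q * m)" for a m
  proof -
    let ?C = "\<lambda>(b, n). to_fract a / f_sub_t f ^ (q * m) = to_fract b / f_sub_t f ^ (q * n)"
    obtain b n where bn: "(SOME bn. ?C bn) = (b, n)" by fastforce
    have "?C (SOME bn. ?C bn)" by (rule someI[of _ "(a, m)"]) simp
    then have "to_fract a / f_sub_t f ^ (q * m) = to_fract b / f_sub_t f ^ (q * n)" unfolding bn by simp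
    then have "a * ?h ^ (q * n) = b * ?h ^ (q * m)" by (simp only: frac_eq_iff)
    then have "P ((?h ^ n) ^ q * a) = P ((?h ^ m) ^ q * b)" by (simp only: power_mult[symmetric] mult.commute)
    then have "P a * ?h ^ (q * n) = P b * ?h ^ (q * m)"
      by (simp only: frob_linD(2)[OF P]) (simp only: power_mult[symmetric] mult.commute)
    then have "to_fract (P a) / f_sub_t f ^ (q * m) = to_fract (P b) / f_sub_t f ^ (q * n)"
      by (simp only: frac_eq_iff)
    then show ?thesis unfolding Q_def using loc_ringI[of a f "q * m"] bn by simp
  qed
  have Qf: "Q (to_fract a) = to_fract (P a)" for a using Q[of a 0] by simp
  have Qlin: "Q (to_fract b ^ q / f_sub_t f ^ (q * n) * x) = to_fract b ^ q / f_sub_t f ^ (q * n) * Q x"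
    if mem: "x \<in> loc_ring f" for b n x
  proof -
    obtain a m where x: "x = to_fract a / f_sub_t f ^ (q * m)" by (rule loc_ringE[OF mem q0])
    have "Q (to_fract (b ^ q * a) / f_sub_t f ^ (q * (n + m))) = to_fract (b ^ q * P a) / f_sub_t f ^ (q * (n + m))"
      by (simp only: Q frob_linD(2)[OF P])
    then have "Q (to_fract b ^ q / f_sub_t f ^ (q * n) * (to_fract a / f_sub_t f ^ (q * m))) =
        to_fract b ^ q / f_sub_t f ^ (q * n) * (to_fract (P a) / f_sub_t f ^ (q * m))"
      by (simp add: to_fract_power power_add distrib_left)
    then show ?thesis unfolding x by (simp only: Q)
  qed
  have Q_lin: "Q \<in> lin_endos loc_const (loc_ring f)"
  proof (rule lin_endosI)
    fix x assume x: "x \<in> loc_ring f"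
    obtain a m where xa: "x = to_fract a / f_sub_t f ^ (q * m)" by (rule loc_ringE[OF x q0])
    show "Q x \<in> loc_ring f" unfolding xa Q by (rule loc_ringI)
    show "Q (loc_const c * x) = loc_const c * Q x" for c
    proof -
      have "Q (to_fract ([:mconst c:] * a) / f_sub_t f ^ (q * m)) = to_fract ([:mconst c:] * P a) / f_sub_t f ^ (q * m)"
        by (simp only: Q frob_lin_poly_mconst[OF perf p P[unfolded q]])
      then show ?thesis unfolding xa Q to_fract_mult by simp
    qed
    fix y assume y: "y \<in> loc_ring f"
    obtain b n where yb: "y = to_fract b / f_sub_t f ^ (q * n)" by (rule loc_ringE[OF y q0])
    show "Q (x + y) = Q x + Q y" unfolding xa yb frac_add Q frob_linD[OF P] ..
  qed (simp add: Q_def)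
  have Qd: "Q \<in> diff_ops loc_const (loc_ring f)"
  proof (rule diff_opsI_char[OF loc_gens_subset loc_ring_alg_gen _ _ _ Q_lin, where e = e])
    show "finite (loc_gens f)" "loc_gens f \<noteq> {}" by (auto simp: loc_gens_def)
    show "prime CHAR(('n, 'k) mpol poly fract)" using p_prime[OF perf p] by (simp add: CHAR_loc)
    fix g x assume g: "g \<in> loc_gens f" and x: "x \<in> loc_ring f"
    have "g \<in> loc_ring f" using g loc_gens_subset by blast
    then obtain b n where "g = to_fract b / f_sub_t f ^ (1 * n)" using loc_ringE[of g f 1] by auto
    then have "g ^ q = to_fract b ^ q / f_sub_t f ^ (q * n)" by (simp add: power_divide power_mult[symmetric] mult.commute)
    then show "Q (g ^ CHAR(('n, 'k) mpol poly fract) ^ e * x) = g ^ CHAR(('n, 'k) mpol poly fract) ^ e * Q x"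
      using Qlin[OF x] by (simp add: CHAR_loc q[symmetric])
  qed
  have uniq: "Q' = Q" if Q': "Q' \<in> diff_ops loc_const (loc_ring f) \<and> (\<forall>a. Q' (to_fract a) = to_fract (P a))" for Q'
  proof (rule diff_ops_eqI_localization[where T = Rt])
    show "Q' \<in> diff_ops loc_const (loc_ring f)" "Q \<in> diff_ops loc_const (loc_ring f)" using Q' Qd by auto
    show "Rt \<subseteq> loc_ring f" using to_fract_loc_ring by blast
    show "a * b \<in> Rt" if "a \<in> Rt" "b \<in> Rt" for a b using that by (auto simp flip: to_fract_mult)
    show "Q' a = Q a" if "a \<in> Rt" for a using that Q' Qf by auto
    fix u assume "u \<in> loc_ring f"
    then obtain a m where u: "u = to_fract a / f_sub_t f ^ (1 * m)" using loc_ringE[of u f 1] by auto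
    have "to_fract (?h ^ m) * u = to_fract a" using f_sub_t_nonzero[of f] by (simp add: u to_fract_power)
    then have "to_fract (?h ^ m) * u \<in> Rt" by (simp only: rangeI)
    moreover have "to_fract (?h ^ m) \<noteq> 0" by simp
    ultimately show "\<exists>h\<in>Rt. h * u \<in> Rt \<and> (\<forall>v. h * v = 0 \<longrightarrow> v = 0)"
      by (intro bexI[of _ "to_fract (?h ^ m)"] conjI rangeI) (simp_all only: mult_eq_0_iff, simp)
  qed
  have ext: "loc_ext f P = Q"
    unfolding loc_ext_def by (rule the_equality) (use Qd Qf uniq in auto)
  show ?A ?B unfolding ext by (fact Qd Q)+
qed

end

section \<open>Functions periodic modulo a power of the characteristic\<close>

text \<open>
  Comparison of coefficients in \<open>(1 + X)\<^bsup>l + q\<^esup> = (1 + X)\<^sup>l (1 + X\<^sup>q)\<close>.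
\<close>

lemma binom_add_prime_power:
  assumes char: "prime CHAR('k::comm_ring_1)" and q: "q = CHAR('k) ^ e"
  shows "(of_nat ((l + q) choose m) :: 'k) =
    of_nat (l choose m) + (if q \<le> m then of_nat (l choose (m - q)) else 0)"
proof -
  have c: "coeff ([:1, 1:] ^ n) i = (of_nat (n choose i) :: 'k)" for n i
  proof (cases "i \<le> n")
    case False
    have "degree ([:1, 1 :: 'k:] ^ n) \<le> n" by (rule order_trans[OF degree_power_le]) simp
    then show ?thesis using False by (simp add: coeff_eq_0 binomial_eq_0)
  qed (simp add: coeff_linear_poly_power)
  have "[:1, 1 :: 'k:] ^ q = (monom 1 1 + 1) ^ q" by (simp add: monom_altdef one_pCons)
  also have "\<dots> = monom 1 q + 1"
    using freshmans_dream'[of q e "monom (1::'k) 1" 1] char q by (simp add: monom_power)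
  finally have "[:1, 1 :: 'k:] ^ (l + q) = [:1, 1:] ^ l + monom 1 q * [:1, 1:] ^ l"
    by (simp add: power_add algebra_simps)
  then have "coeff ([:1, 1 :: 'k:] ^ (l + q)) m = coeff ([:1, 1:] ^ l + monom 1 q * [:1, 1:] ^ l) m" by simp
  then show ?thesis by (simp add: c coeff_monom_mult)
qed

text \<open>
  The function \<open>l \<mapsto> (l choose p\<^sup>e)\<close> reads off the digit number \<open>e\<close> of \<open>l\<close>, the case of Lucas' theorem that is needed.
\<close>

lemma of_nat_choose_prime_power:
  assumes char: "prime CHAR('k::comm_ring_1)"
  shows "(of_nat (l choose CHAR('k) ^ e) :: 'k) = of_nat (l div CHAR('k) ^ e)"
proof (induction l rule: less_induct)
  case (less l)
  define q where "q = CHAR('k) ^ e"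
  have q0: "q > 0" using char by (simp add: q_def prime_gt_0_nat)
  show ?case
  proof (cases "l < q")
    case True
    then show ?thesis by (simp add: q_def binomial_eq_0)
  next
    case False
    then have l: "l = (l - q) + q" by simp
    have "(of_nat (l choose q) :: 'k) = of_nat ((l - q) choose q) + 1"
      by (subst l, subst binom_add_prime_power[OF char q_def]) simp
    moreover have "l div q = (l - q) div q + 1" using False q0 by (simp add: le_div_geq)
    moreover have "l - q < l" using False q0 by simp
    ultimately show ?thesis using less[of "l - q"] unfolding q_def[symmetric] by (simp add: add.commute)
  qed
qed

definition periodic_exp :: "nat \<Rightarrow> nat \<Rightarrow> (nat \<Rightarrow> 'a) \<Rightarrow> bool" where
  "periodic_exp p e a \<longleftrightarrow> (\<forall>l. a (l + p ^ e) = a l)"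

lemma periodic_expD:
  assumes "periodic_exp p e a" shows "a (l + p ^ e * m) = a l"
proof (induction m)
  case (Suc m)
  have "l + p ^ e * Suc m = (l + p ^ e * m) + p ^ e" by simp
  then show ?case using Suc assms unfolding periodic_exp_def by metis
qed simp

lemma periodic_exp_mono:
  assumes "periodic_exp p e a" "e \<le> e'" shows "periodic_exp p e' a"
proof -
  have "p ^ e' = p ^ e * p ^ (e' - e)" using assms(2) by (simp add: power_add[symmetric])
  then show ?thesis using periodic_expD[OF assms(1)] by (simp add: periodic_exp_def)
qed

lemma periodic_exp_mod:
  assumes "periodic_exp p e a" shows "a (l mod p ^ e) = a l"
  using periodic_expD[OF assms, of "l mod p ^ e" "l div p ^ e"] by simp

lemma periodic_exp_common:
  assumes "periodic_exp p e a" "periodic_exp p e' b"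
  obtains E where "periodic_exp p E a" "periodic_exp p E b"
  using periodic_exp_mono[OF assms(1), of "max e e'"] periodic_exp_mono[OF assms(2), of "max e e'"] by simp

lemma mod_power_eq_iff_digits:
  "(l::nat) mod p ^ e = j mod p ^ e \<longleftrightarrow> (\<forall>i<e. l div p ^ i mod p = j div p ^ i mod p)"
proof (induction e)
  case (Suc e)
  show ?case
  proof (cases "p = 0")
    case True
    then have "l = l div p ^ 0 mod p" "j = j div p ^ 0 mod p" by simp_all
    then show ?thesis using True by (metis mod_0_imp_dvd mod_by_0 power_Suc0_right power_0_Suc zero_less_Suc)
  next
    case False
    have eq: "l mod p ^ Suc e = p ^ e * (l div p ^ e mod p) + l mod p ^ e" for l :: nat
      using mod_mult2_eq[of l "p ^ e" p] by (simp add: mult.commute)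
    have "l mod p ^ Suc e = j mod p ^ Suc e \<longleftrightarrow>
      l mod p ^ e = j mod p ^ e \<and> l div p ^ e mod p = j div p ^ e mod p" (is "?A = ?B")
    proof
      assume A: ?A
      have pe: "p ^ e > 0" using False by simp
      have "(l mod p ^ Suc e) mod p ^ e = l mod p ^ e" "(l mod p ^ Suc e) div p ^ e = l div p ^ e mod p" for l
        using pe unfolding eq by simp_all
      then show ?B using A by metis
    qed (simp only: eq)
    then show ?thesis using Suc.IH by (auto simp: less_Suc_eq)
  qed
qed simp

definition residue_ind :: "nat \<Rightarrow> nat \<Rightarrow> nat \<Rightarrow> 'k::field" where
  "residue_ind q j l = (if l mod q = j mod q then 1 else 0)"

lemma periodic_residue_ind: "periodic_exp p e (residue_ind (p ^ e) j)"
  by (simp add: periodic_exp_def residue_ind_def)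

context
  fixes p
  assumes prime: "prime CHAR('k::field)" and p: "p = CHAR('k)"
begin

lemma binom_fun_prime_power: "binom_fun (p ^ e) l = (of_nat (l div p ^ e) :: 'k)"
  unfolding binom_fun_def p by (rule of_nat_choose_prime_power[OF prime])

lemma of_nat_pow_p: "(of_nat n :: 'k) ^ p = of_nat n"
proof (induction n)
  case 0 then show ?case using prime p by (simp add: prime_gt_0_nat)
next
  case (Suc n)
  then show ?case using freshmans_dream[OF prime p, of 1 "of_nat n"] by simp
qed

lemma of_nat_eq_iff_mod: "(of_nat a :: 'k) = of_nat b \<longleftrightarrow> a mod p = b mod p"
proof -
  have p0: "p > 0" using prime p by (simp add: prime_gt_0_nat)
  have red: "(of_nat n :: 'k) = of_nat (n mod p)" for n
  proof -
    have "(of_nat n :: 'k) = of_nat (p * (n div p) + n mod p)" by simp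
    also have "\<dots> = of_nat (n mod p)" by (simp only: of_nat_add of_nat_mult) (simp add: p)
    finally show ?thesis .
  qed
  have "x = y" if "(of_nat x :: 'k) = of_nat y" "x \<le> y" "y < p" for x y
  proof -
    have "of_nat (y - x) = (0 :: 'k)" using that by (simp add: of_nat_diff)
    then have "p dvd y - x" by (simp add: of_nat_eq_0_iff_char_dvd p)
    then show ?thesis using that by (auto dest: dvd_imp_le)
  qed
  from this[of "a mod p" "b mod p"] this[of "b mod p" "a mod p"] p0 show ?thesis
    unfolding red[of a] red[of b] by (metis mod_less_divisor nat_le_linear)
qed

text \<open>
  Fermat's little theorem: \<open>x\<^bsup>p - 1\<^esup> = 1\<close> for a nonzero \<open>x\<close> in the prime field.
\<close>

lemma digit_indicator:
  "1 - (of_nat a - of_nat b :: 'k) ^ (p - 1) = (if a mod p = b mod p then 1 else 0)"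
proof -
  define x where "x = (of_nat a - of_nat b :: 'k)"
  have p1: "p > 1" using prime_gt_1_nat[OF prime] p by simp
  have "x ^ p + of_nat b ^ p = (x + of_nat b) ^ p" using freshmans_dream[OF prime p, of x "of_nat b"] by simp
  then have "x ^ p + of_nat b = of_nat a" by (simp add: x_def of_nat_pow_p)
  then have "x ^ p = x" by (simp add: x_def eq_diff_eq)
  moreover have "x ^ p = x * x ^ (p - 1)" using p1 by (cases p) auto
  ultimately have "x \<noteq> 0 \<Longrightarrow> x ^ (p - 1) = 1" by simp
  moreover have "x = 0 \<longleftrightarrow> a mod p = b mod p" using of_nat_eq_iff_mod[of a b] by (simp add: x_def)
  ultimately show ?thesis using p1 unfolding x_def by auto
qed

text \<open>
  The indicator of a residue class modulo \<open>p\<^sup>e\<close> is a product over the digits \<open>i < e\<close> of polynomials in the digit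
  functions, and a periodic function is a combination of such indicators. So the digit functions generate \<open>A\<^sub>k\<close>, and
  the action of \<open>A\<^sub>k\<close> on a module is determined by theirs.
\<close>

lemma periodic_induct:
  assumes a: "periodic_exp p e (a :: nat \<Rightarrow> 'k)"
    and const: "\<And>c. P (\<lambda>_. c)"
    and digit: "\<And>i. P (binom_fun (p ^ i))"
    and add: "\<And>a b. P a \<Longrightarrow> P b \<Longrightarrow> P (\<lambda>l. a l + b l)"
    and mult: "\<And>a b. P a \<Longrightarrow> P b \<Longrightarrow> P (\<lambda>l. a l * b l)"
  shows "P a"
proof -
  have Psum: "P (\<lambda>l. \<Sum>i\<in>I. g i l)" if "finite I" "\<And>i. i \<in> I \<Longrightarrow> P (g i)" for I :: "nat set" and g
    using that by (induction I rule: finite_induct) (auto intro: const add)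
  have Pprod: "P (\<lambda>l. \<Prod>i\<in>I. g i l)" if "finite I" "\<And>i. i \<in> I \<Longrightarrow> P (g i)" for I :: "nat set" and g
    using that by (induction I rule: finite_induct) (auto intro: const mult)
  have Ppow: "P (\<lambda>l. g l ^ n)" if "P g" for g n
    by (induction n) (auto intro: const mult that)
  have Pminus: "P (\<lambda>l. - 1 * g l)" if "P g" for g
    by (rule mult[OF const that])
  have ind: "P (residue_ind (p ^ e) j)" for e j
  proof -
    have eq: "residue_ind (p ^ e) j = (\<lambda>l. \<Prod>i\<in>{..<e}. 1 + - 1 * (binom_fun (p ^ i) l + - of_nat (j div p ^ i)) ^ (p - 1) :: 'k)"
    proof
      fix l
      have "(\<Prod>i\<in>{..<e}. 1 + - 1 * (binom_fun (p ^ i) l + - of_nat (j div p ^ i)) ^ (p - 1) :: 'k) =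
        (\<Prod>i\<in>{..<e}. if l div p ^ i mod p = j div p ^ i mod p then 1 else 0)"
        by (rule prod.cong) (simp_all only: binom_fun_prime_power digit_indicator[symmetric], simp)
      also have "\<dots> = residue_ind (p ^ e) j l"
      proof (cases "\<forall>i<e. l div p ^ i mod p = j div p ^ i mod p")
        case True
        then show ?thesis unfolding residue_ind_def mod_power_eq_iff_digits by simp
      next
        case False
        then obtain i where i: "i < e" "l div p ^ i mod p \<noteq> j div p ^ i mod p" by blast
        then have "(\<Prod>i\<in>{..<e}. if l div p ^ i mod p = j div p ^ i mod p then 1 else 0 :: 'k) = 0"
          by (intro prod_zero) auto
        then show ?thesis using False unfolding residue_ind_def mod_power_eq_iff_digits by simp
      qed
      finally show "residue_ind (p ^ e) j l =
        (\<Prod>i\<in>{..<e}. 1 + - 1 * (binom_fun (p ^ i) l + - of_nat (j div p ^ i)) ^ (p - 1) :: 'k)" ..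
    qed
    show ?thesis unfolding eq by (intro Pprod add Pminus Ppow const digit) simp
  qed
  have "a = (\<lambda>l. \<Sum>j\<in>{..<p ^ e}. a j * residue_ind (p ^ e) j l)"
  proof
    fix l
    have lt: "l mod p ^ e < p ^ e" using prime p by (simp add: prime_gt_0_nat)
    have "(\<Sum>j\<in>{..<p ^ e}. a j * residue_ind (p ^ e) j l) = (\<Sum>j\<in>{..<p ^ e}. if j = l mod p ^ e then a j else 0)"
      by (rule sum.cong) (auto simp: residue_ind_def)
    also have "\<dots> = a l" using lt periodic_exp_mod[OF a, of l] by (simp add: sum.delta)
    finally show "a l = (\<Sum>j\<in>{..<p ^ e}. a j * residue_ind (p ^ e) j l)" ..
  qed
  moreover have "P (\<lambda>l. \<Sum>j\<in>{..<p ^ e}. a j * residue_ind (p ^ e) j l)"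
    by (intro Psum mult const ind) simp
  ultimately show ?thesis by metis
qed

lemma binom_functions_iff: "(a :: nat \<Rightarrow> 'k) \<in> binom_functions \<longleftrightarrow> (\<exists>e. periodic_exp p e a)"
proof
  assume "a \<in> binom_functions"
  then show "\<exists>e. periodic_exp p e a"
  proof induction
    case (1 c) then show ?case by (auto simp: periodic_exp_def)
  next
    case (2 n)
    have "n < p ^ n" using prime_gt_1_nat[OF prime] p by (simp add: power_gt_expt)
    then have "periodic_exp p n (binom_fun n :: nat \<Rightarrow> 'k)"
      using binom_add_prime_power[OF prime, of "p ^ n" n _ n] p by (simp add: periodic_exp_def binom_fun_def)
    then show ?case ..
  next
    case (3 a b)
    then obtain e where "periodic_exp p e a" "periodic_exp p e b" using periodic_exp_common by blast
    then show ?case by (intro exI[of _ e]) (simp add: periodic_exp_def)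
  next
    case (4 a b)
    then obtain e where "periodic_exp p e a" "periodic_exp p e b" using periodic_exp_common by blast
    then show ?case by (intro exI[of _ e]) (simp add: periodic_exp_def)
  qed
next
  assume "\<exists>e. periodic_exp p e a"
  then obtain e where "periodic_exp p e a" ..
  then show "a \<in> binom_functions" by (rule periodic_induct) (auto intro: binom_functions.intros)
qed

end

text \<open>
  The substitution \<open>s \<mapsto> - s - 1\<close>. A periodic function has a well-defined value at the negative number \<open>- n - 1\<close>, and
  \<open>(p\<^sup>e - 1) (n + 1)\<close> is a natural number in the same class modulo \<open>p\<^sup>e\<close>. It enters because \<open>- \<nu>\<^sub>e\<close> acts on \<open>t\<^sup>n\<close> as the
  digit number \<open>e\<close> of \<open>- n - 1\<close>.
\<close>

definition reflect :: "nat \<Rightarrow> (nat \<Rightarrow> 'a) \<Rightarrow> nat \<Rightarrow> 'a" where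
  "reflect p a n = a ((p ^ (SOME e. periodic_exp p e a) - 1) * (n + 1))"

lemma reflect_eq:
  assumes p: "p > 0" and a: "periodic_exp p e a"
  shows "reflect p a n = a ((p ^ e - 1) * (n + 1))"
proof -
  (* the two arguments differ by a multiple of the period p^e *)
  have *: "a ((p ^ e' - 1) * (n + 1)) = a ((p ^ e - 1) * (n + 1))" if "periodic_exp p e a" "e \<le> e'" for e e'
  proof -
    have e': "p ^ e' = p ^ e * p ^ (e' - e)" using that(2) by (simp add: power_add[symmetric])
    have "p ^ e' - 1 = (p ^ e - 1) + p ^ e * (p ^ (e' - e) - 1)"
      using p unfolding e' by (simp add: diff_mult_distrib2 Suc_leI)
    then have "(p ^ e' - 1) * (n + 1) = (p ^ e - 1) * (n + 1) + p ^ e * ((p ^ (e' - e) - 1) * (n + 1))"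
      by (simp only: distrib_right mult.assoc)
    then show ?thesis using periodic_expD[OF that(1)] by simp
  qed
  define e0 where "e0 = (SOME e. periodic_exp p e a)"
  have "periodic_exp p e0 a" unfolding e0_def using a by (rule someI)
  then have "a ((p ^ max e0 e - 1) * (n + 1)) = a ((p ^ e0 - 1) * (n + 1))" by (intro *) simp_all
  moreover have "a ((p ^ max e0 e - 1) * (n + 1)) = a ((p ^ e - 1) * (n + 1))" using a by (intro *) simp_all
  ultimately show ?thesis by (simp add: reflect_def e0_def)
qed

lemma neg_residue:
  assumes "q > (0::nat)" shows "(q - 1) * (n + 1) = q * (n - n div q) + (q - 1 - n mod q)"
proof -
  obtain d r where n: "n = q * d + r" "r < q" "d = n div q" "r = n mod q" using assms by simp
  have "d \<le> n" unfolding n(3) by (rule div_le_dividend)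
  then obtain s where s: "n = d + s" using le_Suc_ex by blast
  have "(q - 1) * (n + 1) + (n + 1) = q * (n + 1)" using assms by (cases q) auto
  moreover have "q * (n - d) + (q - 1 - r) + (n + 1) = q * (n + 1)"
  proof -
    have "q - 1 - r + r + 1 = q" using n(2) by simp
    then have "q * s + (q - 1 - r) + (q * d + r + 1) = q * s + q * d + q" by simp
    moreover have "q * (n + 1) = q * s + q * d + q" unfolding s by (simp add: distrib_left)
    ultimately show ?thesis using n(1) s by simp
  qed
  ultimately show ?thesis unfolding n(3,4) by linarith
qed

lemma periodic_reflect:
  assumes p: "p > 0" and a: "periodic_exp p e a" shows "periodic_exp p e (reflect p a)"
  unfolding periodic_exp_def
proof
  fix l
  have "(p ^ e - 1) * (l + p ^ e + 1) = (p ^ e - 1) * (l + 1) + p ^ e * (p ^ e - 1)"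
    by (simp only: add.assoc add.commute[of "p ^ e" 1] distrib_left mult.commute[of "p ^ e - 1" "p ^ e"])
  then show "reflect p a (l + p ^ e) = reflect p a l"
    unfolding reflect_eq[OF p a] by (simp only: periodic_expD[OF a])
qed

lemma reflect_residue_ind:
  assumes p: "p > 0" and j: "j < p ^ e"
  shows "reflect p (residue_ind (p ^ e) j) n = (if n mod p ^ e = p ^ e - 1 - j then 1 else 0)"
proof -
  have q: "p ^ e > 0" using p by simp
  have lt: "n mod p ^ e < p ^ e" using q by simp
  have "((p ^ e - 1) * (n + 1)) mod p ^ e = p ^ e - 1 - n mod p ^ e"
    unfolding neg_residue[OF q] using q by simp
  then show ?thesis
    unfolding reflect_eq[OF p periodic_residue_ind] residue_ind_def using j lt by auto
qed

lemma reflect_ops: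
  assumes p: "p > 0"
  shows "reflect p (\<lambda>_. c) = (\<lambda>_. c)"
    and "periodic_exp p e a \<Longrightarrow> periodic_exp p e' b \<Longrightarrow>
      reflect p (\<lambda>l. a l + b l) = (\<lambda>l. reflect p a l + reflect p b l)"
    and "periodic_exp p e a \<Longrightarrow> periodic_exp p e' b \<Longrightarrow>
      reflect p (\<lambda>l. a l * b l) = (\<lambda>l. reflect p a l * reflect p b l)"
proof -
  show "reflect p (\<lambda>_. c) = (\<lambda>_. c)" by (rule ext) (simp add: reflect_def)
  assume "periodic_exp p e a" "periodic_exp p e' b"
  then obtain E where E: "periodic_exp p E a" "periodic_exp p E b" using periodic_exp_common by blast
  have *: "periodic_exp p E (\<lambda>l. a l + b l)" "periodic_exp p E (\<lambda>l. a l * b l)"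
    using E by (simp_all add: periodic_exp_def)
  show "reflect p (\<lambda>l. a l + b l) = (\<lambda>l. reflect p a l + reflect p b l)"
    "reflect p (\<lambda>l. a l * b l) = (\<lambda>l. reflect p a l * reflect p b l)"
    unfolding reflect_eq[OF p *(1)] reflect_eq[OF p *(2)] reflect_eq[OF p E(1)] reflect_eq[OF p E(2)] by simp_all
qed

text \<open>
  Division with remainder \<open>n = Q d + r\<close> by \<open>Q = p\<^sup>e\<close> gives \<open>- n - 1 = - Q (d + 1) + (Q - 1 - r)\<close>.
\<close>

lemma reflect_binom_fun:
  assumes prime: "prime CHAR('k::field)" and p: "p = CHAR('k)"
  shows "reflect p (binom_fun (p ^ e)) n = - (of_nat (n div p ^ e) + 1 :: 'k)"
proof -
  have p0: "p > 0" using prime p by (simp add: prime_gt_0_nat)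
  define Q where "Q = p ^ e"
  have Q: "Q > 0" using p0 by (simp add: Q_def)
  have per: "periodic_exp p (Suc e) (binom_fun (p ^ e) :: nat \<Rightarrow> 'k)"
    unfolding periodic_exp_def
  proof
    fix l
    have "(l + p ^ Suc e) div p ^ e = l div p ^ e + p" using p0 by simp
    then show "binom_fun (p ^ e) (l + p ^ Suc e) = (binom_fun (p ^ e) l :: 'k)"
      unfolding binom_fun_prime_power[OF prime p] by (simp add: p)
  qed
  obtain d r where n: "n = Q * d + r" "r < Q" "d = n div Q" using Q by (metis mod_less_divisor mult_div_mod_eq)
  obtain p' where p': "p = Suc p'" using p0 by (cases p) auto
  have dn: "d \<le> n" unfolding n(3) by (rule div_le_dividend)
  have "(p * Q - 1) * (n + 1) + (n + 1) = p * Q * (n + 1)" using Q p0 by (cases "p * Q") auto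
  moreover have "Q * (p' * (n + 1) + (n - d)) + (Q - 1 - r) + (n + 1) = p * Q * (n + 1)"
  proof -
    have "Q * (n - d) + (Q - 1 - r) + (n + 1) = Q * (n + 1)"
    proof -
      obtain s where s: "n = d + s" using dn le_Suc_ex by blast
      have "Q - 1 - r + r + 1 = Q" using n(2) by simp
      then have "Q * s + (Q - 1 - r) + (Q * d + r + 1) = Q * s + Q * d + Q" by simp
      moreover have "Q * (n + 1) = Q * s + Q * d + Q" unfolding s by (simp add: distrib_left)
      ultimately show ?thesis using n(1) s by simp
    qed
    moreover have "p * Q * (n + 1) = Q * (p' * (n + 1)) + Q * (n + 1)" unfolding p' by (simp add: algebra_simps)
    ultimately show ?thesis by (simp add: distrib_left)
  qed
  ultimately have "(p * Q - 1) * (n + 1) = Q * (p' * (n + 1) + (n - d)) + (Q - 1 - r)" by linarith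
  then have "((p * Q - 1) * (n + 1)) div Q = p' * (n + 1) + (n - d)" using Q by simp
  then have "(of_nat (((p * Q - 1) * (n + 1)) div Q) :: 'k) = of_nat p' * (of_nat n + 1) + (of_nat n - of_nat d)"
    by (simp only: of_nat_add of_nat_mult of_nat_diff[OF dn] of_nat_1)
  moreover have "of_nat p' = (- 1 :: 'k)"
  proof -
    have "of_nat (Suc p') = (0 :: 'k)" unfolding p'[symmetric] p by simp
    then show ?thesis by (simp add: eq_neg_iff_add_eq_0 add.commute)
  qed
  ultimately have "(of_nat (((p * Q - 1) * (n + 1)) div Q) :: 'k) = - (of_nat d + 1)" by simp
  then show ?thesis
    unfolding reflect_eq[OF p0 per] binom_fun_prime_power[OF prime p] by (simp add: Q_def n(3))
qed

section \<open>The ring generated by differential operators and Euler operators\<close>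

definition finite_level :: "nat \<Rightarrow> ('a::comm_ring_1 \<Rightarrow> 'a) \<Rightarrow> bool" where
  "finite_level p P \<longleftrightarrow> (\<exists>e. frob_lin (p ^ e) P)"

lemma finite_level_mult: "finite_level p (\<lambda>x. b * x)"
  unfolding finite_level_def using frob_lin_lmult[OF frob_lin_id] by blast

lemma finite_level_common:
  assumes "finite_level p P" "finite_level p Q" obtains e where "frob_lin (p ^ e) P" "frob_lin (p ^ e) Q"
proof -
  obtain e e' where "frob_lin (p ^ e) P" "frob_lin (p ^ e') Q" using assms by (auto simp: finite_level_def)
  then have "frob_lin (p ^ max e e') P" "frob_lin (p ^ max e e') Q"
    using frob_lin_dvd[of "p ^ e" P "p ^ max e e'"] frob_lin_dvd[of "p ^ e'" Q "p ^ max e e'"]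
    by (simp_all add: le_imp_power_dvd)
  then show ?thesis using that by blast
qed

text \<open>
  Euler operators are diagonal with respect to the powers of \<open>t\<close>.
\<close>

definition diag_op :: "(nat \<Rightarrow> 'k::field) \<Rightarrow> ('n::{finite,linorder}, 'k) mpol poly \<Rightarrow> ('n, 'k) mpol poly" where
  "diag_op w x = (\<Sum>i\<le>degree x. monom (mconst (w i) * coeff x i) i)"

lemma coeff_diag_op [simp]: "coeff (diag_op w x) n = mconst (w n) * coeff x n"
proof -
  have "coeff (diag_op w x) n = (\<Sum>i\<le>degree x. if i = n then mconst (w i) * coeff x i else 0)"
    unfolding diag_op_def coeff_sum by simp
  also have "\<dots> = mconst (w n) * coeff x n"
    by (simp add: sum.delta coeff_eq_0)
  finally show ?thesis .
qed

lemma diag_op_add: "diag_op w (x + y) = diag_op w x + diag_op w y"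
  by (rule poly_eqI) (simp add: distrib_left)

lemma diag_op_plus: "diag_op (\<lambda>n. v n + w n) x = diag_op v x + diag_op w x"
  by (rule poly_eqI) (simp add: mconst_simps distrib_right)

lemma diag_op_times: "diag_op (\<lambda>n. v n * w n) x = diag_op v (diag_op w x)"
  by (rule poly_eqI) (simp add: mconst_simps mult.assoc)

lemma diag_op_const: "diag_op (\<lambda>_. c) x = [:mconst c:] * x"
  by (rule poly_eqI) simp

lemma diag_op_shift: "diag_op w ([:0, 1:] * x) = [:0, 1:] * diag_op (\<lambda>n. w (Suc n)) x"
  by (rule poly_eqI) (simp add: coeff_pCons split: nat.split)

lemma diag_op_monom: "diag_op w (monom c n) = monom (mconst (w n) * c) n"
  by (rule poly_eqI) simp

lemma mconst_of_nat: "mconst (of_nat n :: 'k::field) = of_nat n"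
  by (simp add: mconst_def)

lemma coeff_divided_deriv:
  "coeff (divided_deriv m x) n = of_nat ((n + m) choose m) * coeff x (n + m)"
proof -
  have "coeff (divided_deriv m x) n = (\<Sum>i\<le>degree x. coeff (monom (of_nat (i choose m) * coeff x i) (i - m)) n)"
    unfolding divided_deriv_def coeff_sum ..
  also have "\<dots> = (\<Sum>i\<le>degree x. if i = n + m then of_nat (i choose m) * coeff x i else 0)"
    by (rule sum.cong) (auto simp: binomial_eq_0 not_le)
  also have "\<dots> = of_nat ((n + m) choose m) * coeff x (n + m)"
    by (simp add: sum.delta coeff_eq_0)
  finally show ?thesis .
qed

lemma euler_op_eq_diag_op:
  assumes prime: "prime CHAR('k::field)"
  shows "(euler_op CHAR('k) e :: ('n::{finite,linorder}, 'k) mpol poly \<Rightarrow> _) =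
    diag_op (\<lambda>n. of_nat (n div CHAR('k) ^ e) + 1)"
proof (rule ext, rule poly_eqI)
  fix x :: "('n, 'k) mpol poly" and n
  have pr: "prime CHAR(('n, 'k) mpol)" "CHAR(('n, 'k) mpol) = CHAR('k)"
    using prime by (simp_all add: CHAR_poly_mapping)
  have q: "CHAR('k) ^ e > 0" using prime by (simp add: prime_gt_0_nat)
  have "coeff (euler_op CHAR('k) e x) n = of_nat ((n + CHAR('k) ^ e) choose CHAR('k) ^ e) * coeff x n"
    unfolding euler_op_def coeff_divided_deriv by (simp add: coeff_monom_mult)
  also have "(of_nat ((n + CHAR('k) ^ e) choose CHAR('k) ^ e) :: ('n, 'k) mpol) = of_nat ((n + CHAR('k) ^ e) div CHAR('k) ^ e)"
    using of_nat_choose_prime_power[OF pr(1), of "n + CHAR('k) ^ e" e] unfolding pr(2) .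
  also have "(n + CHAR('k) ^ e) div CHAR('k) ^ e = n div CHAR('k) ^ e + 1" using q by simp
  finally show "coeff (euler_op CHAR('k) e x) n = coeff (diag_op (\<lambda>n. of_nat (n div CHAR('k) ^ e) + 1) x) n"
    by (simp add: mconst_simps mconst_of_nat)
qed

lemma frob_lin_polyI:
  fixes T :: "'a::comm_ring_1 poly \<Rightarrow> 'a poly"
  assumes char: "prime CHAR('a)" and q: "q = CHAR('a) ^ e"
    and add: "\<And>x y. T (x + y) = T x + T y"
    and const: "\<And>c x. T ([:c ^ q:] * x) = [:c ^ q:] * T x"
    and X: "\<And>x. T (monom 1 q * x) = monom 1 q * T x"
  shows "frob_lin q T"
proof -
  have q0: "q > 0" using char q by (simp add: prime_gt_0_nat)
  have T0: "T 0 = 0" using add[of 0 0] by simp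
  have "T (a ^ q * x) = a ^ q * T x" for a x
  proof (induction a rule: pCons_induct)
    case 0 then show ?case using q0 T0 by (simp add: zero_power)
  next
    case (pCons c a)
    have "pCons c a = [:c:] + [:0, 1:] * a" by simp
    also have "\<dots> ^ q = [:c:] ^ q + ([:0, 1:] * a) ^ q"
      by (rule freshmans_dream'[where n = e]) (use char q in simp_all)
    also have "\<dots> = [:c ^ q:] + monom 1 q * a ^ q"
      by (simp only: power_mult_distrib poly_const_pow) (simp add: monom_altdef)
    finally have eq: "pCons c a ^ q = [:c ^ q:] + monom 1 q * a ^ q" .
    show ?case unfolding eq distrib_right add const mult.assoc X pCons.IH ..
  qed
  then show ?thesis using add by (auto simp: frob_lin_def)
qed

lemma map_poly_frob_lin:
  assumes char: "prime CHAR('a::comm_ring_1)" and q: "q = CHAR('a) ^ e" and P: "frob_lin q (P :: 'a \<Rightarrow> 'a)"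
  shows "frob_lin q (map_poly P)"
proof (rule frob_lin_polyI[OF char q])
  note [simp] = frob_lin_zero[OF P] coeff_map_poly
  show "map_poly P (x + y) = map_poly P x + map_poly P y" for x y
    by (rule poly_eqI) (simp add: frob_linD(1)[OF P])
  show "map_poly P ([:c ^ q:] * x) = [:c ^ q:] * map_poly P x" for c x
    by (rule poly_eqI) (simp add: frob_linD(2)[OF P])
  show "map_poly P (monom 1 q * x) = monom 1 q * map_poly P x" for x
    by (rule poly_eqI) (simp add: coeff_monom_mult)
qed

context
  fixes p
  assumes perf: "perfect_pos_char TYPE('k::field)" and p: "p = CHAR('k)"
begin

lemma mpol_char_p: "prime CHAR(('n, 'k) mpol)" "CHAR(('n, 'k) mpol) = p"
  using p_prime[OF perf p] by (simp_all add: CHAR_poly_mapping p)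

lemmas euler_op_p = euler_op_eq_diag_op[OF perfect_prime[OF perf], folded p]

lemma frob_lin_diag_op:
  assumes "periodic_exp p e (w :: nat \<Rightarrow> 'k)"
  shows "frob_lin (p ^ e) (diag_op w :: ('n::{finite,linorder}, 'k) mpol poly \<Rightarrow> _)"
proof (rule frob_lin_polyI[OF mpol_char_p(1), where e = e])
  show "p ^ e = CHAR(('n, 'k) mpol) ^ e" by (simp add: mpol_char_p)
  show "diag_op w (monom 1 (p ^ e) * x) = monom 1 (p ^ e) * diag_op w x" for x :: "('n, 'k) mpol poly"
  proof (rule poly_eqI)
    fix n
    show "coeff (diag_op w (monom 1 (p ^ e) * x)) n = coeff (monom 1 (p ^ e) * diag_op w x) n"
    proof (cases "p ^ e \<le> n")
      case True
      then have "w n = w (n - p ^ e)" using assms unfolding periodic_exp_def by (metis le_add_diff_inverse2)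
      then show ?thesis by (simp add: coeff_monom_mult)
    qed (simp add: coeff_monom_mult)
  qed
  show "diag_op w ([:c ^ p ^ e:] * x) = [:c ^ p ^ e:] * diag_op w x" for c and x :: "('n, 'k) mpol poly"
    by (rule poly_eqI) (simp add: mult.left_commute)
qed (rule diag_op_add)

lemma periodic_euler: "periodic_exp p (Suc e) (\<lambda>n. of_nat (n div p ^ e) + 1 :: 'k)"
proof -
  have "(n + p * p ^ e) div p ^ e = n div p ^ e + p" for n
    using p_prime[OF perf p] by (simp add: prime_gt_0_nat)
  then show ?thesis by (simp add: periodic_exp_def p)
qed

lemma DR_euler_frob_lin:
  assumes "(P :: ('n::{finite,linorder}, 'k) mpol poly \<Rightarrow> _) \<in> DR_euler"
  shows "\<exists>e. frob_lin (p ^ e) P"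
  using assms
proof induction
  case (1 P)
  then obtain e where "frob_lin (p ^ e) P" using diff_ops_mpol_iff[OF perf p] by blast
  then have "frob_lin (p ^ e) (map_poly P)"
    by (intro map_poly_frob_lin[OF mpol_char_p(1), where e = e]) (simp_all add: mpol_char_p)
  then show ?case ..
next
  case (2 e)
  then show ?case
    unfolding p[symmetric] euler_op_p
    using frob_lin_diag_op[OF periodic_euler] by blast
next
  case (3 P Q)
  then have "finite_level p P" "finite_level p Q" by (simp_all add: finite_level_def)
  then obtain e where "frob_lin (p ^ e) P" "frob_lin (p ^ e) Q" by (rule finite_level_common)
  then show ?case unfolding frob_lin_def by (intro exI[of _ e]) (simp add: algebra_simps)
next
  case (4 P)
  then show ?case unfolding frob_lin_def by auto
next
  case (5 P Q)
  then have "finite_level p P" "finite_level p Q" by (simp_all add: finite_level_def)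
  then obtain e where "frob_lin (p ^ e) P" "frob_lin (p ^ e) Q" by (rule finite_level_common)
  then show ?case using frob_lin_comp by blast
qed

lemma diag_op_map_poly_commute:
  assumes "frob_lin (p ^ e) (P :: ('n::{finite,linorder}, 'k) mpol \<Rightarrow> _)"
  shows "map_poly P (diag_op w x) = diag_op w (map_poly P x)"
  by (rule poly_eqI) (simp add: coeff_map_poly frob_lin_zero[OF assms] frob_lin_mconst[OF perf p assms])

text \<open>
  Operators on coefficients are linear over \<open>k\<close>, and diagonal operators commute with each other.
\<close>

lemma DR_euler_diag_op_commute:
  assumes "(P :: ('n::{finite,linorder}, 'k) mpol poly \<Rightarrow> _) \<in> DR_euler"
  shows "P (diag_op w x) = diag_op w (P x)"
  using assms
proof (induction arbitrary: x)
  case (1 P)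
  then obtain e where "frob_lin (p ^ e) P" using diff_ops_mpol_iff[OF perf p] by blast
  then show ?case by (rule diag_op_map_poly_commute)
next
  case (2 e)
  show ?case unfolding euler_op_eq_diag_op[OF perfect_prime[OF perf]]
    by (simp add: diag_op_times[symmetric] mult.commute)
next
  case (3 P Q) then show ?case by (simp add: diag_op_add)
next
  case (4 P)
  have "diag_op w (- y) = - diag_op w y" for y :: "('n, 'k) mpol poly" by (rule poly_eqI) simp
  then show ?case using 4 by simp
qed simp

lemma map_poly_DR_euler:
  "frob_lin (p ^ e) (P :: ('n::{finite,linorder}, 'k) mpol \<Rightarrow> _) \<Longrightarrow> map_poly P \<in> DR_euler"
  using diff_ops_mpol_iff[OF perf p] by (blast intro: DR_euler.intros(1))

text \<open>
  A periodic weight is a polynomial in the digit functions, whose diagonal operators are \<open>\<nu>\<^sub>i - 1\<close>.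
\<close>

lemma diag_op_DR_euler:
  assumes "periodic_exp p e (w :: nat \<Rightarrow> 'k)"
  shows "(diag_op w :: ('n::{finite,linorder}, 'k) mpol poly \<Rightarrow> _) \<in> DR_euler"
proof (rule periodic_induct[OF perfect_prime[OF perf] p assms])
  have const: "(diag_op (\<lambda>_. c) :: ('n::{finite,linorder}, 'k) mpol poly \<Rightarrow> _) \<in> DR_euler" for c :: 'k
  proof -
    have "frob_lin (p ^ 0) (\<lambda>x. mconst c * x :: ('n, 'k) mpol)" by (intro frob_lin_lmult frob_lin_id)
    then have "map_poly (\<lambda>x. mconst c * x :: ('n, 'k) mpol) \<in> DR_euler" by (rule map_poly_DR_euler)
    moreover have "map_poly (\<lambda>x. mconst c * x :: ('n, 'k) mpol) = diag_op (\<lambda>_. c)"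
      by (rule ext, rule poly_eqI) (simp add: coeff_map_poly)
    ultimately show ?thesis by simp
  qed
  then show "(diag_op (\<lambda>_. c) :: ('n::{finite,linorder}, 'k) mpol poly \<Rightarrow> _) \<in> DR_euler" for c :: 'k .
  show "(diag_op (binom_fun (p ^ i) :: nat \<Rightarrow> 'k) :: ('n::{finite,linorder}, 'k) mpol poly \<Rightarrow> _) \<in> DR_euler" for i
  proof -
    have "(\<lambda>x. euler_op CHAR('k) i x + diag_op (\<lambda>_. - 1) x) \<in> (DR_euler :: (('n::{finite,linorder}, 'k) mpol poly \<Rightarrow> _) set)"
      using DR_euler.intros(2,3) const by blast
    moreover have "(\<lambda>x. euler_op CHAR('k) i x + diag_op (\<lambda>_. - 1) x) =
        (diag_op (binom_fun (p ^ i) :: nat \<Rightarrow> 'k) :: ('n::{finite,linorder}, 'k) mpol poly \<Rightarrow> _)"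
    proof -
      have "(binom_fun (p ^ i) :: nat \<Rightarrow> 'k) = (\<lambda>n. (of_nat (n div p ^ i) + 1) + - 1)"
        using binom_fun_prime_power[OF perfect_prime[OF perf] p, of i] by (simp add: fun_eq_iff)
      then have "diag_op (binom_fun (p ^ i)) x = diag_op (\<lambda>n. (of_nat (n div p ^ i) + 1) + - 1 :: 'k) x"
        for x :: "('n, 'k) mpol poly" by (simp only:)
      then show ?thesis
        unfolding p[symmetric] euler_op_p diag_op_plus[of "\<lambda>n. of_nat (n div p ^ i) + 1"] fun_eq_iff
        by (simp only: simp_thms)
    qed
    ultimately show ?thesis by simp
  qed
  fix a b :: "nat \<Rightarrow> 'k"
  assume ab: "(diag_op a :: ('n::{finite,linorder}, 'k) mpol poly \<Rightarrow> _) \<in> DR_euler"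
    "(diag_op b :: ('n::{finite,linorder}, 'k) mpol poly \<Rightarrow> _) \<in> DR_euler"
  have "(\<lambda>x. diag_op a x + diag_op b x) = (diag_op (\<lambda>l. a l + b l) :: ('n::{finite,linorder}, 'k) mpol poly \<Rightarrow> _)"
    by (simp add: diag_op_plus fun_eq_iff)
  then show "(diag_op (\<lambda>l. a l + b l) :: ('n::{finite,linorder}, 'k) mpol poly \<Rightarrow> _) \<in> DR_euler"
    using DR_euler.intros(3)[OF ab] by simp
  have "diag_op a \<circ> diag_op b = (diag_op (\<lambda>l. a l * b l) :: ('n::{finite,linorder}, 'k) mpol poly \<Rightarrow> _)"
    by (simp add: diag_op_times fun_eq_iff)
  then show "(diag_op (\<lambda>l. a l * b l) :: ('n::{finite,linorder}, 'k) mpol poly \<Rightarrow> _) \<in> DR_euler"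
    using DR_euler.intros(5)[OF ab] by simp
qed

text \<open>
  Moving \<open>t\<close> past a diagonal operator shifts the weight by one, which keeps it periodic. This makes \<open>t M\<close> a
  submodule.
\<close>

lemma DR_euler_t_commute:
  assumes "(P :: ('n::{finite,linorder}, 'k) mpol poly \<Rightarrow> _) \<in> DR_euler"
  shows "\<exists>P'\<in>DR_euler. \<forall>x. P ([:0, 1:] * x) = [:0, 1:] * P' x"
  using assms
proof induction
  case (1 P)
  then obtain e where P: "frob_lin (p ^ e) P" using diff_ops_mpol_iff[OF perf p] by blast
  have "map_poly P ([:0, 1:] * x) = [:0, 1:] * map_poly P x" for x
    by (rule poly_eqI) (simp add: coeff_map_poly frob_lin_zero[OF P] coeff_pCons split: nat.split)
  then show ?case using map_poly_DR_euler[OF P] by blast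
next
  case (2 e)
  have "periodic_exp p (Suc e) (\<lambda>n. of_nat (Suc n div p ^ e) + 1 :: 'k)"
    using periodic_euler[of e] unfolding periodic_exp_def by (metis add_Suc)
  from diag_op_DR_euler[OF this] show ?case
    unfolding p[symmetric] euler_op_p diag_op_shift by blast
next
  case (3 P Q)
  then obtain P' Q' where PQ: "P' \<in> DR_euler" "\<forall>x. P ([:0, 1:] * x) = [:0, 1:] * P' x"
    "Q' \<in> DR_euler" "\<forall>x. Q ([:0, 1:] * x) = [:0, 1:] * Q' x" by blast
  have "P ([:0, 1:] * x) + Q ([:0, 1:] * x) = [:0, 1:] * (P' x + Q' x)" for x
    using PQ(2,4) by (simp only: distrib_left)
  then show ?case using DR_euler.intros(3)[OF PQ(1,3)] by (intro bexI[of _ "\<lambda>q. P' q + Q' q"]) simp_all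
next
  case (4 P)
  then obtain P' where P: "P' \<in> DR_euler" "\<forall>x. P ([:0, 1:] * x) = [:0, 1:] * P' x" by blast
  have "- P ([:0, 1:] * x) = [:0, 1:] * (- P' x)" for x
    using P(2) by (simp only: mult_minus_right)
  then show ?case using DR_euler.intros(4)[OF P(1)] by (intro bexI[of _ "\<lambda>q. - P' q"]) simp_all
next
  case (5 P Q)
  then obtain P' Q' where PQ: "P' \<in> DR_euler" "\<forall>x. P ([:0, 1:] * x) = [:0, 1:] * P' x"
    "Q' \<in> DR_euler" "\<forall>x. Q ([:0, 1:] * x) = [:0, 1:] * Q' x" by blast
  have "(P \<circ> Q) ([:0, 1:] * x) = [:0, 1:] * (P' \<circ> Q') x" for x
    using PQ(2,4) by (simp only: o_apply)
  then show ?case using DR_euler.intros(5)[OF PQ(1,3)] by blast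
qed

end

context
  fixes p and f :: "('n::{finite,linorder}, 'k::field) mpol"
  assumes perf: "perfect_pos_char TYPE('k)" and p: "p = CHAR('k)"
begin

lemma pow_pos: "p ^ e > 0"
  using p_prime[OF perf p] by (simp add: prime_gt_0_nat)

lemmas loc_ext_frac = loc_ext_props(2)[OF perf p refl, where f = f]

lemma loc_ext_mem: "finite_level p P \<Longrightarrow> u \<in> loc_ring f \<Longrightarrow> loc_ext f P u \<in> loc_ring f"
  unfolding finite_level_def by (metis loc_ext_frac loc_ringE loc_ringI pow_pos)

lemma loc_ext_to_fract: "finite_level p P \<Longrightarrow> loc_ext f P (to_fract a) = to_fract (P a)"
  unfolding finite_level_def using loc_ext_frac[of _ P a 0] by auto

lemma loc_ext_add:
  assumes "finite_level p P" "u \<in> loc_ring f" "v \<in> loc_ring f"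
  shows "loc_ext f P (u + v) = loc_ext f P u + loc_ext f P v"
proof -
  obtain e where P: "frob_lin (p ^ e) P" using assms(1) by (auto simp: finite_level_def)
  obtain a m where u: "u = to_fract a / f_sub_t f ^ (p ^ e * m)" by (rule loc_ringE[OF assms(2) pow_pos])
  obtain b n where v: "v = to_fract b / f_sub_t f ^ (p ^ e * n)" by (rule loc_ringE[OF assms(3) pow_pos])
  show ?thesis unfolding u v frac_add loc_ext_frac[OF P] frob_linD[OF P] ..
qed

text \<open>
  At a common level of both operators, and over a common denominator that is a scalar at this level, the
  extensions act on numerators only.
\<close>

lemma loc_ext_plus:
  assumes "finite_level p P" "finite_level p Q" "u \<in> loc_ring f"
  shows "loc_ext f (\<lambda>x. P x + Q x) u = loc_ext f P u + loc_ext f Q u"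
proof -
  obtain e where P: "frob_lin (p ^ e) P" "frob_lin (p ^ e) Q" by (rule finite_level_common[OF assms(1,2)])
  have PQ: "frob_lin (p ^ e) (\<lambda>x. P x + Q x)" using P unfolding frob_lin_def by (simp add: algebra_simps)
  obtain a m where u: "u = to_fract a / f_sub_t f ^ (p ^ e * m)" by (rule loc_ringE[OF assms(3) pow_pos])
  show ?thesis unfolding u loc_ext_frac[OF P(1)] loc_ext_frac[OF P(2)] loc_ext_frac[OF PQ]
    by (simp add: add_divide_distrib)
qed

lemma loc_ext_comp:
  assumes "finite_level p P" "finite_level p Q" "u \<in> loc_ring f"
  shows "loc_ext f (P \<circ> Q) u = loc_ext f P (loc_ext f Q u)"
proof -
  obtain e where P: "frob_lin (p ^ e) P" "frob_lin (p ^ e) Q" by (rule finite_level_common[OF assms(1,2)])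
  have PQ: "frob_lin (p ^ e) (P \<circ> Q)" using P by (rule frob_lin_comp)
  obtain a m where u: "u = to_fract a / f_sub_t f ^ (p ^ e * m)" by (rule loc_ringE[OF assms(3) pow_pos])
  show ?thesis unfolding u loc_ext_frac[OF P(1)] loc_ext_frac[OF P(2)] loc_ext_frac[OF PQ] by simp
qed

lemma loc_ext_mult:
  assumes "u \<in> loc_ring f" shows "loc_ext f (\<lambda>x. b * x) u = to_fract b * u"
proof -
  have P: "frob_lin (p ^ 0) (\<lambda>x. b * x)" using frob_lin_lmult[OF frob_lin_id] by blast
  obtain a m where u: "u = to_fract a / f_sub_t f ^ (p ^ 0 * m)" by (rule loc_ringE[OF assms pow_pos])
  show ?thesis unfolding u loc_ext_frac[OF P] by simp
qed

end

section \<open>Cosets\<close>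

text \<open>
  Elements of the iterated quotients are handled through representatives in the localization: \<open>M_rep\<close> and \<open>T_rep\<close> are
  the preimages of \<open>M\<close> and \<open>t M\<close>, and \<open>B_class\<close> and \<open>N_class\<close> are the quotient maps.
\<close>

definition B_class :: "('n::{finite,linorder}, 'k::field) mpol poly fract \<Rightarrow> ('n, 'k) mpol poly fract set" where
  "B_class u = u +o Rt"

definition M_rep :: "('n::{finite,linorder}, 'k::field) mpol \<Rightarrow> ('n, 'k) mpol poly fract set" where
  "M_rep f = {loc_ext f P (1 / f_sub_t f) + to_fract r | P r. P \<in> DR_euler}"

definition T_rep :: "('n::{finite,linorder}, 'k::field) mpol \<Rightarrow> ('n, 'k) mpol poly fract set" where
  "T_rep f = {to_fract [:0, 1:] * u + to_fract r | u r. u \<in> M_rep f}"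

definition N_class :: "('n::{finite,linorder}, 'k::field) mpol \<Rightarrow> ('n, 'k) mpol poly fract \<Rightarrow>
    ('n, 'k) mpol poly fract set set" where
  "N_class f u = B_class u +o tM_mod f"

lemma Rt_plus_Rt: "Rt + Rt = (Rt :: ('n::{finite,linorder}, 'k::field) mpol poly fract set)"
proof
  show "Rt + Rt \<subseteq> (Rt :: ('n, 'k) mpol poly fract set)" by (auto elim!: set_plus_elim simp flip: to_fract_add)
  show "Rt \<subseteq> (Rt + Rt :: ('n, 'k) mpol poly fract set)"
  proof
    fix x :: "('n, 'k) mpol poly fract" assume "x \<in> Rt"
    then have "x + to_fract 0 \<in> Rt + Rt" by (intro set_plus_intro) auto
    then show "x \<in> Rt + Rt" by simp
  qed
qed

lemma B_class_add: "B_class u + B_class v = B_class (u + v)"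
  unfolding B_class_def set_plus_rearrange Rt_plus_Rt ..

lemma B_class_absorb:
  fixes u :: "('n::{finite,linorder}, 'k::field) mpol poly fract"
  shows "B_class (u + to_fract r) = B_class u"
proof -
  have "B_class (to_fract r) = Rt"
  proof
    show "B_class (to_fract r) \<subseteq> Rt" unfolding B_class_def elt_set_plus_def by (auto simp flip: to_fract_add)
    show "Rt \<subseteq> B_class (to_fract r)"
    proof
      fix x :: "('n, 'k) mpol poly fract" assume "x \<in> Rt"
      then obtain s where "x = to_fract r + to_fract (s - r)" by auto
      then show "x \<in> B_class (to_fract r)" unfolding B_class_def elt_set_plus_def by blast
    qed
  qed
  moreover have "B_class 0 = (Rt :: ('n, 'k) mpol poly fract set)" by (auto simp: B_class_def elt_set_plus_def)
  ultimately have "B_class (to_fract r) = B_class 0" by simp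
  then show ?thesis using B_class_add[of u "to_fract r"] B_class_add[of u 0] by simp
qed

lemma in_B_classE: assumes "v \<in> B_class u" obtains r where "v = u + to_fract r"
  using assms by (auto simp: B_class_def elt_set_plus_def)

lemma delta_eq: "delta f = B_class (1 / f_sub_t f)"
  by (simp add: delta_def B_class_def Fract_conv_to_fract)

context
  fixes p and f :: "('n::{finite,linorder}, 'k::field) mpol"
  assumes perf: "perfect_pos_char TYPE('k)" and p: "p = CHAR('k)"
begin

lemma DR_euler_finite_level: "P \<in> DR_euler \<Longrightarrow> finite_level p (P :: ('n, 'k) mpol poly \<Rightarrow> _)"
  using DR_euler_frob_lin[OF perf p] by (simp add: finite_level_def)

lemmas L_mem = loc_ext_mem[OF perf p, where f = f]
  and L_to_fract = loc_ext_to_fract[OF perf p, where f = f]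
  and L_add = loc_ext_add[OF perf p, where f = f]
  and L_plus = loc_ext_plus[OF perf p, where f = f]
  and L_comp = loc_ext_comp[OF perf p, where f = f]
  and L_mult = loc_ext_mult[OF perf p, where f = f]

lemma B_act_B_class:
  assumes P: "finite_level p P" and u: "u \<in> loc_ring f"
  shows "B_act f P (B_class u) = B_class (loc_ext f P u)"
proof -
  have "loc_ext f P v +o Rt = B_class (loc_ext f P u)" if v: "v \<in> B_class u" for v
  proof -
    obtain r where "v = u + to_fract r" using v by (rule in_B_classE)
    then have "loc_ext f P v = loc_ext f P u + to_fract (P r)"
      using L_add[OF P u to_fract_loc_ring] L_to_fract[OF P] by simp
    then show ?thesis using B_class_absorb by (simp add: B_class_def)
  qed
  moreover have "u \<in> B_class u" unfolding B_class_def elt_set_plus_def by (auto intro!: exI[of _ 0])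
  ultimately show ?thesis unfolding B_act_def by blast
qed

lemma inv_mem: "1 / f_sub_t f \<in> loc_ring f"
  using loc_ringI[of 1 f 1] by simp

lemma loc_ring_add: "u \<in> loc_ring f \<Longrightarrow> v \<in> loc_ring f \<Longrightarrow> u + v \<in> loc_ring f"
  and loc_ring_mult: "u \<in> loc_ring f \<Longrightarrow> v \<in> loc_ring f \<Longrightarrow> u * v \<in> loc_ring f"
  using const_subalgebra_loc[of f] unfolding const_subalgebra_def by blast+

lemma M_rep_subset: "M_rep f \<subseteq> loc_ring f"
proof
  fix u assume "u \<in> M_rep f"
  then obtain P r where "P \<in> DR_euler" "u = loc_ext f P (1 / f_sub_t f) + to_fract r"
    unfolding M_rep_def by blast
  then show "u \<in> loc_ring f" using loc_ring_add[OF L_mem[OF DR_euler_finite_level inv_mem] to_fract_loc_ring] by simp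
qed

lemma M_repI: "P \<in> DR_euler \<Longrightarrow> loc_ext f P (1 / f_sub_t f) \<in> M_rep f"
  unfolding M_rep_def by (intro CollectI exI[of _ P] exI[of _ 0]) simp

lemma M_rep_L:
  assumes P: "P \<in> DR_euler" and u: "u \<in> M_rep f" shows "loc_ext f P u \<in> M_rep f"
proof -
  obtain Q r where u: "u = loc_ext f Q (1 / f_sub_t f) + to_fract r" and Q: "Q \<in> DR_euler"
    using u by (auto simp: M_rep_def)
  have "loc_ext f P u = loc_ext f (P \<circ> Q) (1 / f_sub_t f) + to_fract (P r)"
    unfolding u
    by (simp only: L_add[OF DR_euler_finite_level[OF P] L_mem[OF DR_euler_finite_level[OF Q] inv_mem] to_fract_loc_ring]
        L_to_fract[OF DR_euler_finite_level[OF P]] L_comp[OF DR_euler_finite_level[OF P] DR_euler_finite_level[OF Q] inv_mem])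
  then show ?thesis unfolding M_rep_def using DR_euler.intros(5)[OF P Q] by blast
qed

lemma M_rep_add:
  assumes "u \<in> M_rep f" "v \<in> M_rep f" shows "u + v \<in> M_rep f"
proof -
  obtain P r where u: "u = loc_ext f P (1 / f_sub_t f) + to_fract r" and P: "P \<in> DR_euler"
    using assms(1) by (auto simp: M_rep_def)
  obtain Q s where v: "v = loc_ext f Q (1 / f_sub_t f) + to_fract s" and Q: "Q \<in> DR_euler"
    using assms(2) by (auto simp: M_rep_def)
  have "u + v = loc_ext f (\<lambda>x. P x + Q x) (1 / f_sub_t f) + to_fract (r + s)"
    unfolding u v L_plus[OF DR_euler_finite_level[OF P] DR_euler_finite_level[OF Q] inv_mem] by simp
  then show ?thesis unfolding M_rep_def using DR_euler.intros(3)[OF P Q] by blast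
qed

lemma const_DR: "(\<lambda>x. [:mconst c:] * x :: ('n, 'k) mpol poly) \<in> DR_euler"
proof -
  have "(\<lambda>x. [:mconst c:] * x :: ('n, 'k) mpol poly) = diag_op (\<lambda>_. c)" by (simp add: diag_op_const fun_eq_iff)
  then show ?thesis using diag_op_DR_euler[OF perf p, of 0 "\<lambda>_. c"] by (simp add: periodic_exp_def)
qed

lemma M_rep_mult_const: "u \<in> M_rep f \<Longrightarrow> to_fract [:mconst c:] * u \<in> M_rep f"
  using M_rep_L[OF const_DR, of u c] L_mult[of u "[:mconst c:]"] M_rep_subset by auto

lemma M_rep_minus: "u \<in> M_rep f \<Longrightarrow> - u \<in> M_rep f"
proof -
  assume "u \<in> M_rep f"
  moreover have "to_fract [:mconst (- 1):] = (- 1 :: ('n, 'k) mpol poly fract)"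
  proof -
    have "[:mconst (- 1):] = (- 1 :: ('n, 'k) mpol poly)" by (simp only: mconst_simps) (simp add: one_pCons)
    then show ?thesis by simp
  qed
  ultimately show ?thesis using M_rep_mult_const[of u "- 1"] by simp
qed

lemma to_fract_M_rep: "to_fract r \<in> M_rep f"
proof -
  have "loc_ext f (\<lambda>x. [:mconst 0:] * x) (1 / f_sub_t f) = 0"
    unfolding L_mult[OF inv_mem] by (simp add: mconst_simps)
  moreover have "loc_ext f (\<lambda>x. [:mconst 0:] * x) (1 / f_sub_t f) + to_fract r \<in> M_rep f"
    unfolding M_rep_def using const_DR by blast
  ultimately show ?thesis by simp
qed

lemma T_repI: "u \<in> M_rep f \<Longrightarrow> to_fract [:0, 1:] * u + to_fract r \<in> T_rep f"
  unfolding T_rep_def by blast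

lemma T_rep_add:
  assumes "u \<in> T_rep f" "v \<in> T_rep f" shows "u + v \<in> T_rep f"
proof -
  obtain u' r v' s where *: "u = to_fract [:0, 1:] * u' + to_fract r" "u' \<in> M_rep f"
    "v = to_fract [:0, 1:] * v' + to_fract s" "v' \<in> M_rep f"
    using assms by (auto simp: T_rep_def)
  have eq: "u + v = to_fract [:0, 1:] * (u' + v') + to_fract (r + s)" unfolding * by (simp add: distrib_left)
  show ?thesis unfolding eq by (rule T_repI[OF M_rep_add[OF *(2,4)]])
qed

lemma to_fract_T_rep: "to_fract r \<in> T_rep f"
  using T_repI[OF to_fract_M_rep[of 0], of r] by simp

lemma T_rep_subset: "T_rep f \<subseteq> loc_ring f"
  unfolding T_rep_def using M_rep_subset loc_ring_add loc_ring_mult to_fract_loc_ring by blast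

text \<open>
  With \<open>P t = t P'\<close> and \<open>P'\<close> again in the ring, \<open>P (t v) = t P' v\<close>.
\<close>

lemma T_rep_L:
  assumes P: "P \<in> DR_euler" and u: "u \<in> T_rep f" shows "loc_ext f P u \<in> T_rep f"
proof -
  let ?X = "[:0, 1:] :: ('n, 'k) mpol poly"
  obtain v r where u: "u = to_fract ?X * v + to_fract r" and v: "v \<in> M_rep f"
    using u by (auto simp: T_rep_def)
  obtain P' where P': "P' \<in> DR_euler" "\<forall>x. P (?X * x) = ?X * P' x"
    using DR_euler_t_commute[OF perf p P] by blast
  have vS: "v \<in> loc_ring f" using v M_rep_subset by blast
  have X: "finite_level p (\<lambda>x. ?X * x)" by (rule finite_level_mult)
  have eq: "P \<circ> (\<lambda>x. ?X * x) = (\<lambda>x. ?X * x) \<circ> P'" unfolding o_def using P'(2) by blast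
  have "loc_ext f P (to_fract ?X * v) = loc_ext f (P \<circ> (\<lambda>x. ?X * x)) v"
    by (simp only: L_comp[OF DR_euler_finite_level[OF P] X vS] L_mult[OF vS])
  also have "\<dots> = to_fract ?X * loc_ext f P' v"
    unfolding eq by (simp only: L_comp[OF X DR_euler_finite_level[OF P'(1)] vS] L_mult[OF L_mem[OF DR_euler_finite_level[OF P'(1)] vS]])
  finally have "loc_ext f P u = to_fract ?X * loc_ext f P' v + to_fract (P r)"
    unfolding u
    by (simp only: L_add[OF DR_euler_finite_level[OF P] loc_ring_mult[OF to_fract_loc_ring vS] to_fract_loc_ring]
        L_to_fract[OF DR_euler_finite_level[OF P]])
  then show ?thesis using T_repI[OF M_rep_L[OF P'(1) v]] by simp
qed

lemma M_mod_eq: "M_mod f = B_class ` M_rep f"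
proof
  show "M_mod f \<subseteq> B_class ` M_rep f"
    unfolding M_mod_def delta_eq using B_act_B_class[OF DR_euler_finite_level inv_mem] M_repI by auto
  show "B_class ` M_rep f \<subseteq> M_mod f"
  proof
    fix X assume "X \<in> B_class ` M_rep f"
    then obtain P r where P: "P \<in> DR_euler" "X = B_class (loc_ext f P (1 / f_sub_t f) + to_fract r)"
      by (auto simp: M_rep_def)
    then have "X = B_act f P (delta f)"
      unfolding delta_eq B_act_B_class[OF DR_euler_finite_level[OF P(1)] inv_mem] by (simp add: B_class_absorb)
    then show "X \<in> M_mod f" unfolding M_mod_def using P(1) by blast
  qed
qed

lemma tM_mod_eq: "tM_mod f = B_class ` T_rep f"
proof -
  have B: "B_act f (\<lambda>q. [:0, 1:] * q) (B_class u) = B_class (to_fract [:0, 1:] * u)" if "u \<in> M_rep f" for u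
  proof -
    have uS: "u \<in> loc_ring f" using that M_rep_subset by blast
    show ?thesis unfolding B_act_B_class[OF finite_level_mult uS] L_mult[OF uS] ..
  qed
  have "tM_mod f = (\<lambda>u. B_class (to_fract [:0, 1:] * u)) ` M_rep f"
    unfolding tM_mod_def M_mod_eq image_image using B by (rule image_cong[OF refl])
  also have "\<dots> = B_class ` T_rep f"
  proof
    show "(\<lambda>u. B_class (to_fract [:0, 1:] * u)) ` M_rep f \<subseteq> B_class ` T_rep f"
    proof
      fix X assume "X \<in> (\<lambda>u. B_class (to_fract [:0, 1:] * u)) ` M_rep f"
      then obtain u where u: "u \<in> M_rep f" "X = B_class (to_fract [:0, 1:] * u)" by blast
      then show "X \<in> B_class ` T_rep f" using T_repI[OF u(1), of 0] by simp
    qed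
    show "B_class ` T_rep f \<subseteq> (\<lambda>u. B_class (to_fract [:0, 1:] * u)) ` M_rep f"
      by (auto simp: T_rep_def B_class_absorb)
  qed
  finally show ?thesis .
qed

lemma tM_plus_tM: "tM_mod f + tM_mod f = tM_mod f"
proof
  show "tM_mod f + tM_mod f \<subseteq> tM_mod f"
  proof
    fix X assume "X \<in> tM_mod f + tM_mod f"
    then obtain A B where "A \<in> tM_mod f" "B \<in> tM_mod f" "X = A + B" by (elim set_plus_elim)
    then show "X \<in> tM_mod f" unfolding tM_mod_eq by (auto simp: B_class_add intro: T_rep_add)
  qed
  show "tM_mod f \<subseteq> tM_mod f + tM_mod f"
  proof
    fix X assume X: "X \<in> tM_mod f"
    then obtain u where u: "X = B_class u" unfolding tM_mod_eq by blast
    have "B_class 0 \<in> tM_mod f" unfolding tM_mod_eq using to_fract_T_rep[of 0] by auto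
    then have "X + B_class 0 \<in> tM_mod f + tM_mod f" using X by (rule_tac set_plus_intro)
    then show "X \<in> tM_mod f + tM_mod f" by (simp add: u B_class_add)
  qed
qed

lemma N_class_add: "N_class f u + N_class f v = N_class f (u + v)"
  unfolding N_class_def set_plus_rearrange tM_plus_tM B_class_add ..

lemma T_rep_minus: "u \<in> T_rep f \<Longrightarrow> - u \<in> T_rep f"
proof -
  assume "u \<in> T_rep f"
  then obtain v r where u: "u = to_fract [:0, 1:] * v + to_fract r" "v \<in> M_rep f"
    by (auto simp: T_rep_def)
  have eq: "- u = to_fract [:0, 1:] * (- v) + to_fract (- r)" by (simp add: u)
  show ?thesis unfolding eq by (rule T_repI[OF M_rep_minus[OF u(2)]])
qed

lemma N_class_zero: assumes w: "w \<in> T_rep f" shows "N_class f w = tM_mod f"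
proof -
  have "N_class f w = (\<lambda>v. B_class (w + v)) ` T_rep f"
    unfolding N_class_def tM_mod_eq elt_set_plus_def by (auto simp: B_class_add)
  also have "\<dots> = B_class ` ((+) w ` T_rep f)" by (simp add: image_image)
  also have "(+) w ` T_rep f = T_rep f"
  proof
    show "(+) w ` T_rep f \<subseteq> T_rep f" using T_rep_add[OF w] by blast
    show "T_rep f \<subseteq> (+) w ` T_rep f"
    proof
      fix v assume "v \<in> T_rep f"
      then have "- w + v \<in> T_rep f" using T_rep_add T_rep_minus[OF w] by blast
      moreover have "v = w + (- w + v)" by simp
      ultimately show "v \<in> (+) w ` T_rep f" by blast
    qed
  qed
  finally show ?thesis unfolding tM_mod_eq .
qed

lemma tM_eq_N_class: "tM_mod f = N_class f 0"
  using N_class_zero[OF to_fract_T_rep[of 0]] by simp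

lemma N_mod_eq: "N_mod f = N_class f ` M_rep f"
  unfolding N_mod_def M_mod_eq image_image N_class_def ..

text \<open>
  The union in the definition of the action runs over representatives that differ by elements of \<open>t M\<close>, which the
  operator preserves.
\<close>

lemma N_act_N_class:
  assumes P: "P \<in> DR_euler" and u: "u \<in> M_rep f"
  shows "N_act f P (N_class f u) = N_class f (loc_ext f P u)"
proof -
  have uS: "u \<in> loc_ring f" using u M_rep_subset by blast
  have "B_act f P X +o tM_mod f = N_class f (loc_ext f P u)" if X: "X \<in> N_class f u" for X
  proof -
    obtain w where w: "w \<in> T_rep f" "X = B_class (u + w)"
      using X unfolding N_class_def tM_mod_eq elt_set_plus_def by (auto simp: B_class_add)
    have wS: "w \<in> loc_ring f" using w T_rep_subset by blast
    have "B_act f P X +o tM_mod f = N_class f (loc_ext f P u + loc_ext f P w)"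
      unfolding w(2) B_act_B_class[OF DR_euler_finite_level[OF P] loc_ring_add[OF uS wS]] L_add[OF DR_euler_finite_level[OF P] uS wS]
      by (simp add: N_class_def)
    also have "\<dots> = N_class f (loc_ext f P u) + N_class f 0"
      using N_class_zero[OF T_rep_L[OF P w(1)]] by (simp add: N_class_add[symmetric] tM_eq_N_class)
    finally show ?thesis by (simp add: N_class_add)
  qed
  moreover have "B_class u \<in> N_class f u"
  proof -
    have "B_class u + B_class 0 \<in> B_class u +o tM_mod f"
      unfolding tM_mod_eq using to_fract_T_rep[of 0] by (intro set_plus_intro2) auto
    then show ?thesis by (simp add: N_class_def B_class_add)
  qed
  ultimately show ?thesis unfolding N_act_def by blast
qed

lemma N_act_closed: "P \<in> DR_euler \<Longrightarrow> Y \<in> N_mod f \<Longrightarrow> N_act f P Y \<in> N_mod f"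
  unfolding N_mod_eq using N_act_N_class M_rep_L by auto

lemma abelian_group_N: "abelian_group (N_record f sm)"
proof (rule abelian_groupI)
  fix x y z assume *: "x \<in> carrier (N_record f sm)" "y \<in> carrier (N_record f sm)"
  then obtain u v where uv: "x = N_class f u" "y = N_class f v" "u \<in> M_rep f" "v \<in> M_rep f"
    by (auto simp: N_record_def N_mod_eq)
  show "x \<oplus>\<^bsub>N_record f sm\<^esub> y \<in> carrier (N_record f sm)"
    unfolding uv using M_rep_add[OF uv(3,4)] by (simp add: N_record_def N_mod_eq N_class_add)
  show "x \<oplus>\<^bsub>N_record f sm\<^esub> y = y \<oplus>\<^bsub>N_record f sm\<^esub> x"
    by (simp add: N_record_def add.commute)
  show "x \<oplus>\<^bsub>N_record f sm\<^esub> y \<oplus>\<^bsub>N_record f sm\<^esub> z = x \<oplus>\<^bsub>N_record f sm\<^esub> (y \<oplus>\<^bsub>N_record f sm\<^esub> z)"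
    by (simp add: N_record_def add.assoc)
next
  show "\<zero>\<^bsub>N_record f sm\<^esub> \<in> carrier (N_record f sm)"
    using to_fract_M_rep[of 0] by (simp add: N_record_def N_mod_eq tM_eq_N_class)
  fix x assume "x \<in> carrier (N_record f sm)"
  then obtain u where u: "x = N_class f u" "u \<in> M_rep f" by (auto simp: N_record_def N_mod_eq)
  show "\<zero>\<^bsub>N_record f sm\<^esub> \<oplus>\<^bsub>N_record f sm\<^esub> x = x"
    by (simp add: N_record_def u tM_eq_N_class N_class_add)
  show "\<exists>y\<in>carrier (N_record f sm). y \<oplus>\<^bsub>N_record f sm\<^esub> x = \<zero>\<^bsub>N_record f sm\<^esub>"
    using M_rep_minus[OF u(2)]
    by (intro bexI[of _ "N_class f (- u)"]) (simp_all add: N_record_def u tM_eq_N_class N_class_add N_mod_eq)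
qed

end

section \<open>The module structure over the binomial functions\<close>

lemma cring_binom_alg: "cring (binom_alg :: (nat \<Rightarrow> 'k::field) ring)"
proof (rule cringI)
  show "abelian_group (binom_alg :: (nat \<Rightarrow> 'k) ring)"
  proof (rule abelian_groupI)
    fix a :: "nat \<Rightarrow> 'k" assume "a \<in> carrier binom_alg"
    then have "(\<lambda>l. - 1 * a l) \<in> binom_functions"
      by (intro binom_functions.intros) (simp add: binom_alg_def)
    then show "\<exists>b\<in>carrier binom_alg. b \<oplus>\<^bsub>binom_alg\<^esub> a = \<zero>\<^bsub>binom_alg\<^esub>"
      by (intro bexI[of _ "\<lambda>l. - 1 * a l"]) (simp_all add: binom_alg_def)
  qed (auto simp: binom_alg_def algebra_simps intro: binom_functions.intros)
  show "comm_monoid (binom_alg :: (nat \<Rightarrow> 'k) ring)"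
    by (rule comm_monoidI) (auto simp: binom_alg_def algebra_simps intro: binom_functions.intros)
qed (auto simp: binom_alg_def algebra_simps)

definition gamma_spec :: "('n::{finite,linorder}, 'k::field) mpol \<Rightarrow>
    ((nat \<Rightarrow> 'k) \<Rightarrow> ('n, 'k) mpol poly fract set set \<Rightarrow> ('n, 'k) mpol poly fract set set) \<Rightarrow> bool" where
  "gamma_spec f sm \<longleftrightarrow>
     sm \<in> carrier binom_alg \<rightarrow>\<^sub>E (N_mod f \<rightarrow>\<^sub>E N_mod f) \<and>
     module binom_alg (N_record f sm) \<and>
     (\<forall>c. \<forall>Y\<in>N_mod f. sm (\<lambda>_. c) Y = N_act f (\<lambda>q. [:mconst c:] * q) Y) \<and>
     (\<forall>e. \<forall>Y\<in>N_mod f. sm (binom_fun (CHAR('k) ^ e)) Y = N_act f (\<lambda>q. - euler_op CHAR('k) e q) Y)"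

text \<open>
  The explicit form of the action: \<open>a\<close> acts by the diagonal operator with weight \<open>a (- n - 1)\<close> at \<open>t\<^sup>n\<close>.
\<close>

definition gamma_act :: "('n::{finite,linorder}, 'k::field) mpol \<Rightarrow>
    (nat \<Rightarrow> 'k) \<Rightarrow> ('n, 'k) mpol poly fract set set \<Rightarrow> ('n, 'k) mpol poly fract set set" where
  "gamma_act f = (\<lambda>a\<in>carrier binom_alg. \<lambda>Y\<in>N_mod f. N_act f (diag_op (reflect CHAR('k) a)) Y)"

context
  fixes p and f :: "('n::{finite,linorder}, 'k::field) mpol"
  assumes perf: "perfect_pos_char TYPE('k)" and p: "p = CHAR('k)"
begin

lemma p_pos: "p > 0"
  using p_prime[OF perf p] by (simp add: prime_gt_0_nat)

lemmas binom_functions_periodic_iff = binom_functions_iff[OF perfect_prime[OF perf] p]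

lemma diag_op_reflect_DR:
  assumes "a \<in> binom_functions" shows "(diag_op (reflect p (a :: nat \<Rightarrow> 'k)) :: ('n, 'k) mpol poly \<Rightarrow> _) \<in> DR_euler"
proof -
  obtain e where "periodic_exp p e a" using assms binom_functions_periodic_iff by blast
  then show ?thesis using diag_op_DR_euler[OF perf p periodic_reflect[OF p_pos]] by blast
qed

lemma gamma_act_N_class:
  assumes "a \<in> binom_functions" "u \<in> M_rep f"
  shows "gamma_act f a (N_class f u) = N_class f (loc_ext f (diag_op (reflect p a)) u)"
proof -
  have "N_class f u \<in> N_mod f" using assms(2) by (simp add: N_mod_eq[OF perf p])
  then have "gamma_act f a (N_class f u) = N_act f (diag_op (reflect p a)) (N_class f u)"
    using assms(1) by (simp add: gamma_act_def binom_alg_def p)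
  then show ?thesis using N_act_N_class[OF perf p diag_op_reflect_DR[OF assms(1)] assms(2)] by simp
qed

lemma gamma_act_closed:
  assumes "a \<in> binom_functions" "Y \<in> N_mod f" shows "gamma_act f a Y \<in> N_mod f"
  using assms N_act_closed[OF perf p diag_op_reflect_DR] by (simp add: gamma_act_def binom_alg_def p)

lemma gamma_module: "module binom_alg (N_record f (gamma_act f))"
proof (rule moduleI[OF cring_binom_alg abelian_group_N[OF perf p]])
  let ?N = "N_record f (gamma_act f)"
  note DR = diag_op_reflect_DR and good = DR_euler_finite_level[OF perf p diag_op_reflect_DR]
  fix a b :: "nat \<Rightarrow> 'k" and x y
  assume "a \<in> carrier binom_alg" "b \<in> carrier binom_alg" and x: "x \<in> carrier ?N"
  then have ab: "a \<in> binom_functions" "b \<in> binom_functions" by (simp_all add: binom_alg_def)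
  obtain ea eb where per: "periodic_exp p ea a" "periodic_exp p eb b" using ab binom_functions_periodic_iff by blast
  obtain u where u: "x = N_class f u" "u \<in> M_rep f" using x by (auto simp: N_record_def N_mod_eq[OF perf p])
  have uS: "u \<in> loc_ring f" using u(2) M_rep_subset[OF perf p] by blast
  have sum: "(\<lambda>l. a l + b l) \<in> binom_functions" and prod: "(\<lambda>l. a l * b l) \<in> binom_functions"
    using ab by (auto intro: binom_functions.intros)
  show "a \<odot>\<^bsub>?N\<^esub> x \<in> carrier ?N" using gamma_act_closed[OF ab(1)] x by (simp add: N_record_def)
  have "diag_op (reflect p (\<lambda>l. a l + b l)) = (\<lambda>x. diag_op (reflect p a) x + diag_op (reflect p b) x :: ('n, 'k) mpol poly)"
    unfolding reflect_ops(2)[OF p_pos per] by (simp add: diag_op_plus fun_eq_iff)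
  then have "loc_ext f (diag_op (reflect p (\<lambda>l. a l + b l))) u =
      loc_ext f (diag_op (reflect p a)) u + loc_ext f (diag_op (reflect p b)) u"
    using loc_ext_plus[OF perf p good[OF ab(1)] good[OF ab(2)] uS] by simp
  then show "(a \<oplus>\<^bsub>binom_alg\<^esub> b) \<odot>\<^bsub>?N\<^esub> x = a \<odot>\<^bsub>?N\<^esub> x \<oplus>\<^bsub>?N\<^esub> b \<odot>\<^bsub>?N\<^esub> x"
    using gamma_act_N_class[OF sum u(2)] gamma_act_N_class[OF ab(1) u(2)] gamma_act_N_class[OF ab(2) u(2)]
    by (simp add: N_record_def binom_alg_def u(1) N_class_add[OF perf p])
  have "diag_op (reflect p (\<lambda>l. a l * b l)) = (diag_op (reflect p a) \<circ> diag_op (reflect p b) :: ('n, 'k) mpol poly \<Rightarrow> _)"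
    unfolding reflect_ops(3)[OF p_pos per] by (simp add: diag_op_times fun_eq_iff)
  then have "loc_ext f (diag_op (reflect p (\<lambda>l. a l * b l))) u =
      loc_ext f (diag_op (reflect p a)) (loc_ext f (diag_op (reflect p b)) u)"
    using loc_ext_comp[OF perf p good[OF ab(1)] good[OF ab(2)] uS] by simp
  then show "(a \<otimes>\<^bsub>binom_alg\<^esub> b) \<odot>\<^bsub>?N\<^esub> x = a \<odot>\<^bsub>?N\<^esub> (b \<odot>\<^bsub>?N\<^esub> x)"
    using gamma_act_N_class[OF prod u(2)] gamma_act_N_class[OF ab(2) u(2)]
      gamma_act_N_class[OF ab(1) M_rep_L[OF perf p DR[OF ab(2)] u(2)]]
    by (simp add: N_record_def binom_alg_def u(1))
  assume "y \<in> carrier ?N"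
  then obtain v where v: "y = N_class f v" "v \<in> M_rep f" by (auto simp: N_record_def N_mod_eq[OF perf p])
  have vS: "v \<in> loc_ring f" using v(2) M_rep_subset[OF perf p] by blast
  show "a \<odot>\<^bsub>?N\<^esub> (x \<oplus>\<^bsub>?N\<^esub> y) = a \<odot>\<^bsub>?N\<^esub> x \<oplus>\<^bsub>?N\<^esub> a \<odot>\<^bsub>?N\<^esub> y"
    using gamma_act_N_class[OF ab(1) M_rep_add[OF perf p u(2) v(2)]]
      gamma_act_N_class[OF ab(1) u(2)] gamma_act_N_class[OF ab(1) v(2)]
      loc_ext_add[OF perf p good[OF ab(1)] uS vS]
    by (simp add: N_record_def u(1) v(1) N_class_add[OF perf p])
next
  let ?N = "N_record f (gamma_act f)"
  fix x assume "x \<in> carrier ?N"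
  then obtain u where u: "x = N_class f u" "u \<in> M_rep f" by (auto simp: N_record_def N_mod_eq[OF perf p])
  have uS: "u \<in> loc_ring f" using u(2) M_rep_subset[OF perf p] by blast
  have one: "(\<lambda>_. 1 :: 'k) \<in> binom_functions" by (rule binom_functions.intros)
  have "diag_op (reflect p (\<lambda>_. 1 :: 'k)) = (\<lambda>x. 1 * x :: ('n, 'k) mpol poly)"
    unfolding reflect_ops(1)[OF p_pos] by (simp add: diag_op_const fun_eq_iff mconst_simps flip: one_pCons)
  then have "loc_ext f (diag_op (reflect p (\<lambda>_. 1 :: 'k))) u = u"
    using loc_ext_mult[OF perf p uS, of 1] by simp
  then show "\<one>\<^bsub>binom_alg\<^esub> \<odot>\<^bsub>?N\<^esub> x = x"
    using gamma_act_N_class[OF one u(2)] by (simp add: N_record_def binom_alg_def u(1))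
qed

lemma diag_op_reflect_const: "diag_op (reflect p (\<lambda>_. c :: 'k)) = (\<lambda>q. [:mconst c:] * q :: ('n, 'k) mpol poly)"
  unfolding reflect_ops(1)[OF p_pos] by (simp add: diag_op_const fun_eq_iff)

lemma diag_op_reflect_digit:
  "diag_op (reflect p (binom_fun (p ^ e) :: nat \<Rightarrow> 'k)) = (\<lambda>q. - euler_op p e q :: ('n, 'k) mpol poly)"
proof
  fix x :: "('n, 'k) mpol poly"
  have "reflect p (binom_fun (p ^ e)) = (\<lambda>n. - 1 * (of_nat (n div p ^ e) + 1) :: 'k)"
    by (rule ext) (simp only: reflect_binom_fun[OF perfect_prime[OF perf] p] mult_minus1)
  then have "diag_op (reflect p (binom_fun (p ^ e) :: nat \<Rightarrow> 'k)) x =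
      diag_op (\<lambda>_. - 1) (diag_op (\<lambda>n. of_nat (n div p ^ e) + 1) x)"
    by (simp only: diag_op_times)
  also have "\<dots> = - euler_op p e x"
    unfolding euler_op_p[OF perf p] by (rule poly_eqI) (simp add: mconst_simps)
  finally show "diag_op (reflect p (binom_fun (p ^ e) :: nat \<Rightarrow> 'k)) x = - euler_op p e x" .
qed

lemma gamma_act_spec: "gamma_spec f (gamma_act f)"
  unfolding gamma_spec_def
proof (intro conjI allI ballI)
  show "gamma_act f \<in> carrier binom_alg \<rightarrow>\<^sub>E (N_mod f \<rightarrow>\<^sub>E N_mod f)"
    using gamma_act_closed unfolding gamma_act_def by (simp add: PiE_iff binom_alg_def)
  show "module binom_alg (N_record f (gamma_act f))" by (rule gamma_module)
  fix Y assume Y: "Y \<in> N_mod f"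
  show "gamma_act f (\<lambda>_. c) Y = N_act f (\<lambda>q. [:mconst c:] * q) Y" for c
    using Y binom_functions.intros(1)[of c] diag_op_reflect_const[of c] by (simp add: gamma_act_def binom_alg_def p)
  show "gamma_act f (binom_fun (CHAR('k) ^ e)) Y = N_act f (\<lambda>q. - euler_op CHAR('k) e q) Y" for e
  proof -
    have "(binom_fun (CHAR('k) ^ e) :: nat \<Rightarrow> 'k) \<in> binom_functions" by (rule binom_functions.intros)
    then show ?thesis using Y diag_op_reflect_digit[of e] by (simp add: gamma_act_def binom_alg_def p)
  qed
qed

text \<open>
  The elements of \<open>A\<^sub>k\<close> on which two structures agree form a subalgebra that contains constants and digit
  functions, hence all periodic functions.
\<close>

lemma gamma_spec_unique:
  assumes 1: "gamma_spec f sm" and 2: "gamma_spec f sm'" shows "sm = sm'"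
proof -
  interpret m1: module binom_alg "N_record f sm" using 1 by (simp add: gamma_spec_def)
  interpret m2: module binom_alg "N_record f sm'" using 2 by (simp add: gamma_spec_def)
  have ext: "sm \<in> binom_functions \<rightarrow>\<^sub>E (N_mod f \<rightarrow>\<^sub>E N_mod f)" "sm' \<in> binom_functions \<rightarrow>\<^sub>E (N_mod f \<rightarrow>\<^sub>E N_mod f)"
    using 1 2 by (simp_all add: gamma_spec_def binom_alg_def)
  have eq: "a \<in> binom_functions \<and> (\<forall>Y\<in>N_mod f. sm a Y = sm' a Y)" if a: "a \<in> binom_functions" for a
  proof -
    obtain e where "periodic_exp p e a" using a binom_functions_periodic_iff by blast
    then show ?thesis
    proof (rule periodic_induct[OF perfect_prime[OF perf] p])
      show "(\<lambda>_. c) \<in> binom_functions \<and> (\<forall>Y\<in>N_mod f. sm (\<lambda>_. c) Y = sm' (\<lambda>_. c) Y)" for c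
        using 1 2 binom_functions.intros(1) by (simp add: gamma_spec_def)
      show "binom_fun (p ^ i) \<in> binom_functions \<and> (\<forall>Y\<in>N_mod f. sm (binom_fun (p ^ i)) Y = sm' (binom_fun (p ^ i)) Y)" for i
        using 1 2 binom_functions.intros(2) by (simp add: gamma_spec_def p)
      fix a b
      assume a: "a \<in> binom_functions \<and> (\<forall>Y\<in>N_mod f. sm a Y = sm' a Y)"
        and b: "b \<in> binom_functions \<and> (\<forall>Y\<in>N_mod f. sm b Y = sm' b Y)"
      have "sm (\<lambda>l. a l + b l) Y = sm' (\<lambda>l. a l + b l) Y" if "Y \<in> N_mod f" for Y
        using m1.smult_l_distr[of a b Y] m2.smult_l_distr[of a b Y] a b that
        by (simp add: binom_alg_def N_record_def)
      then show "(\<lambda>l. a l + b l) \<in> binom_functions \<and> (\<forall>Y\<in>N_mod f. sm (\<lambda>l. a l + b l) Y = sm' (\<lambda>l. a l + b l) Y)"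
        using a b binom_functions.intros(3) by blast
      have "sm (\<lambda>l. a l * b l) Y = sm' (\<lambda>l. a l * b l) Y" if "Y \<in> N_mod f" for Y
      proof -
        have "sm b Y \<in> N_mod f" using ext(1) b that by (auto simp: PiE_iff)
        then show ?thesis
          using m1.smult_assoc1[of a b Y] m2.smult_assoc1[of a b Y] a b that
          by (simp add: binom_alg_def N_record_def)
      qed
      then show "(\<lambda>l. a l * b l) \<in> binom_functions \<and> (\<forall>Y\<in>N_mod f. sm (\<lambda>l. a l * b l) Y = sm' (\<lambda>l. a l * b l) Y)"
        using a b binom_functions.intros(4) by blast
    qed
  qed
  have "sm a = sm' a" if a: "a \<in> binom_functions" for a
  proof (rule PiE_ext)
    show "sm a \<in> N_mod f \<rightarrow>\<^sub>E N_mod f" "sm' a \<in> N_mod f \<rightarrow>\<^sub>E N_mod f"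
      using PiE_mem[OF ext(1) a] PiE_mem[OF ext(2) a] .
  qed (use eq[OF a] in blast)
  then show ?thesis by (rule PiE_ext[OF ext])
qed

lemma gamma_smult_eq: "gamma_smult f = gamma_act f"
  unfolding gamma_smult_def gamma_spec_def[symmetric]
  using gamma_act_spec gamma_spec_unique by (intro the_equality) auto

lemma b_function_iff:
  "a \<in> b_function f \<longleftrightarrow> a \<in> binom_functions \<and> (\<forall>u\<in>M_rep f. N_class f (loc_ext f (diag_op (reflect p a)) u) = tM_mod f)"
  unfolding b_function_def annihilator_def N_gamma_def gamma_smult_eq
  using gamma_act_N_class by (auto simp: N_record_def binom_alg_def N_mod_eq[OF perf p])

end

section \<open>Annihilation by indicators of residue classes\<close>

definition residue_op :: "nat \<Rightarrow> nat \<Rightarrow> nat \<Rightarrow> ('n::{finite,linorder}, 'k::field) mpol poly \<Rightarrow> ('n, 'k) mpol poly" where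
  "residue_op p q j = diag_op (reflect p (residue_ind q j))"

context
  fixes p e q :: nat and f :: "('n::{finite,linorder}, 'k::field) mpol"
  assumes perf: "perfect_pos_char TYPE('k)" and p: "p = CHAR('k)" and q: "q = p ^ e"
begin

text \<open>
  Both follow from \<open>(f - t)\<^sup>q = f\<^sup>q - t\<^sup>q\<close>, the second by dividing by \<open>f - t\<close>.
\<close>

lemma h_power:
  "[:f, -1:] ^ q = [:f ^ q:] - monom 1 q"
  "[:f, -1:] ^ (q - 1) = (\<Sum>i<q. monom (f ^ i) (q - 1 - i))"
proof -
  have q0: "q > 0" using p_pos[OF perf p] q by simp
  let ?X = "[:0, 1:] :: ('n, 'k) mpol poly"
  have h: "[:f, -1:] = [:f:] - ?X" by simp
  have "([:f, -1:] + ?X) ^ q = [:f, -1:] ^ q + ?X ^ q"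
    by (rule freshmans_dream'[where n = e]) (simp_all add: mpol_char_p[OF perf p] p_prime[OF perf p] q)
  then have hq: "[:f, -1:] ^ q = [:f:] ^ q - ?X ^ q" by simp
  then show "[:f, -1:] ^ q = [:f ^ q:] - monom 1 q" by (simp add: poly_const_pow monom_altdef)
  obtain q' where q': "q = Suc q'" using q0 by (cases q) auto
  have "[:f, -1:] * [:f, -1:] ^ (q - 1) = [:f:] ^ q - ?X ^ q" using hq by (simp add: q')
  also have "\<dots> = [:f, -1:] * (\<Sum>i<q. [:f:] ^ i * ?X ^ (q - 1 - i))"
    unfolding q' h by (simp only: diff_power_eq_sum diff_Suc_1)
  finally have "[:f, -1:] ^ (q - 1) = (\<Sum>i<q. [:f:] ^ i * ?X ^ (q - 1 - i))"
    by (rule mult_left_cancel[THEN iffD1, rotated]) simp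
  also have "\<dots> = (\<Sum>i<q. monom (f ^ i) (q - 1 - i))"
    by (rule sum.cong) (simp_all add: poly_const_pow monom_altdef)
  finally show "[:f, -1:] ^ (q - 1) = (\<Sum>i<q. monom (f ^ i) (q - 1 - i))" .
qed

lemma residue_op_frob_lin: "frob_lin q (residue_op p q j :: ('n, 'k) mpol poly \<Rightarrow> _)"
  unfolding residue_op_def q using frob_lin_diag_op[OF perf p periodic_reflect[OF p_pos[OF perf p] periodic_residue_ind]] .

lemma residue_op_DR: "(residue_op p q j :: ('n, 'k) mpol poly \<Rightarrow> _) \<in> DR_euler"
  unfolding residue_op_def q using diag_op_DR_euler[OF perf p periodic_reflect[OF p_pos[OF perf p] periodic_residue_ind]] .

lemma residue_op_h: assumes j: "j < q" shows "residue_op p q j ([:f, -1:] ^ (q - 1)) = monom (f ^ j) (q - 1 - j)"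
proof -
  have w: "reflect p (residue_ind q j) n = (if n mod q = q - 1 - j then 1 else 0 :: 'k)" for n
    unfolding q by (rule reflect_residue_ind[OF p_pos[OF perf p] j[unfolded q]])
  have dsum: "residue_op p q j (\<Sum>i\<in>I. g i) = (\<Sum>i\<in>I. residue_op p q j (g i))" if "finite I" for I :: "nat set" and g :: "nat \<Rightarrow> ('n, 'k) mpol poly"
    using that by (induction I rule: finite_induct)
      (simp_all add: frob_linD(1)[OF residue_op_frob_lin] frob_lin_zero[OF residue_op_frob_lin])
  have "residue_op p q j ([:f, -1:] ^ (q - 1)) = (\<Sum>i<q. residue_op p q j (monom (f ^ i) (q - 1 - i)))"
    unfolding h_power(2) by (rule dsum) simp
  also have "\<dots> = (\<Sum>i<q. if i = j then monom (f ^ i) (q - 1 - i) else 0)"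
  proof (rule sum.cong)
    fix i assume i: "i \<in> {..<q}"
    then have "(q - 1 - i) mod q = q - 1 - i" by simp
    moreover have "q - 1 - i = q - 1 - j \<longleftrightarrow> i = j" using i j by auto
    ultimately show "residue_op p q j (monom (f ^ i) (q - 1 - i)) = (if i = j then monom (f ^ i) (q - 1 - i) else 0)"
      unfolding residue_op_def diag_op_monom w by (simp add: mconst_simps)
  qed simp
  also have "\<dots> = monom (f ^ j) (q - 1 - j)" using j by (simp add: sum.delta)
  finally show ?thesis .
qed

text \<open>
  The generator is \<open>(f - t)\<^bsup>q - 1\<^esup> / (f - t)\<^sup>q\<close>, and the idempotent selects one monomial in \<open>t\<close> of the numerator.
\<close>

lemma residue_op_delta: assumes j: "j < q"
  shows "loc_ext f (residue_op p q j) (1 / f_sub_t f) = to_fract (monom (f ^ j) (q - 1 - j)) / f_sub_t f ^ q"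
proof -
  have q0: "q > 0" using p_pos[OF perf p] q by simp
  have "to_fract ([:f, -1:] ^ (q - 1)) / f_sub_t f ^ (q * 1) = 1 / f_sub_t f"
  proof -
    have "f_sub_t f ^ q = f_sub_t f * f_sub_t f ^ (q - 1)" using q0 by (cases q) auto
    then show ?thesis using f_sub_t_nonzero[of f] by (simp add: to_fract_power)
  qed
  then show ?thesis
    using loc_ext_props(2)[OF perf p q residue_op_frob_lin, of f j "[:f, -1:] ^ (q - 1)" 1] residue_op_h[OF j]
    by simp
qed

text \<open>
  With \<open>f\<^sup>j = P (f\<^bsup>j + 1\<^esup>)\<close> the monomial selected by the idempotent becomes \<open>t\<close> times the image under \<open>P\<close> of the
  next one. It is enough to treat the generator, because the idempotent commutes with all operators
  that generate \<open>M\<close> and these preserve \<open>t M\<close>.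
\<close>

lemma not_jump_annihilates:
  assumes j: "j < q" "j \<notin> jumps f q"
  shows "(residue_ind q j :: nat \<Rightarrow> 'k) \<in> b_function f"
proof -
  have q0: "q > 0" using j by simp
  let ?X = "[:0, 1:] :: ('n, 'k) mpol poly"
  let ?\<delta> = "1 / f_sub_t f"
  obtain P0 where P0: "frob_lin q P0" "P0 (f ^ Suc j) = f ^ j" using j unfolding jumps_def by blast
  define P where "P = map_poly P0"
  have Pfl: "frob_lin q P"
    unfolding P_def by (rule map_poly_frob_lin[OF mpol_char_p(1)[OF perf p] _ P0(1), where e = e])
      (simp add: mpol_char_p(2)[OF perf p] q)
  have PDR: "P \<in> DR_euler" unfolding P_def using map_poly_DR_euler[OF perf p] P0(1) q by blast
  have Pmonom: "P (monom c n) = monom (P0 c) n" for c n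
    unfolding P_def by (rule poly_eqI) (simp add: coeff_map_poly frob_lin_zero[OF P0(1)])
  have PX: "P (?X * x) = ?X * P x" for x
    unfolding P_def by (rule poly_eqI)
      (simp add: coeff_map_poly frob_lin_zero[OF P0(1)] coeff_pCons split: nat.split)
  have LP: "loc_ext f P (to_fract a / f_sub_t f ^ q) = to_fract (P a) / f_sub_t f ^ q" for a
    using loc_ext_props(2)[OF perf p q Pfl, of f a 1] by simp
  have step: "to_fract (P (?X * residue_op p q i ([:f, -1:] ^ (q - 1)))) / f_sub_t f ^ q =
      to_fract ?X * loc_ext f P (loc_ext f (residue_op p q i) ?\<delta>)" if "i < q" for i
    unfolding residue_op_delta[OF that] LP PX residue_op_h[OF that] by (simp only: to_fract_mult times_divide_eq_right)
  have mem: "loc_ext f P (loc_ext f (residue_op p q i) ?\<delta>) \<in> M_rep f" for i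
    by (intro M_rep_L[OF perf p PDR] M_repI[OF perf p] residue_op_DR)
  have "loc_ext f (residue_op p q j) ?\<delta> \<in> T_rep f"
  proof (cases "Suc j < q")
    case True
    have "?X * residue_op p q (Suc j) ([:f, -1:] ^ (q - 1)) = monom (f ^ Suc j) (q - 1 - j)"
    proof -
      have "q - 1 - j = Suc (q - 1 - Suc j)" using True by simp
      then show ?thesis unfolding residue_op_h[OF True] by (simp add: monom_Suc)
    qed
    then have "P (?X * residue_op p q (Suc j) ([:f, -1:] ^ (q - 1))) = monom (f ^ j) (q - 1 - j)"
      by (simp only: Pmonom P0(2))
    then have "loc_ext f (residue_op p q j) ?\<delta> = to_fract ?X * loc_ext f P (loc_ext f (residue_op p q (Suc j)) ?\<delta>) + to_fract 0"
      unfolding residue_op_delta[OF j(1)] step[OF True, symmetric] by simp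
    then show ?thesis using T_repI[OF perf p mem] by (simp only:)
  next
    case False
    then have jq: "Suc j = q" using j(1) by simp
    (* f^q = (f - t)^q + t^q: the first summand cancels the denominator, the second is a multiple of t *)
    have "monom (f ^ Suc j) 0 = [:f, -1:] ^ q * 1 + ?X * residue_op p q 0 ([:f, -1:] ^ (q - 1))"
    proof -
      have "?X * monom 1 (q - 1) = monom 1 q" using q0 by (cases q) (simp_all add: monom_Suc)
      then show ?thesis unfolding residue_op_h[OF q0] h_power(1) jq by (simp add: monom_0)
    qed
    then have "P (monom (f ^ Suc j) 0) = [:f, -1:] ^ q * P 1 + P (?X * residue_op p q 0 ([:f, -1:] ^ (q - 1)))"
      by (simp only: frob_linD[OF Pfl])
    moreover have "q - 1 - j = 0" using jq by simp
    ultimately have "monom (f ^ j) (q - 1 - j) = [:f, -1:] ^ q * P 1 + P (?X * residue_op p q 0 ([:f, -1:] ^ (q - 1)))"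
      by (simp only: Pmonom P0(2))
    then have "loc_ext f (residue_op p q j) ?\<delta> =
        to_fract ([:f, -1:] ^ q * P 1) / f_sub_t f ^ q + to_fract (P (?X * residue_op p q 0 ([:f, -1:] ^ (q - 1)))) / f_sub_t f ^ q"
      unfolding residue_op_delta[OF j(1)] by (simp only: to_fract_add add_divide_distrib)
    moreover have "to_fract ([:f, -1:] ^ q * P 1) / f_sub_t f ^ q = to_fract (P 1)"
      using f_sub_t_nonzero[of f] by (simp add: to_fract_power)
    ultimately have "loc_ext f (residue_op p q j) ?\<delta> = to_fract ?X * loc_ext f P (loc_ext f (residue_op p q 0) ?\<delta>) + to_fract (P 1)"
      unfolding step[OF q0] by (simp only: add.commute)
    then show ?thesis using T_repI[OF perf p mem] by (simp only:)
  qed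
  note delta_T = this
  have kill: "loc_ext f (residue_op p q j) u \<in> T_rep f" if u: "u \<in> M_rep f" for u
  proof -
    obtain Q r where Q: "Q \<in> DR_euler" "u = loc_ext f Q ?\<delta> + to_fract r"
      using u unfolding M_rep_def by blast
    note good = DR_euler_finite_level[OF perf p Q(1)] and goodi = DR_euler_finite_level[OF perf p residue_op_DR]
    note inv = inv_mem[OF perf p, of f]
    have eq: "residue_op p q j \<circ> Q = Q \<circ> residue_op p q j"
      unfolding residue_op_def o_def using DR_euler_diag_op_commute[OF perf p Q(1)] by simp
    have "loc_ext f (residue_op p q j) (loc_ext f Q ?\<delta>) = loc_ext f Q (loc_ext f (residue_op p q j) ?\<delta>)"
      unfolding loc_ext_comp[OF perf p goodi good inv, symmetric]
        loc_ext_comp[OF perf p good goodi inv, symmetric] eq ..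
    then have "loc_ext f (residue_op p q j) u = loc_ext f Q (loc_ext f (residue_op p q j) ?\<delta>) + to_fract (residue_op p q j r)"
      unfolding Q(2)
      by (simp only: loc_ext_add[OF perf p goodi loc_ext_mem[OF perf p good inv] to_fract_loc_ring]
          loc_ext_to_fract[OF perf p goodi])
    then show ?thesis
      using T_rep_add[OF perf p T_rep_L[OF perf p Q(1) delta_T] to_fract_T_rep[OF perf p]] by simp
  qed
  have "residue_ind q j \<in> (binom_functions :: (nat \<Rightarrow> 'k) set)"
    unfolding q using binom_functions_iff[OF perfect_prime[OF perf] p] periodic_residue_ind by blast
  then show ?thesis
    unfolding b_function_iff[OF perf p] using N_class_zero[OF perf p kill] unfolding residue_op_def by blast
qed

end

section \<open>Roots\<close>

lemma digit_trunc_mod: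
  assumes "z \<in> padic_ints p" "e \<le> E" shows "digit_trunc p z E mod p ^ e = digit_trunc p z e"
proof -
  have "digit_trunc p z E mod p ^ e = digit_trunc p z e mod p ^ e"
    unfolding mod_power_eq_iff_digits using digit_trunc_digit[OF assms(1)] assms(2) by simp
  then show ?thesis using digit_trunc_less[OF assms(1)] by simp
qed

text \<open>
  Evaluation at the truncations of \<open>z\<close> is eventually the evaluation of a periodic function at \<open>z\<close>; the
  functions that vanish there form an ideal, which contains the generators of the ideal of \<open>z\<close>.
\<close>

lemma root_ideal_vanishes:
  assumes perf: "perfect_pos_char TYPE('k::field)" and p: "p = CHAR('k)"
    and z: "z \<in> padic_ints p" and a: "(a :: nat \<Rightarrow> 'k) \<in> root_ideal z"
  shows "\<exists>E. \<forall>e\<ge>E. a (digit_trunc p z e) = 0"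
proof -
  let ?I = "{a \<in> binom_functions. \<exists>E. \<forall>e\<ge>E. a (digit_trunc p z e) = (0 :: 'k)}"
  interpret A: cring "binom_alg :: (nat \<Rightarrow> 'k) ring" by (rule cring_binom_alg)
  have carr: "carrier binom_alg = (binom_functions :: (nat \<Rightarrow> 'k) set)" by (simp add: binom_alg_def)
  have I_add: "(\<lambda>l. a l + b l) \<in> ?I" if ab: "a \<in> ?I" "b \<in> ?I" for a b
  proof -
    obtain E E' where "\<forall>e\<ge>E. a (digit_trunc p z e) = 0" "\<forall>e\<ge>E'. b (digit_trunc p z e) = 0" using ab by blast
    then have "\<forall>e\<ge>max E E'. a (digit_trunc p z e) + b (digit_trunc p z e) = 0" by simp
    then show ?thesis using ab binom_functions.intros(3)[of a b] by blast
  qed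
  have I_mult: "(\<lambda>l. b l * a l) \<in> ?I" if ab: "a \<in> ?I" "b \<in> binom_functions" for a b
  proof -
    obtain E where "\<forall>e\<ge>E. a (digit_trunc p z e) = 0" using ab by blast
    then have "\<forall>e\<ge>E. b (digit_trunc p z e) * a (digit_trunc p z e) = 0" by simp
    then show ?thesis using ab binom_functions.intros(4)[of b a] by blast
  qed
  have "ideal ?I binom_alg"
  proof (rule idealI)
    show "ring (binom_alg :: (nat \<Rightarrow> 'k) ring)" by (rule A.ring_axioms)
    show "subgroup ?I (add_monoid binom_alg)"
    proof (rule A.add.subgroupI)
      show "?I \<subseteq> carrier binom_alg" by (auto simp: carr)
      show "?I \<noteq> {}" using binom_functions.intros(1)[of "0 :: 'k"] by blast
      fix a b :: "nat \<Rightarrow> 'k" assume a: "a \<in> ?I"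
      have neg: "(\<lambda>l. - 1 * a l) \<in> ?I" by (rule I_mult[OF a]) (rule binom_functions.intros)
      have "\<ominus>\<^bsub>binom_alg\<^esub> a = (\<lambda>l. - 1 * a l)"
        by (rule A.minus_equality) (use a neg in \<open>auto simp: binom_alg_def\<close>)
      then show "\<ominus>\<^bsub>binom_alg\<^esub> a \<in> ?I" using neg by simp
      assume "b \<in> ?I"
      then show "a \<oplus>\<^bsub>binom_alg\<^esub> b \<in> ?I" using I_add[OF a] by (simp add: binom_alg_def)
    qed
    fix a b :: "nat \<Rightarrow> 'k" assume ab: "a \<in> ?I" "b \<in> carrier binom_alg"
    then have "(\<lambda>l. b l * a l) \<in> ?I" by (intro I_mult) (auto simp: carr)
    then show "b \<otimes>\<^bsub>binom_alg\<^esub> a \<in> ?I" "a \<otimes>\<^bsub>binom_alg\<^esub> b \<in> ?I"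
      by (simp_all add: binom_alg_def mult.commute)
  qed
  moreover have "{(\<lambda>l. binom_fun (CHAR('k) ^ e) l - of_nat (z e)) | e. True} \<subseteq> ?I"
  proof
    fix b :: "nat \<Rightarrow> 'k" assume "b \<in> {(\<lambda>l. binom_fun (CHAR('k) ^ e) l - of_nat (z e)) | e. True}"
    then obtain i where b: "b = (\<lambda>l. binom_fun (p ^ i) l + - of_nat (z i))" by (auto simp: p)
    have "b (digit_trunc p z e) = 0" if "e \<ge> Suc i" for e
    proof -
      have "digit_trunc p z e div p ^ i mod p = z i mod p"
        using digit_trunc_digit[OF z, of i e] that z by (simp add: padic_ints_def)
      then show ?thesis
        unfolding b binom_fun_prime_power[OF perfect_prime[OF perf] p]
        using of_nat_eq_iff_mod[OF perfect_prime[OF perf] p, of "digit_trunc p z e div p ^ i" "z i"] by simp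
    qed
    moreover have "b \<in> binom_functions" unfolding b by (intro binom_functions.intros)
    ultimately show "b \<in> ?I" by blast
  qed
  ultimately have "root_ideal z \<subseteq> ?I" unfolding root_ideal_def by (rule A.genideal_minimal)
  then show ?thesis using a by blast
qed

text \<open>
  Otherwise the \<open>b\<close>-function contains the indicator of the class of \<open>z\<close> modulo \<open>p\<^sup>e\<close>, which has value \<open>1\<close> at \<open>z\<close>.
\<close>

lemma roots_subset:
  fixes f :: "('n::{finite,linorder}, 'k::field) mpol"
  assumes perf: "perfect_pos_char TYPE('k)" and z: "z \<in> roots (b_function f)"
  shows "digit_trunc CHAR('k) z e \<in> jumps f (CHAR('k) ^ e)"
proof (rule ccontr)
  define p where "p = CHAR('k)"
  have zp: "z \<in> padic_ints p" and sub: "b_function f \<subseteq> root_ideal z"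
    using z by (simp_all add: roots_def p_def)
  assume "\<not> ?thesis"
  then have "(residue_ind (p ^ e) (digit_trunc p z e) :: nat \<Rightarrow> 'k) \<in> b_function f"
    using not_jump_annihilates[OF perf p_def refl, of "digit_trunc p z e" e f] digit_trunc_less[OF zp, of e] by (simp add: p_def)
  then obtain E where E: "\<forall>e'\<ge>E. residue_ind (p ^ e) (digit_trunc p z e) (digit_trunc p z e') = (0 :: 'k)"
    using root_ideal_vanishes[OF perf p_def zp] sub by blast
  have "residue_ind (p ^ e) (digit_trunc p z e) (digit_trunc p z (max e E)) = (1 :: 'k)"
    using digit_trunc_mod[OF zp, of e "max e E"] digit_trunc_less[OF zp, of e] by (simp add: residue_ind_def)
  then show False using E by simp
qed

theorem theoremC:
  fixes g :: "('n::{finite,linorder}, 'k::field) mpol"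
  assumes "perfect_pos_char TYPE('k)"
    and "g \<notin> range mconst"
  shows "finite (roots (b_function g)) \<and>
    (\<forall>z \<in> roots (b_function g). \<exists>r::rat. padic_eq_rat CHAR('k) z r \<and> - 1 \<le> r \<and> r < 0)"
proof -
  have g: "g \<noteq> 0" using assms(2) mconst_simps(3) by (metis rangeI)
  let ?Z = "{z \<in> padic_ints CHAR('k). \<forall>e. digit_trunc CHAR('k) z e \<in> jumps g (CHAR('k) ^ e)}"
  have sub: "roots (b_function g) \<subseteq> ?Z"
    using roots_subset[OF assms(1)] by (auto simp: roots_def)
  show ?thesis
    using finite_subset[OF sub jump_limits_rational(1)[OF assms(1) g]]
      jump_limits_rational(2)[OF assms(1) g] sub by blast
qed

end
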